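(* Let $w$ be a signed Gauss word on letters $a_1,\dots,a_n$ with minimal realization $(S_w,\gamma_w)$. For each $i$ write $w=a_iw_{a_i}a_i^{-1}\widetilde w_{a_i}$ (up to cyclic permutation), and let $S_{a_i}(w)$ be the set of all symbols $a^p$ ($a\in\{a_1,\dots,a_n\}$, $p=\pm1$) that occur in $w_{a_i}$. Let $\alpha_{a_i}(w)=\langle\varphi_w,\varphi_{a_i}\rangle$, where $\varphi_w$ and $\varphi_{a_i}$ are the classes in $H_1(S_w,\mathbb Z)$ of $\gamma_w$ and of the curve $\gamma_{a_i}$ obtained by splitting the crossing $a_i$. Then, for every $i=1,2,\dots,n$, $$\alpha_{a_i}(w)=\sum_{a^p\in S_{a_i}(w)}p.$$
   Context: Surfaces are compact, oriented, triangulated (PL) 2-manifolds. An oriented PL-normal curve (one component) on a connected surface $\Sigma$ is an oriented closed trail in the 1-skeleton whose only self-intersections are transverse double points (crossings). At a crossing one of the two strands travels the crossing positively and the other negatively: a strand travels it positively iff the other strand crosses it from its left to its right. A signed Gauss word on letters $a_1,\dots,a_n$ is a word, considered up to cyclic permutation, in which each of the symbols $a_1,\dots,a_n,a_1^{-1},\dots,a_n^{-1}$ occurs exactly once. $(\Sigma,\gamma)$ is a realization of $w$ if the crossings of $\gamma$ can be labelled $a_1,\dots,a_n$ so that following $\gamma$ and writing $a_i$ (resp. $a_i^{-1}$) each time $a_i$ is travelled positively (resp. negatively) gives $w$. A minimal realization is a realization on a closed connected surface of minimum genus among all realizations of $w$ on closed connected surfaces. Splitting: smoothing the crossing $a_i$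 consistently with the orientation of $\gamma_w$ yields an oriented curve of two components $\gamma'_{a_i}\cup\gamma_{a_i}$ with signed Gauss paragraph $\{w_{a_i},\widetilde w_{a_i}\}$: $\gamma'_{a_i}$ reads $w_{a_i}$ and $\gamma_{a_i}$ reads $\widetilde w_{a_i}$. Intersection number: for transverse oriented curves $\gamma_1,\gamma_2$ on an oriented surface, $\langle\gamma_1,\gamma_2\rangle=\sum_{c\in\gamma_1\cap\gamma_2}\epsilon_c$ with $\epsilon_c=+1$ if $\gamma_1$ travels $c$ positively and $-1$ if negatively. For homology classes, $\langle\varphi_1,\varphi_2\rangle$ is the value on transverse representatives. *)

theory Defs
  imports Main "HOL-Library.Infinite_Typeclass"
begin

section \<open>Closed oriented triangulated surfaces\<close>

text \<open>A triangulated oriented surface is given by its positively oriented triangles: \<open>(a, b, c)\<close>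
  means that \<open>a\<close>, \<open>b\<close>, \<open>c\<close> are the corners of a triangle in counterclockwise order, so the set
  contains each triangle three times, once for each cyclic rotation.\<close>

type_synonym 'v triangles = "('v \<times> 'v \<times> 'v) set"

definition rotations :: "'v \<times> 'v \<times> 'v \<Rightarrow> 'v triangles" where
  "rotations t = (case t of (a, b, c) \<Rightarrow> {(a, b, c), (b, c, a), (c, a, b)})"

definition verts :: "'v triangles \<Rightarrow> 'v set" where
  "verts T = {a. \<exists>b c. (a, b, c) \<in> T}"

definition edges :: "'v triangles \<Rightarrow> ('v \<times> 'v) set" where
  "edges T = {(a, b). \<exists>c. (a, b, c) \<in> T}"

text \<open>The neighbour of \<open>v\<close> that follows \<open>a\<close> counterclockwise around \<open>v\<close>.\<close>

definition ccw_next :: "'v triangles \<Rightarrow> 'v \<Rightarrow> 'v \<Rightarrow> 'v" where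
  "ccw_next T v a = (THE b. (v, a, b) \<in> T)"

text \<open>The fifth and sixth conditions say that every edge lies in exactly two triangles, which induce
  opposite orientations on it; the seventh says that the link of every vertex is a single cycle.\<close>

definition closed_connected_surface :: "'v triangles \<Rightarrow> bool" where
  "closed_connected_surface T \<longleftrightarrow>
     finite T \<and> T \<noteq> {} \<and>
     (\<forall>t\<in>T. rotations t \<subseteq> T) \<and>
     (\<forall>(a, b, c)\<in>T. a \<noteq> b \<and> b \<noteq> c \<and> c \<noteq> a \<and> (b, a, c) \<notin> T) \<and>
     (\<forall>a b c d. (a, b, c) \<in> T \<longrightarrow> (a, b, d) \<in> T \<longrightarrow> c = d) \<and>
     (\<forall>a b c. (a, b, c) \<in> T \<longrightarrow> (\<exists>d. (b, a, d) \<in> T)) \<and>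
     (\<forall>v x y. (v, x) \<in> edges T \<longrightarrow> (v, y) \<in> edges T \<longrightarrow> (\<exists>k. (ccw_next T v ^^ k) x = y)) \<and>
     (\<forall>u\<in>verts T. \<forall>v\<in>verts T. (u, v) \<in> (edges T)\<^sup>*)"

text \<open>\<open>edges T\<close> contains both orientations of each edge.\<close>

definition euler_char :: "'v triangles \<Rightarrow> int" where
  "euler_char T = int (card (verts T)) - int (card (edges T) div 2) + int (card T div 3)"

definition genus :: "'v triangles \<Rightarrow> int" where
  "genus T = (2 - euler_char T) div 2"


section \<open>Curves in the 1-skeleton\<close>

text \<open>A closed walk is the cyclic list of its vertices; its last vertex is followed by its first.\<close>

definition step :: "'v list \<Rightarrow> nat \<Rightarrow> 'v \<times> 'v" where
  "step \<gamma> i = (\<gamma> ! i, \<gamma> ! (Suc i mod length \<gamma>))"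

definition closed_walk :: "'v triangles \<Rightarrow> 'v list \<Rightarrow> bool" where
  "closed_walk T \<gamma> \<longleftrightarrow> \<gamma> \<noteq> [] \<and> (\<forall>i<length \<gamma>. step \<gamma> i \<in> edges T)"

definition closed_trail :: "'v triangles \<Rightarrow> 'v list \<Rightarrow> bool" where
  "closed_trail T \<gamma> \<longleftrightarrow> closed_walk T \<gamma> \<and>
     (\<forall>i<length \<gamma>. \<forall>j<length \<gamma>. i \<noteq> j \<longrightarrow>
        step \<gamma> i \<noteq> step \<gamma> j \<and> step \<gamma> i \<noteq> prod.swap (step \<gamma> j))"

text \<open>The strand of \<open>\<gamma>\<close> at position \<open>i\<close>: the vertices just before and just after it.\<close>

definition strand :: "'v list \<Rightarrow> nat \<Rightarrow> 'v \<times> 'v" where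
  "strand \<gamma> i = (\<gamma> ! ((i + length \<gamma> - 1) mod length \<gamma>), \<gamma> ! (Suc i mod length \<gamma>))"

text \<open>For a strand \<open>(p, q)\<close> through \<open>v\<close>, entering from \<open>p\<close> and leaving to \<open>q\<close>, the neighbours of
  \<open>v\<close> on its left are those met strictly between \<open>q\<close> and \<open>p\<close> when turning counterclockwise
  from \<open>q\<close>. The right side is the left side of the reversed strand.\<close>

definition left_side :: "'v triangles \<Rightarrow> 'v \<Rightarrow> 'v \<times> 'v \<Rightarrow> 'v set" where
  "left_side T v s = {x. \<exists>k>0. (ccw_next T v ^^ k) (snd s) = x \<and>
     (\<forall>l. 0 < l \<and> l \<le> k \<longrightarrow> (ccw_next T v ^^ l) (snd s) \<noteq> fst s)}"

text \<open>\<open>crossed_left_to_right T v s t\<close>: at \<open>v\<close> the strand \<open>s\<close> is crossed by the strand \<open>t\<close> from the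
  left of \<open>s\<close> to the right of \<open>s\<close>, that is, \<open>s\<close> travels the crossing positively.\<close>

definition crossed_left_to_right ::
    "'v triangles \<Rightarrow> 'v \<Rightarrow> 'v \<times> 'v \<Rightarrow> 'v \<times> 'v \<Rightarrow> bool" where
  "crossed_left_to_right T v s t \<longleftrightarrow> fst s \<noteq> snd s \<and>
     fst t \<in> left_side T v s \<and> snd t \<in> left_side T v (prod.swap s)"

definition transverse_at :: "'v triangles \<Rightarrow> 'v \<Rightarrow> 'v \<times> 'v \<Rightarrow> 'v \<times> 'v \<Rightarrow> bool" where
  "transverse_at T v s t \<longleftrightarrow> crossed_left_to_right T v s t \<or> crossed_left_to_right T v t s"

definition normal_curve :: "'v triangles \<Rightarrow> 'v list \<Rightarrow> bool" where
  "normal_curve T \<gamma> \<longleftrightarrow> closed_trail T \<gamma> \<and>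
     (\<forall>v. card {i. i < length \<gamma> \<and> \<gamma> ! i = v} \<le> 2) \<and>
     (\<forall>i<length \<gamma>. \<forall>j<length \<gamma>. i \<noteq> j \<longrightarrow> \<gamma> ! i = \<gamma> ! j \<longrightarrow>
        transverse_at T (\<gamma> ! i) (strand \<gamma> i) (strand \<gamma> j))"

definition crossings :: "'v list \<Rightarrow> 'v set" where
  "crossings \<gamma> = {v. \<exists>i<length \<gamma>. \<exists>j<length \<gamma>. i \<noteq> j \<and> \<gamma> ! i = v \<and> \<gamma> ! j = v}"

definition travels_positively :: "'v triangles \<Rightarrow> 'v list \<Rightarrow> nat \<Rightarrow> bool" where
  "travels_positively T \<gamma> i \<longleftrightarrow> (\<exists>j<length \<gamma>. j \<noteq> i \<and> \<gamma> ! j = \<gamma> ! i \<and>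
     crossed_left_to_right T (\<gamma> ! i) (strand \<gamma> i) (strand \<gamma> j))"


section \<open>Signed Gauss words and their realizations\<close>

text \<open>The pairs \<open>(i, 1)\<close> and \<open>(i, -1)\<close> stand for the symbols \<open>a\<^sub>i\<close> and its inverse.\<close>

definition signed_gauss_word :: "nat \<Rightarrow> (nat \<times> int) list \<Rightarrow> bool" where
  "signed_gauss_word n w \<longleftrightarrow> distinct w \<and> set w = {1..n} \<times> {1, -1}"

definition gauss_word :: "'v triangles \<Rightarrow> ('v \<Rightarrow> nat) \<Rightarrow> 'v list \<Rightarrow> (nat \<times> int) list" where
  "gauss_word T L \<gamma> = map (\<lambda>i. (L (\<gamma> ! i), if travels_positively T \<gamma> i then 1 else -1))
     (filter (\<lambda>i. \<gamma> ! i \<in> crossings \<gamma>) [0..<length \<gamma>])"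

text \<open>\<open>L\<close> is the labelling of the crossings.\<close>

definition realization ::
    "nat \<Rightarrow> (nat \<times> int) list \<Rightarrow> 'v triangles \<Rightarrow> 'v list \<Rightarrow> ('v \<Rightarrow> nat) \<Rightarrow> bool" where
  "realization n w T \<gamma> L \<longleftrightarrow> closed_connected_surface T \<and> normal_curve T \<gamma> \<and>
     bij_betw L (crossings \<gamma>) {1..n} \<and> (\<exists>k. gauss_word T L \<gamma> = rotate k w)"

text \<open>The competing surfaces have vertices in the same type. When that type is infinite, they
  comprise all closed connected triangulated surfaces up to isomorphism.\<close>

definition minimal_realization ::
    "nat \<Rightarrow> (nat \<times> int) list \<Rightarrow> 'v triangles \<Rightarrow> 'v list \<Rightarrow> ('v \<Rightarrow> nat) \<Rightarrow> bool" where
  "minimal_realization n w T \<gamma> L \<longleftrightarrow> realization n w T \<gamma> L \<and>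
     (\<forall>(T' :: 'v triangles) \<gamma>' L'. realization n w T' \<gamma>' L' \<longrightarrow> genus T \<le> genus T')"

text \<open>The symbols strictly between \<open>a\<^sub>i\<close> and its inverse, read cyclically from \<open>a\<^sub>i\<close>.\<close>

definition symbols_between :: "(nat \<times> int) list \<Rightarrow> nat \<Rightarrow> (nat \<times> int) set" where
  "symbols_between w i =
     \<Union>{set u |u. \<exists>k u'. rotate k w = (i, 1) # u @ (i, -1) # u'}"

text \<open>Smoothing at \<open>c\<close>: of the two loops into which \<open>c\<close> cuts \<open>\<gamma>\<close>, the first one, \<open>\<gamma>'\<close>, leaves \<open>c\<close>
  along the strand that travels \<open>c\<close> positively. As closed walks in the 1-skeleton the two components
  still touch at \<open>c\<close>; pulling them apart there does not change their homology classes.\<close>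

definition splitting :: "'v triangles \<Rightarrow> 'v list \<Rightarrow> 'v \<Rightarrow> 'v list \<Rightarrow> 'v list \<Rightarrow> bool" where
  "splitting T \<gamma> c \<gamma>' \<gamma>\<^sub>c \<longleftrightarrow> (\<exists>k. rotate k \<gamma> = \<gamma>' @ \<gamma>\<^sub>c \<and>
     \<gamma>' \<noteq> [] \<and> hd \<gamma>' = c \<and> \<gamma>\<^sub>c \<noteq> [] \<and> hd \<gamma>\<^sub>c = c \<and> travels_positively T (rotate k \<gamma>) 0)"

definition split_curve :: "'v triangles \<Rightarrow> 'v list \<Rightarrow> 'v \<Rightarrow> 'v list" where
  "split_curve T \<gamma> c = (THE \<gamma>\<^sub>c. \<exists>\<gamma>'. splitting T \<gamma> c \<gamma>' \<gamma>\<^sub>c)"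


section \<open>First homology\<close>

text \<open>Simplicial 1-chains with integer coefficients are antisymmetric functions on directed edges,
  extended by zero.\<close>

type_synonym 'v chain = "'v \<times> 'v \<Rightarrow> int"

definition chain_of :: "'v list \<Rightarrow> 'v chain" where
  "chain_of \<gamma> e = int (card {i. i < length \<gamma> \<and> step \<gamma> i = e})
     - int (card {i. i < length \<gamma> \<and> step \<gamma> i = prod.swap e})"

definition cycles1 :: "'v triangles \<Rightarrow> 'v chain set" where
  "cycles1 T = {z. (\<forall>a b. z (b, a) = - z (a, b)) \<and> (\<forall>e. e \<notin> edges T \<longrightarrow> z e = 0) \<and>
     (\<forall>v\<in>verts T. (\<Sum>x\<in>verts T. z (v, x)) = 0)}"

definition boundaries1 :: "'v triangles \<Rightarrow> 'v chain set" where
  "boundaries1 T = {z. \<exists>f :: 'v \<times> 'v \<times> 'v \<Rightarrow> int.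
     z = (\<lambda>e. \<Sum>(a, b, c)\<in>T. f (a, b, c) * chain_of [a, b, c] e)}"

text \<open>The class of the cycle \<open>z\<close> in the quotient of cycles by boundaries, as a coset.\<close>

definition hclass :: "'v triangles \<Rightarrow> 'v chain \<Rightarrow> 'v chain set" where
  "hclass T z = {y \<in> cycles1 T. (\<lambda>e. y e - z e) \<in> boundaries1 T}"


section \<open>Intersection numbers\<close>

definition transverse :: "'v triangles \<Rightarrow> 'v list \<Rightarrow> 'v list \<Rightarrow> bool" where
  "transverse T \<beta> \<gamma> \<longleftrightarrow> (\<forall>i<length \<beta>. \<forall>j<length \<gamma>. \<beta> ! i = \<gamma> ! j \<longrightarrow>
     transverse_at T (\<beta> ! i) (strand \<beta> i) (strand \<gamma> j))"

text \<open>The sum runs over pairs of passages through a common vertex, so that a vertex at which one of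
  the curves passes several times is counted with multiplicity.\<close>

definition intersection_number :: "'v triangles \<Rightarrow> 'v list \<Rightarrow> 'v list \<Rightarrow> int" where
  "intersection_number T \<beta> \<gamma> =
     (\<Sum>(i, j) | i < length \<beta> \<and> j < length \<gamma> \<and> \<beta> ! i = \<gamma> ! j.
        if crossed_left_to_right T (\<beta> ! i) (strand \<beta> i) (strand \<gamma> j) then 1 else -1)"

text \<open>Two homology classes need not have transverse representatives in the 1-skeleton of the given
  triangulation, so representatives are taken in iterated stellar subdivisions. \<open>subdivision T T' F\<close>
  says that \<open>T'\<close> is such a subdivision of \<open>T\<close> and that \<open>F\<close> is the induced map on 1-chains.\<close>

definition star_face :: "'v triangles \<Rightarrow> 'v \<Rightarrow> 'v \<Rightarrow> 'v \<Rightarrow> 'v \<Rightarrow> 'v triangles" where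
  "star_face T a b c m = (T - rotations (a, b, c)) \<union>
     rotations (a, b, m) \<union> rotations (b, c, m) \<union> rotations (c, a, m)"

definition star_edge :: "'v triangles \<Rightarrow> 'v \<Rightarrow> 'v \<Rightarrow> 'v \<Rightarrow> 'v \<Rightarrow> 'v \<Rightarrow> 'v triangles" where
  "star_edge T a b c d m = (T - (rotations (a, b, c) \<union> rotations (b, a, d))) \<union>
     rotations (a, m, c) \<union> rotations (m, b, c) \<union> rotations (b, m, d) \<union> rotations (m, a, d)"

definition star_edge_chain :: "'v \<Rightarrow> 'v \<Rightarrow> 'v \<Rightarrow> 'v chain \<Rightarrow> 'v chain" where
  "star_edge_chain a b m z = (\<lambda>e.
     if e = (a, b) \<or> e = (b, a) then 0
     else if e = (a, m) \<or> e = (m, b) then z (a, b)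
     else if e = (m, a) \<or> e = (b, m) then z (b, a)
     else z e)"

inductive subdivision ::
    "'v triangles \<Rightarrow> 'v triangles \<Rightarrow> ('v chain \<Rightarrow> 'v chain) \<Rightarrow> bool" for T where
  refl: "subdivision T T (\<lambda>z. z)"
| face: "subdivision T T' F \<Longrightarrow> (a, b, c) \<in> T' \<Longrightarrow> m \<notin> verts T' \<Longrightarrow>
    subdivision T (star_face T' a b c m) F"
| edge: "subdivision T T' F \<Longrightarrow> (a, b, c) \<in> T' \<Longrightarrow> (b, a, d) \<in> T' \<Longrightarrow> m \<notin> verts T' \<Longrightarrow>
    subdivision T (star_edge T' a b c d m) (\<lambda>z. star_edge_chain a b m (F z))"

text \<open>\<open>\<gamma>\<close> is a closed curve on \<open>T'\<close> that represents the image of the class \<open>\<phi>\<close> under \<open>F\<close>. It may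
  repeat edges and its self-intersections are arbitrary: only its position relative to the
  other curve matters for intersection numbers.\<close>

definition represents ::
    "'v triangles \<Rightarrow> ('v chain \<Rightarrow> 'v chain) \<Rightarrow> 'v list \<Rightarrow> 'v chain set \<Rightarrow> bool" where
  "represents T' F \<gamma> \<phi> \<longleftrightarrow> closed_walk T' \<gamma> \<and> (\<exists>z\<in>\<phi>. chain_of \<gamma> \<in> hclass T' (F z))"

definition hom_intersection :: "'v triangles \<Rightarrow> 'v chain set \<Rightarrow> 'v chain set \<Rightarrow> int" where
  "hom_intersection T \<phi> \<psi> = (THE k. \<exists>T' F \<beta> \<gamma>. subdivision T T' F \<and>
     represents T' F \<beta> \<phi> \<and> represents T' F \<gamma> \<psi> \<and> transverse T' \<beta> \<gamma> \<and>
     k = intersection_number T' \<beta> \<gamma>)"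

definition alpha :: "'v triangles \<Rightarrow> 'v list \<Rightarrow> ('v \<Rightarrow> nat) \<Rightarrow> nat \<Rightarrow> int" where
  "alpha T \<gamma> L i = hom_intersection T (hclass T (chain_of \<gamma>))
     (hclass T (chain_of (split_curve T \<gamma> (inv_into (crossings \<gamma>) L i))))"

end

theory Submission
  imports Defs
begin

text \<open>Cutting open the cyclic order of the neighbours of each vertex gives signs \<open>\<sigma> v x y\<close>, and
  \<open>\<Sum>\<^sub>v \<Sum>\<^sub>x \<Sum>\<^sub>y y(v, x) z(v, y) \<sigma> v x y\<close> is an antisymmetric bilinear form on 1-chains. On cycles it vanishes
  against boundaries of triangles, it is invariant under stellar subdivision, and on two transverse
  walks it is \<open>- 2\<close> times their intersection number. Hence intersection numbers of homology classes are
  well defined as soon as transverse representatives exist; these are found in the barycentric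
  subdivision, where one walk stays in the old 1-skeleton and the other is pushed to the dual one.
  Finally \<open>\<gamma> = \<gamma>' + \<gamma>\<^sub>c\<close> as chains, so by antisymmetry \<open>\<langle>\<gamma>, \<gamma>\<^sub>c\<rangle> = \<langle>\<gamma>', \<gamma>\<^sub>c\<rangle>\<close>, which is evaluated
  crossing by crossing: \<open>c\<close> itself contributes \<open>0\<close>, a crossing of \<open>\<gamma>'\<close> with \<open>\<gamma>\<^sub>c\<close> contributes its exponent
  in \<open>w\<^sub>c\<close>, and the two exponents of a self-crossing of \<open>\<gamma>'\<close> cancel in the sum over \<open>w\<^sub>c\<close>.\<close>

section \<open>Chains and boundaries\<close>

text \<open>\<open>hom_intersection\<close> is a definite description over all subdivisions and all
  transverse representatives, while \<open>\<gamma>\<close> shares every edge of its own arc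
  \<open>\<gamma>\<^sub>c\<close>, so these two curves are never transverse. A form on chains
  removes both difficulties: it is evaluated on the curves as they lie, and it forces all admissible
  pairs of representatives to give one number. A sum over pairs of half-edges needs a linear order
  at each vertex. Two ways of cutting the cyclic order change \<open>\<sigma> v x y\<close> by a
  term \<open>h y - h x\<close>, which dies against cycles because their values around
  \<open>v\<close> add up to zero. The factor 2 arises since the four pairs of half-edges at a
  crossing combine into two cyclic triples, one for each side of the first strand, and each has
  orientation 1. At \<open>c\<close> itself the two arcs touch without crossing; that this
  contributes nothing rests on an inequality satisfied by the signs of a linear order.\<close>

definition dedge :: "'v \<Rightarrow> 'v \<Rightarrow> 'v chain" where
  "dedge a b e = (if a = b then 0 else if e = (a, b) then 1 else if e = (b, a) then - 1 else 0)"

definition steps :: "'v list \<Rightarrow> ('v \<times> 'v) list" where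
  "steps \<gamma> = map (step \<gamma>) [0..<length \<gamma>]"

lemma dedge_swap: "dedge b a e = - dedge a b e"
  by (auto simp: dedge_def)

text \<open>Valid for arbitrary lists: a step from a vertex to itself is counted with both signs in
  \<open>chain_of\<close>, which matches the zero of \<open>dedge\<close> on the diagonal.\<close>

lemma chain_of_eq_sum:
  "chain_of \<gamma> e = (\<Sum>i<length \<gamma>. dedge (fst (step \<gamma> i)) (snd (step \<gamma> i)) e)"
proof -
  have *: "int (card {i. i < length \<gamma> \<and> P i}) = (\<Sum>i<length \<gamma>. if P i then 1 else 0)" for P
  proof -
    have "(\<Sum>i<length \<gamma>. if P i then 1 else 0) = (\<Sum>i\<in>{i. i < length \<gamma> \<and> P i}. 1::int)"
      by (rule sum.mono_neutral_cong_right) auto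
    then show ?thesis by simp
  qed
  show ?thesis
    unfolding chain_of_def * sum_subtractf[symmetric]
  proof (rule sum.cong)
    fix i
    obtain a b x y where "step \<gamma> i = (a, b)" "e = (x, y)" by (metis surj_pair)
    then show "(if step \<gamma> i = e then 1 else 0) - (if step \<gamma> i = prod.swap e then 1 else 0)
        = dedge (fst (step \<gamma> i)) (snd (step \<gamma> i)) e"
      by (cases "x = a"; cases "y = b"; cases "x = b"; cases "y = a") (auto simp: dedge_def)
  qed simp
qed

lemma chain_of_antisym: "chain_of \<gamma> (b, a) = - chain_of \<gamma> (a, b)"
  by (simp add: chain_of_def)

lemma chain_of_triangle:
  "chain_of [a, b, c] e = dedge a b e + dedge b c e + dedge c a e"
  by (simp add: chain_of_eq_sum step_def lessThan_Suc)

lemma sum_dedge: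
  assumes "finite V" "x \<in> V" "y \<in> V"
  shows "(\<Sum>u\<in>V. dedge x y (v, u) * h u) = of_bool (v = x) * h y - of_bool (v = y) * (h x :: int)"
proof -
  have "dedge x y (v, u) * h u = (if u = y then of_bool (v = x) * h u else 0)
     - (if u = x then of_bool (v = y) * h u else 0)" for u
    by (cases "v = x"; cases "v = y"; cases "u = x"; cases "u = y") (auto simp: dedge_def)
  then show ?thesis
    using assms by (simp add: sum_subtractf)
qed

lemma cycles1D:
  assumes "z \<in> cycles1 T"
  shows "z (b, a) = - z (a, b)" "e \<notin> edges T \<Longrightarrow> z e = 0"
    "v \<in> verts T \<Longrightarrow> (\<Sum>x\<in>verts T. z (v, x)) = 0"
  using assms unfolding cycles1_def by blast+

lemma boundaries1_zero: "(\<lambda>_. 0) \<in> boundaries1 T"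
  unfolding boundaries1_def by (auto intro!: exI[of _ "\<lambda>_. 0"] simp: case_prod_beta)

lemma boundaries1_add:
  assumes "y \<in> boundaries1 T" "z \<in> boundaries1 T"
  shows "(\<lambda>e. y e + z e) \<in> boundaries1 T"
proof -
  obtain f g where "y = (\<lambda>e. \<Sum>(a, b, c)\<in>T. f (a, b, c) * chain_of [a, b, c] e)"
    "z = (\<lambda>e. \<Sum>(a, b, c)\<in>T. g (a, b, c) * chain_of [a, b, c] e)"
    using assms unfolding boundaries1_def by blast
  then have "(\<lambda>e. y e + z e) = (\<lambda>e. \<Sum>(a, b, c)\<in>T. (f (a, b, c) + g (a, b, c)) * chain_of [a, b, c] e)"
    by (simp add: sum.distrib[symmetric] case_prod_beta algebra_simps)
  then show ?thesis
    unfolding boundaries1_def by (intro CollectI exI[of _ "\<lambda>t. f t + g t"])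
qed

lemma boundaries1_minus:
  assumes "y \<in> boundaries1 T"
  shows "(\<lambda>e. - y e) \<in> boundaries1 T"
proof -
  obtain f where "y = (\<lambda>e. \<Sum>(a, b, c)\<in>T. f (a, b, c) * chain_of [a, b, c] e)"
    using assms unfolding boundaries1_def by blast
  then have "(\<lambda>e. - y e) = (\<lambda>e. \<Sum>(a, b, c)\<in>T. (- f (a, b, c)) * chain_of [a, b, c] e)"
    by (simp add: sum_negf[symmetric] case_prod_beta)
  then show ?thesis
    unfolding boundaries1_def by (intro CollectI exI[of _ "\<lambda>t. - f t"])
qed

text \<open>\<open>T\<close> lists each triangle in three rotations, so the coefficient function is
  supported on just one of them; otherwise the boundary would appear three times.\<close>

lemma boundaries1_triangle:
  assumes "finite T" "(a, b, c) \<in> T"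
  shows "(\<lambda>e. dedge a b e + dedge b c e + dedge c a e) \<in> boundaries1 T"
proof -
  have "(\<Sum>(x, y, z)\<in>T. of_bool ((x, y, z) = (a, b, c)) * chain_of [x, y, z] e) = chain_of [a, b, c] e" for e
  proof -
    have "(\<Sum>(x, y, z)\<in>T. of_bool ((x, y, z) = (a, b, c)) * chain_of [x, y, z] e)
       = (\<Sum>(x, y, z)\<in>{(a, b, c)}. chain_of [x, y, z] e)"
      using assms by (intro sum.mono_neutral_cong_right) auto
    then show ?thesis by simp
  qed
  then have "(\<lambda>e. dedge a b e + dedge b c e + dedge c a e) =
      (\<lambda>e. \<Sum>(x, y, z)\<in>T. of_bool ((x, y, z) = (a, b, c)) * chain_of [x, y, z] e)"
    by (simp only: chain_of_triangle[symmetric])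
  then show ?thesis
    unfolding boundaries1_def by (intro CollectI exI[of _ "\<lambda>t. of_bool (t = (a, b, c))"])
qed

text \<open>Stated for arbitrary chains rather than cycles, so that open paths with common ends can
  be exchanged piece by piece before a walk is closed up.\<close>

definition homologous :: "'v triangles \<Rightarrow> 'v chain \<Rightarrow> 'v chain \<Rightarrow> bool" where
  "homologous T y z \<longleftrightarrow> (\<lambda>e. y e - z e) \<in> boundaries1 T"

lemma homologous_refl: "homologous T z z"
  by (simp add: homologous_def boundaries1_zero)

lemma homologous_sym: "homologous T y z \<Longrightarrow> homologous T z y"
  unfolding homologous_def by (drule boundaries1_minus) simp

lemma homologous_trans: "homologous T x y \<Longrightarrow> homologous T y z \<Longrightarrow> homologous T x z"
  unfolding homologous_def by (drule (1) boundaries1_add) simp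

lemma homologous_add:
  "homologous T x y \<Longrightarrow> homologous T x' y' \<Longrightarrow> homologous T (\<lambda>e. x e + x' e) (\<lambda>e. y e + y' e)"
  unfolding homologous_def by (drule (1) boundaries1_add) (simp add: algebra_simps)

lemma homologous_triangle:
  assumes "finite T" "(a, b, c) \<in> T"
  shows "homologous T (dedge a c) (\<lambda>e. dedge a b e + dedge b c e)"
  using boundaries1_minus[OF boundaries1_triangle[OF assms]]
  by (simp add: homologous_def dedge_swap[of c a] algebra_simps)


section \<open>The intersection form\<close>

text \<open>Collects the local incidence conditions, the part of a surface that is carried through
  stellar moves. Information about the order in links is carried separately, by the signs of
  \<open>link_order\<close>.\<close>

locale pseudosurface =
  fixes T :: "'v triangles"
  assumes finite: "finite T"
    and rot: "(a, b, c) \<in> T \<Longrightarrow> (b, c, a) \<in> T"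
    and distinct: "(a, b, c) \<in> T \<Longrightarrow> a \<noteq> b"
    and no_flip: "(a, b, c) \<in> T \<Longrightarrow> (b, a, c) \<notin> T"
    and unique: "(a, b, c) \<in> T \<Longrightarrow> (a, b, d) \<in> T \<Longrightarrow> c = d"
    and opposite: "(a, b, c) \<in> T \<Longrightarrow> \<exists>d. (b, a, d) \<in> T"
begin

lemma rot': "(a, b, c) \<in> T \<Longrightarrow> (c, a, b) \<in> T"
  by (blast intro: rot)

lemma rotations_subset: "(a, b, c) \<in> T \<Longrightarrow> rotations (a, b, c) \<subseteq> T"
  by (auto simp: rotations_def intro: rot rot')

lemma finite_verts: "finite (verts T)"
proof -
  have "verts T = fst ` T" by (force simp: verts_def)
  then show ?thesis using finite by simp
qed

lemma finite_edges: "finite (edges T)"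
proof -
  have "edges T = (\<lambda>(a, b, c). (a, b)) ` T" by (force simp: edges_def)
  then show ?thesis using finite by simp
qed

lemma edges_sym: "(a, b) \<in> edges T \<Longrightarrow> (b, a) \<in> edges T"
  using opposite by (fastforce simp: edges_def)

lemma edges_verts: "(a, b) \<in> edges T \<Longrightarrow> a \<in> verts T \<and> b \<in> verts T"
  by (auto simp: edges_def verts_def dest: rot)

lemma edges_neq: "(a, b) \<in> edges T \<Longrightarrow> a \<noteq> b"
  by (auto simp: edges_def dest: distinct)

lemma triangle_edges:
  assumes "(a, b, c) \<in> T"
  shows "(a, b) \<in> edges T" "(b, c) \<in> edges T" "(c, a) \<in> edges T"
    "(b, a) \<in> edges T" "(c, b) \<in> edges T" "(a, c) \<in> edges T"
  using rot[OF assms] rot'[OF assms] assms edges_sym by (auto simp: edges_def)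

lemma triangle_verts: "(a, b, c) \<in> T \<Longrightarrow> a \<in> verts T \<and> b \<in> verts T \<and> c \<in> verts T"
  using triangle_edges edges_verts by blast

lemma triangle_distinct: "(a, b, c) \<in> T \<Longrightarrow> a \<noteq> b \<and> b \<noteq> c \<and> c \<noteq> a"
  using rot rot' distinct by blast

lemma ccw_next_eq: "(v, a, b) \<in> T \<Longrightarrow> ccw_next T v a = b"
  unfolding ccw_next_def using unique by blast

lemma ccw_next_triangle: "(v, a) \<in> edges T \<Longrightarrow> (v, a, ccw_next T v a) \<in> T"
  using ccw_next_eq by (fastforce simp: edges_def)

lemma ccw_next_funpow_edge: "(v, a) \<in> edges T \<Longrightarrow> (v, (ccw_next T v ^^ k) a) \<in> edges T"
  by (induction k) (auto dest: ccw_next_triangle triangle_edges)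

lemma closed_walk_edge:
  assumes "closed_walk T \<gamma>" "i < length \<gamma>"
  shows "step \<gamma> i \<in> edges T" "\<gamma> ! i \<in> verts T"
  using assms edges_verts by (auto simp: closed_walk_def step_def)

end

text \<open>Seen from \<open>v\<close>, a passage is one half-edge directed outwards and one
  directed inwards, whence the difference. The test function \<open>h\<close> stays free: the
  constant 1 gives the cycle condition, the signs give the intersection form.\<close>

lemma chain_of_vertex:
  assumes "\<gamma> \<noteq> []" "finite V" "set \<gamma> \<subseteq> V"
  shows "(\<Sum>u\<in>V. chain_of \<gamma> (v, u) * h u) =
    (\<Sum>i | i < length \<gamma> \<and> \<gamma> ! i = v. h (snd (strand \<gamma> i)) - (h (fst (strand \<gamma> i)) :: int))"
proof -
  let ?n = "length \<gamma>"
  have n: "?n > 0" using assms by simp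
  have "(\<Sum>u\<in>V. chain_of \<gamma> (v, u) * h u) = (\<Sum>i<?n. \<Sum>u\<in>V. dedge (fst (step \<gamma> i)) (snd (step \<gamma> i)) (v, u) * h u)"
    unfolding chain_of_eq_sum sum_distrib_right by (rule sum.swap)
  also have "\<dots> = (\<Sum>i<?n. of_bool (v = fst (step \<gamma> i)) * h (snd (step \<gamma> i)) - of_bool (v = snd (step \<gamma> i)) * h (fst (step \<gamma> i)))"
    using assms n by (intro sum.cong HOL.refl sum_dedge) (auto simp: step_def)
  also have "\<dots> = (\<Sum>i<?n. of_bool (v = \<gamma> ! i) * h (\<gamma> ! (Suc i mod ?n)))
      - (\<Sum>i<?n. of_bool (v = \<gamma> ! (Suc i mod ?n)) * h (\<gamma> ! i))"
    by (simp add: sum_subtractf step_def)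
  \<comment> \<open>Re-indexing by the end point of a step makes both sums run over passages through
    \<open>v\<close>; the inverse map is the predecessor index that occurs in
    \<open>strand\<close>.\<close>
  also have "(\<Sum>i<?n. of_bool (v = \<gamma> ! (Suc i mod ?n)) * h (\<gamma> ! i)) =
      (\<Sum>i<?n. of_bool (v = \<gamma> ! i) * h (\<gamma> ! ((i + ?n - 1) mod ?n)))"
  proof (rule sum.reindex_bij_witness[where j="\<lambda>i. Suc i mod ?n" and i="\<lambda>i. (i + ?n - 1) mod ?n"])
    fix i assume "i \<in> {..<?n}"
    then have i: "i < ?n" by simp
    show "(Suc i mod ?n + ?n - 1) mod ?n = i"
      using i by (cases "Suc i = ?n") auto
    then show "of_bool (v = \<gamma> ! (Suc i mod ?n)) * h (\<gamma> ! ((Suc i mod ?n + ?n - 1) mod ?n)) =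
         of_bool (v = \<gamma> ! (Suc i mod ?n)) * h (\<gamma> ! i)" by simp
    show "Suc ((i + ?n - 1) mod ?n) mod ?n = i"
      using i n by (cases i) (auto simp: mod_Suc_eq)
  qed (use n in auto)
  also have "(\<Sum>i<?n. of_bool (v = \<gamma> ! i) * h (\<gamma> ! (Suc i mod ?n))) - \<dots> =
    (\<Sum>i<?n. of_bool (v = \<gamma> ! i) * (h (snd (strand \<gamma> i)) - (h (fst (strand \<gamma> i)))))"
    by (simp add: strand_def sum_subtractf right_diff_distrib)
  also have "\<dots> = (\<Sum>i | i < ?n \<and> \<gamma> ! i = v. h (snd (strand \<gamma> i)) - (h (fst (strand \<gamma> i)) :: int))"
    by (rule sum.mono_neutral_cong_right) auto
  finally show ?thesis .
qed

section \<open>The bilinear form and its local contributions\<close>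

definition form :: "'v set \<Rightarrow> ('v \<Rightarrow> 'v \<Rightarrow> 'v \<Rightarrow> int) \<Rightarrow> 'v chain \<Rightarrow> 'v chain \<Rightarrow> int" where
  "form V \<sigma> y z = (\<Sum>v\<in>V. \<Sum>x\<in>V. \<Sum>u\<in>V. y (v, x) * (z (v, u) * \<sigma> v x u))"

text \<open>The share of one pair of passages in \<open>form\<close>: outgoing half-edges count
  positively and incoming ones negatively in each argument.\<close>

definition strand_form :: "('v \<Rightarrow> 'v \<Rightarrow> 'v \<Rightarrow> int) \<Rightarrow> 'v \<Rightarrow> 'v \<times> 'v \<Rightarrow> 'v \<times> 'v \<Rightarrow> int" where
  "strand_form \<sigma> v s t = \<sigma> v (snd s) (snd t) - \<sigma> v (snd s) (fst t)
     - \<sigma> v (fst s) (snd t) + \<sigma> v (fst s) (fst t)"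

lemma form_add_right: "form V \<sigma> x (\<lambda>e. y e + z e) = form V \<sigma> x y + form V \<sigma> x z"
  by (simp add: form_def algebra_simps sum.distrib)

lemma form_add_left: "form V \<sigma> (\<lambda>e. y e + z e) x = form V \<sigma> y x + form V \<sigma> z x"
  by (simp add: form_def algebra_simps sum.distrib)

lemma form_diff_right: "form V \<sigma> x (\<lambda>e. y e - z e) = form V \<sigma> x y - form V \<sigma> x z"
  by (simp add: form_def algebra_simps sum_subtractf)

lemma form_sum_right: "form V \<sigma> x (\<lambda>e. \<Sum>i\<in>A. f i * z i e) = (\<Sum>i\<in>A. f i * form V \<sigma> x (z i))"
proof (induction A rule: infinite_finite_induct)
  case (insert i A)
  have "form V \<sigma> x (\<lambda>e. f i * z i e) = f i * form V \<sigma> x (z i)"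
    by (simp add: form_def sum_distrib_left algebra_simps)
  then show ?case using insert by (simp add: form_add_right)
qed (simp_all add: form_def)

lemma form_chain_of:
  assumes "\<beta> \<noteq> []" "\<gamma> \<noteq> []" "finite V" "set \<beta> \<subseteq> V" "set \<gamma> \<subseteq> V"
  shows "form V \<sigma> (chain_of \<beta>) (chain_of \<gamma>) =
    (\<Sum>(i, j) | i < length \<beta> \<and> j < length \<gamma> \<and> \<beta> ! i = \<gamma> ! j.
       strand_form \<sigma> (\<beta> ! i) (strand \<beta> i) (strand \<gamma> j))"
proof -
  let ?G = "\<lambda>v. {j. j < length \<gamma> \<and> \<gamma> ! j = v}"
  have "form V \<sigma> (chain_of \<beta>) (chain_of \<gamma>) =
    (\<Sum>v\<in>V. \<Sum>x\<in>V. chain_of \<beta> (v, x) * (\<Sum>j\<in>?G v. \<sigma> v x (snd (strand \<gamma> j)) - \<sigma> v x (fst (strand \<gamma> j))))"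
    using assms by (simp add: form_def chain_of_vertex sum_distrib_left[symmetric])
  also have "\<dots> = (\<Sum>v\<in>V. \<Sum>i | i < length \<beta> \<and> \<beta> ! i = v. \<Sum>j\<in>?G v. strand_form \<sigma> v (strand \<beta> i) (strand \<gamma> j))"
    unfolding chain_of_vertex[OF assms(1,3,4)]
    by (simp add: strand_form_def sum_subtractf[symmetric] algebra_simps)
  also have "\<dots> = (\<Sum>v\<in>V. \<Sum>i\<in>{..<length \<beta>}. if \<beta> ! i = v then (\<Sum>j\<in>?G v. strand_form \<sigma> v (strand \<beta> i) (strand \<gamma> j)) else 0)"
    by (intro sum.cong HOL.refl sum.mono_neutral_cong_left) auto
  also have "\<dots> = (\<Sum>i\<in>{..<length \<beta>}. \<Sum>v\<in>V. if \<beta> ! i = v then (\<Sum>j\<in>?G v. strand_form \<sigma> v (strand \<beta> i) (strand \<gamma> j)) else 0)"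
    by (rule sum.swap)
  also have "\<dots> = (\<Sum>i\<in>{..<length \<beta>}. \<Sum>j\<in>?G (\<beta> ! i). strand_form \<sigma> (\<beta> ! i) (strand \<beta> i) (strand \<gamma> j))"
    using assms by (intro sum.cong HOL.refl) (simp add: subset_eq)
  also have "\<dots> = (\<Sum>(i, j)\<in>Sigma {..<length \<beta>} (\<lambda>i. ?G (\<beta> ! i)). strand_form \<sigma> (\<beta> ! i) (strand \<beta> i) (strand \<gamma> j))"
    by (rule sum.Sigma) auto
  also have "Sigma {..<length \<beta>} (\<lambda>i. ?G (\<beta> ! i)) = {(i, j). i < length \<beta> \<and> j < length \<gamma> \<and> \<beta> ! i = \<gamma> ! j}"
    by auto
  finally show ?thesis .
qed

context pseudosurface
begin

lemma cycles1_chain_of: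
  assumes "closed_walk T \<gamma>"
  shows "chain_of \<gamma> \<in> cycles1 T"
proof -
  have ne: "\<gamma> \<noteq> []" using assms by (simp add: closed_walk_def)
  have V: "set \<gamma> \<subseteq> verts T"
    using closed_walk_edge(2)[OF assms] by (auto simp: in_set_conv_nth)
  have "chain_of \<gamma> e = 0" if "e \<notin> edges T" for e
  proof -
    have "prod.swap e \<notin> edges T" using that edges_sym by (cases e) auto
    then have "step \<gamma> i \<noteq> e \<and> step \<gamma> i \<noteq> prod.swap e" if "i < length \<gamma>" for i
      using closed_walk_edge(1)[OF assms that] \<open>e \<notin> edges T\<close> by metis
    then have *: "{i. i < length \<gamma> \<and> step \<gamma> i = e} = {}" "{i. i < length \<gamma> \<and> step \<gamma> i = prod.swap e} = {}"
      by blast+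
    show ?thesis unfolding chain_of_def * by simp
  qed
  moreover have "(\<Sum>x\<in>verts T. chain_of \<gamma> (v, x)) = 0" for v
    using chain_of_vertex[OF ne finite_verts V, of v "\<lambda>_. 1"] by simp
  ultimately show ?thesis
    by (auto simp: cycles1_def intro: chain_of_antisym)
qed

end

text \<open>\<open>\<sigma> v x y\<close> plays the role of the sign of \<open>y - x\<close> for a linear order of the neighbours of
  \<open>v\<close> obtained by cutting open their cyclic order. The sum \<open>\<sigma> v x y + \<sigma> v y z + \<sigma> v z x\<close> is then the cyclic
  orientation of a triple, which does not depend on the cut.\<close>

locale link_order = pseudosurface T for T :: "'v triangles" +
  fixes \<sigma> :: "'v \<Rightarrow> 'v \<Rightarrow> 'v \<Rightarrow> int"
  assumes antisym: "\<sigma> v x y = - \<sigma> v y x"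
    and cyclic: "(v, x, y) \<in> T \<Longrightarrow> (v, z) \<in> edges T \<Longrightarrow> z \<noteq> x \<Longrightarrow> z \<noteq> y \<Longrightarrow>
      \<sigma> v x y + \<sigma> v y z + \<sigma> v z x = 1"
begin

lemma self_zero: "\<sigma> v x x = 0"
  using antisym[of v x x] by simp

lemma form_antisym: "form V \<sigma> y z = - form V \<sigma> z y"
proof -
  have "form V \<sigma> z y = (\<Sum>v\<in>V. \<Sum>x\<in>V. \<Sum>u\<in>V. z (v, u) * (y (v, x) * \<sigma> v u x))"
    unfolding form_def by (subst (2) sum.swap) (rule HOL.refl)
  also have "\<dots> = (\<Sum>v\<in>V. \<Sum>x\<in>V. \<Sum>u\<in>V. - (y (v, x) * (z (v, u) * \<sigma> v x u)))"
    by (intro sum.cong HOL.refl, subst antisym) simp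
  also have "\<dots> = - form V \<sigma> y z"
    by (simp add: form_def sum_negf)
  finally show ?thesis by simp
qed

lemma strand_form_antisym: "strand_form \<sigma> v s t = - strand_form \<sigma> v t s"
  using antisym[of v "fst s"] antisym[of v "snd s"] by (simp add: strand_form_def)

text \<open>For a neighbour \<open>x\<close> other than \<open>b\<close> and \<open>c\<close> the
  bracket is the constant \<open>1 - \<sigma> a b c\<close>, because \<open>b\<close> and
  \<open>c\<close> are adjacent in the link. A constant is killed by the cycle condition at
  \<open>a\<close>. At \<open>x = b\<close> and \<open>x = c\<close> the bracket is one less than
  that constant, which leaves the two terms on the right.\<close>

lemma form_corner:
  assumes z: "z \<in> cycles1 T" and t: "(a, b, c) \<in> T"
  shows "(\<Sum>x\<in>verts T. z (a, x) * (\<sigma> a x b - \<sigma> a x c)) = - z (a, b) - z (a, c)"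
proof -
  let ?V = "verts T"
  have V: "a \<in> ?V" "b \<in> ?V" "c \<in> ?V" "b \<noteq> c"
    using triangle_verts[OF t] triangle_distinct[OF t] by auto
  have 0: "(\<Sum>x\<in>?V. z (a, x)) = 0"
    using cycles1D(3)[OF z] V by simp
  have "z (a, x) * (\<sigma> a x b - \<sigma> a x c) = z (a, x) * (1 - \<sigma> a b c)
      - (if x = b then z (a, x) else 0) - (if x = c then z (a, x) else 0)" for x
  proof (cases "(a, x) \<in> edges T")
    case True
    consider "x = b" | "x = c" | "x \<noteq> b" "x \<noteq> c" by blast
    then show ?thesis
    proof cases
      case 1
      then show ?thesis using V by (simp add: self_zero algebra_simps)
    next
      case 2
      then show ?thesis using V antisym[of a c b] by (simp add: self_zero algebra_simps)
    next
      case 3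
      then have "\<sigma> a x b - \<sigma> a x c = 1 - \<sigma> a b c"
        using cyclic[OF t True] antisym[of a c x] by linarith
      then show ?thesis using 3 by simp
    qed
  next
    case False
    then have "z (a, x) = 0" by (rule cycles1D(2)[OF z])
    then show ?thesis by auto
  qed
  then have "(\<Sum>x\<in>?V. z (a, x) * (\<sigma> a x b - \<sigma> a x c)) = (\<Sum>x\<in>?V. z (a, x)) * (1 - \<sigma> a b c)
     - (\<Sum>x\<in>?V. if x = b then z (a, x) else 0) - (\<Sum>x\<in>?V. if x = c then z (a, x) else 0)"
    by (simp add: sum_subtractf sum_distrib_right)
  then show ?thesis using 0 V finite_verts by simp
qed

text \<open>The three corners leave each side of the triangle once in each direction, and these
  cancel because a cycle is antisymmetric.\<close>

lemma form_triangle: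
  assumes z: "z \<in> cycles1 T" and t: "(a, b, c) \<in> T"
  shows "form (verts T) \<sigma> z (chain_of [a, b, c]) = 0"
proof -
  let ?V = "verts T"
  have V: "a \<in> ?V" "b \<in> ?V" "c \<in> ?V"
    using triangle_verts[OF t] by auto
  have *: "(\<Sum>u\<in>?V. chain_of [a, b, c] (v, u) * \<sigma> v x u) =
     of_bool (v = a) * (\<sigma> v x b - \<sigma> v x c) + of_bool (v = b) * (\<sigma> v x c - \<sigma> v x a)
      + of_bool (v = c) * (\<sigma> v x a - \<sigma> v x b)" for v x
    using V finite_verts
    by (simp only: chain_of_triangle distrib_right sum.distrib sum_dedge) (simp add: right_diff_distrib)
  have "form ?V \<sigma> z (chain_of [a, b, c]) =
    (\<Sum>v\<in>?V. \<Sum>x\<in>?V. of_bool (v = a) * (z (v, x) * (\<sigma> v x b - \<sigma> v x c))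
      + of_bool (v = b) * (z (v, x) * (\<sigma> v x c - \<sigma> v x a))
      + of_bool (v = c) * (z (v, x) * (\<sigma> v x a - \<sigma> v x b)))"
    unfolding form_def sum_distrib_left[symmetric] * by (simp add: algebra_simps)
  also have "\<dots> = (\<Sum>x\<in>?V. z (a, x) * (\<sigma> a x b - \<sigma> a x c))
      + (\<Sum>x\<in>?V. z (b, x) * (\<sigma> b x c - \<sigma> b x a)) + (\<Sum>x\<in>?V. z (c, x) * (\<sigma> c x a - \<sigma> c x b))"
    using V finite_verts
    by (simp only: sum.distrib sum_distrib_left[symmetric]) (simp add: of_bool_def if_distrib[where f="\<lambda>x. x * _"] cong: if_cong)
  also have "\<dots> = - z (a, b) - z (a, c) - z (b, c) - z (b, a) - z (c, a) - z (c, b)"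
    using form_corner[OF z t] form_corner[OF z rot[OF t]] form_corner[OF z rot'[OF t]] by simp
  also have "\<dots> = 0"
    using cycles1D(1)[OF z, of b a] cycles1D(1)[OF z, of c a] cycles1D(1)[OF z, of c b] by linarith
  finally show ?thesis .
qed

lemma form_homologous_right:
  assumes "x \<in> cycles1 T" "homologous T y z"
  shows "form (verts T) \<sigma> x y = form (verts T) \<sigma> x z"
proof -
  obtain f where f: "(\<lambda>e. y e - z e) = (\<lambda>e. \<Sum>t\<in>T. f t * (case t of (a, b, c) \<Rightarrow> chain_of [a, b, c]) e)"
    using assms(2) unfolding homologous_def boundaries1_def by (auto simp: case_prod_beta)
  have "form (verts T) \<sigma> x (\<lambda>e. y e - z e) = 0"
    unfolding f form_sum_right using form_triangle[OF assms(1)] by (intro sum.neutral) auto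
  then show ?thesis by (simp add: form_diff_right)
qed

text \<open>One argument is exchanged at a time. Antisymmetry moves the first argument into the
  right slot, and at each stage the argument that stays is a cycle.\<close>

lemma form_homologous:
  assumes "x \<in> cycles1 T" "z \<in> cycles1 T" "homologous T x y" "homologous T z u"
    and "u \<in> cycles1 T"
  shows "form (verts T) \<sigma> x z = form (verts T) \<sigma> y u"
  using form_homologous_right[OF assms(1,4)] form_homologous_right[OF assms(5,3)]
    form_antisym[of _ x u] form_antisym[of _ y u] by simp

text \<open>Induction along the counterclockwise walk from \<open>q\<close>. Orientation is
  additive: the triple with the new vertex \<open>?y\<close> and \<open>q\<close>, \<open>p\<close>
  is the old triple with \<open>?x\<close>, plus that of \<open>?x\<close>, \<open>?y\<close>,
  \<open>p\<close>, minus that of \<open>?x\<close>, \<open>?y\<close>, \<open>q\<close>, and the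
  last two have adjacent members.\<close>

lemma left_side_orientation:
  assumes x: "x \<in> left_side T v (p, q)" and e: "(v, p) \<in> edges T" "(v, q) \<in> edges T" and "p \<noteq> q"
  shows "\<sigma> v q x + \<sigma> v x p + \<sigma> v p q = 1"
proof -
  let ?n = "ccw_next T v"
  obtain k where k: "k > 0" "(?n ^^ k) q = x" and before: "\<And>l. 0 < l \<Longrightarrow> l \<le> k \<Longrightarrow> (?n ^^ l) q \<noteq> p"
    using x by (auto simp: left_side_def)
  have "0 < l \<Longrightarrow> l \<le> k \<Longrightarrow> \<sigma> v q ((?n ^^ l) q) + \<sigma> v ((?n ^^ l) q) p + \<sigma> v p q = 1" for l
  proof (induction l)
    case (Suc l)
    let ?x = "(?n ^^ l) q" and ?y = "(?n ^^ Suc l) q"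
    have t: "(v, ?x, ?y) \<in> T"
      using ccw_next_triangle[OF ccw_next_funpow_edge[OF e(2), of l]] by simp
    have y: "?y \<noteq> p" using before Suc by blast
    show ?case
    proof (cases "l = 0")
      case True
      then show ?thesis using t y e \<open>p \<noteq> q\<close> cyclic[of v q ?y p] by simp
    next
      case False
      then have IH: "\<sigma> v q ?x + \<sigma> v ?x p + \<sigma> v p q = 1" and x: "?x \<noteq> p"
        using Suc before by auto
      have xyp: "\<sigma> v ?x ?y + \<sigma> v ?y p + \<sigma> v p ?x = 1"
        using cyclic[OF t e(1)] x y by metis
      \<comment> \<open>The walk cannot come back to \<open>q\<close> before meeting
        \<open>p\<close>: the orientation of a degenerate triple is 0, contradicting the value 1
        already obtained.\<close>
      have "q \<noteq> ?x"
      proof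
        assume "q = ?x"
        then show False using IH antisym[of v q p] self_zero[of v q] by simp
      qed
      moreover have "q \<noteq> ?y"
      proof
        assume "q = ?y"
        then show False using IH xyp antisym[of v q] antisym[of v p ?x] by auto
      qed
      ultimately have "\<sigma> v ?x ?y + \<sigma> v ?y q + \<sigma> v q ?x = 1"
        using cyclic[OF t e(2)] by blast
      then show ?thesis using xyp IH antisym[of v ?y q] antisym[of v p ?x] by linarith
    qed
  qed simp
  then show ?thesis using k by blast
qed

text \<open>Adding the orientations of the triples on the left and on the right of \<open>s\<close>
  makes the terms in \<open>fst s\<close> and \<open>snd s\<close> alone cancel. What remains is
  \<open>- strand_form\<close>, and it equals 1 + 1.\<close>

lemma strand_form_crossed:
  assumes "crossed_left_to_right T v s t"
    and e: "(v, fst s) \<in> edges T" "(v, snd s) \<in> edges T"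
  shows "strand_form \<sigma> v s t = - 2"
proof -
  have ne: "fst s \<noteq> snd s" and l: "fst t \<in> left_side T v (fst s, snd s)" "snd t \<in> left_side T v (snd s, fst s)"
    using assms(1) by (auto simp: crossed_left_to_right_def prod.swap_def)
  show ?thesis
    using left_side_orientation[OF l(1) e ne] left_side_orientation[OF l(2) e(2,1) ne[symmetric]]
      antisym[of v "snd t" "snd s"] antisym[of v "fst t" "fst s"] antisym[of v "snd s" "fst s"]
    by (simp add: strand_form_def)
qed

lemma strand_edges:
  assumes "closed_walk T \<gamma>" "i < length \<gamma>"
  shows "(\<gamma> ! i, fst (strand \<gamma> i)) \<in> edges T" "(\<gamma> ! i, snd (strand \<gamma> i)) \<in> edges T"
proof -
  let ?n = "length \<gamma>"
  show "(\<gamma> ! i, snd (strand \<gamma> i)) \<in> edges T"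
    using closed_walk_edge(1)[OF assms] by (simp add: step_def strand_def)
  let ?j = "(i + ?n - 1) mod ?n"
  have "Suc ?j mod ?n = i" "?j < ?n"
    using assms(2) by (cases i; auto)+
  then have "step \<gamma> ?j = (fst (strand \<gamma> i), \<gamma> ! i)"
    by (simp add: step_def strand_def)
  then show "(\<gamma> ! i, fst (strand \<gamma> i)) \<in> edges T"
    using closed_walk_edge(1)[OF assms(1) \<open>?j < ?n\<close>] edges_sym by simp
qed

lemma strand_form_transverse:
  assumes tr: "transverse_at T v s t"
    and "(v, fst s) \<in> edges T" "(v, snd s) \<in> edges T" "(v, fst t) \<in> edges T" "(v, snd t) \<in> edges T"
  shows "strand_form \<sigma> v s t = (if crossed_left_to_right T v s t then - 2 else 2)"
proof (cases "crossed_left_to_right T v s t")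
  case False
  then have "crossed_left_to_right T v t s" using tr by (simp add: transverse_at_def)
  then show ?thesis using False strand_form_crossed assms strand_form_antisym[of v s t] by simp
qed (use strand_form_crossed assms in simp)

lemma form_transverse:
  assumes "closed_walk T \<beta>" "closed_walk T \<gamma>" "transverse T \<beta> \<gamma>"
  shows "form (verts T) \<sigma> (chain_of \<beta>) (chain_of \<gamma>) = - 2 * intersection_number T \<beta> \<gamma>"
proof -
  have ne: "\<beta> \<noteq> []" "\<gamma> \<noteq> []" using assms by (auto simp: closed_walk_def)
  have V: "set \<beta> \<subseteq> verts T" "set \<gamma> \<subseteq> verts T"
    using closed_walk_edge(2) assms by (auto simp: in_set_conv_nth)
  show ?thesis
    unfolding form_chain_of[OF ne finite_verts V] intersection_number_def sum_distrib_left
  proof (intro sum.cong HOL.refl)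
    fix p assume "p \<in> {(i, j). i < length \<beta> \<and> j < length \<gamma> \<and> \<beta> ! i = \<gamma> ! j}"
    then obtain i j where p: "p = (i, j)" "i < length \<beta>" "j < length \<gamma>" "\<beta> ! i = \<gamma> ! j" by auto
    then have "transverse_at T (\<beta> ! i) (strand \<beta> i) (strand \<gamma> j)"
      using assms(3) by (simp add: transverse_def)
    then show "(case p of (i, j) \<Rightarrow> strand_form \<sigma> (\<beta> ! i) (strand \<beta> i) (strand \<gamma> j)) =
      - 2 * (case p of (i, j) \<Rightarrow> if crossed_left_to_right T (\<beta> ! i) (strand \<beta> i) (strand \<gamma> j) then 1 else - 1)"
      using strand_form_transverse strand_edges[OF assms(1) p(2)] strand_edges[OF assms(2) p(3)] p
      by simp
  qed
qed

end

section \<open>Subdivisions\<close>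

definition link :: "'v triangles \<Rightarrow> 'v \<Rightarrow> ('v \<times> 'v) set" where
  "link T v = {(x, y). (v, x, y) \<in> T}"

text \<open>The axioms of \<open>link_order\<close> at one vertex, for an abstract successor
  relation, so that a stellar move can be checked one link at a time.\<close>

definition cyclic_order :: "('v \<times> 'v) set \<Rightarrow> ('v \<Rightarrow> 'v \<Rightarrow> int) \<Rightarrow> bool" where
  "cyclic_order R s \<longleftrightarrow> (\<forall>x y. s x y = - s y x) \<and>
     (\<forall>x y z. (x, y) \<in> R \<longrightarrow> z \<in> Domain R \<longrightarrow> z \<noteq> x \<longrightarrow> z \<noteq> y \<longrightarrow> s x y + s y z + s z x = 1)"

lemma edges_iff_link: "(v, x) \<in> edges T \<longleftrightarrow> x \<in> Domain (link T v)"
  by (auto simp: edges_def link_def)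

lemma link_order_iff:
  "link_order T \<sigma> \<longleftrightarrow> pseudosurface T \<and> (\<forall>v. cyclic_order (link T v) (\<sigma> v))"
  unfolding link_order_def link_order_axioms_def cyclic_order_def edges_iff_link link_def by blast

text \<open>Neighbours are ranked by the number of counterclockwise turns from a base neighbour; the
  only adjacent pair with decreasing rank lies at the cut. The extra bound also covers triples
  without adjacent members, of which \<open>cyclic\<close> says nothing directly; it is used on the
  original triangulation to treat the smoothed crossing.\<close>

lemma link_order_exists:
  assumes "closed_connected_surface T"
  shows "\<exists>\<sigma>. link_order T \<sigma> \<and> (\<forall>v x y z. \<sigma> v x y + \<sigma> v y z + \<sigma> v z x \<le> 1)"
proof -
  interpret pseudosurface T
  proof
    show "(b, c, a) \<in> T" if "(a, b, c) \<in> T" for a b c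
      using assms that unfolding closed_connected_surface_def rotations_def by fastforce
  qed (use assms in \<open>unfold closed_connected_surface_def, (blast | fastforce)+\<close>)
  have reach: "\<exists>k. (ccw_next T v ^^ k) x = y" if "(v, x) \<in> edges T" "(v, y) \<in> edges T" for v x y
    using assms that unfolding closed_connected_surface_def by blast
  define base where "base v = (SOME x. (v, x) \<in> edges T)" for v
  define rank where "rank v x = (LEAST k. (ccw_next T v ^^ k) (base v) = x)" for v x
  define \<sigma> where "\<sigma> v x y = sgn (int (rank v y) - int (rank v x))" for v x y
  have "\<sigma> v x y + \<sigma> v y z + \<sigma> v z x = 1"
    if t: "(v, x, y) \<in> T" and z: "(v, z) \<in> edges T" "z \<noteq> x" "z \<noteq> y" for v x y z
  proof -
    let ?n = "ccw_next T v" and ?r = "rank v"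
    have base: "(v, base v) \<in> edges T"
      unfolding base_def using z(1) by (rule someI)
    have rank: "(?n ^^ ?r u) (base v) = u" if "(v, u) \<in> edges T" for u
      unfolding rank_def using reach[OF base that] by (rule LeastI_ex)
    have rank_le: "?r u \<le> k" if "(?n ^^ k) (base v) = u" for u k
      unfolding rank_def using that by (rule Least_le)
    have x: "(v, x) \<in> edges T" and y: "(v, y) \<in> edges T"
      using triangle_edges[OF t] by auto
    have inj: "?r u \<noteq> ?r w" if "u \<noteq> w" "(v, u) \<in> edges T" "(v, w) \<in> edges T" for u w
      using rank that by metis
    have ne: "?r z \<noteq> ?r x" "?r z \<noteq> ?r y"
      using inj x y z by blast+
    have step: "(?n ^^ Suc (?r x)) (base v) = y"
      using rank[OF x] ccw_next_eq[OF t] by simp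
    show ?thesis
    proof (cases "?r y")
      case 0
      \<comment> \<open>Here \<open>y\<close> is the base, so the turns repeat with period
        \<open>Suc (?r x)\<close>. Every rank is therefore at most that of \<open>x\<close>, and the
        pair \<open>x\<close>, \<open>y\<close> straddles the cut.\<close>
      then have "(?n ^^ Suc (?r x)) (base v) = base v"
        using rank[OF y] step by simp
      then have "(?n ^^ (?r z mod Suc (?r x))) (base v) = z"
        using rank[OF z(1)] funpow_mod_eq by metis
      then have "?r z \<le> ?r z mod Suc (?r x)" by (rule rank_le)
      then have "?r z \<le> ?r x" by (metis le_trans less_Suc_eq_le mod_less_divisor zero_less_Suc)
      then show ?thesis using ne 0 by (simp add: \<sigma>_def)
    next
      case (Suc j)
      \<comment> \<open>Away from the cut the predecessor of \<open>y\<close> is unique, so the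
        ranks of \<open>x\<close> and \<open>y\<close> are consecutive and no \<open>z\<close> fits
        between them.\<close>
      have "(v, (?n ^^ j) (base v), y) \<in> T"
        using ccw_next_triangle[OF ccw_next_funpow_edge[OF base, of j]] rank[OF y] Suc by simp
      then have "(?n ^^ j) (base v) = x"
        using unique t rot' by meson
      then have "?r x \<le> j" by (rule rank_le)
      then have "?r y = Suc (?r x)" using rank_le[OF step] Suc by simp
      then show ?thesis using ne by (auto simp: \<sigma>_def sgn_if)
    qed
  qed
  moreover have "\<sigma> v x y = - \<sigma> v y x" for v x y
    by (auto simp: \<sigma>_def sgn_if)
  ultimately have "link_order T \<sigma>" by unfold_locales
  moreover have "\<sigma> v x y + \<sigma> v y z + \<sigma> v z x \<le> 1" for v x y z
    by (simp add: \<sigma>_def sgn_if)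
  ultimately show ?thesis by blast
qed

definition rename :: "'v \<Rightarrow> 'v \<Rightarrow> ('v \<Rightarrow> 'v \<Rightarrow> int) \<Rightarrow> 'v \<Rightarrow> 'v \<Rightarrow> int" where
  "rename b m s x y = s (if x = m then b else x) (if y = m then b else y)"

text \<open>To all other neighbours \<open>m\<close> looks like \<open>b\<close>, which makes the
  two adjacent; the two explicit values place \<open>m\<close> on the counterclockwise side of
  \<open>b\<close>.\<close>

definition insert_after :: "'v \<Rightarrow> 'v \<Rightarrow> ('v \<Rightarrow> 'v \<Rightarrow> int) \<Rightarrow> 'v \<Rightarrow> 'v \<Rightarrow> int" where
  "insert_after b m s x y =
     (if x = m \<and> y = b then - 1 else if x = b \<and> y = m then 1 else rename b m s x y)"

lemma cyclic_order_rename: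
  assumes R: "cyclic_order R s" and m: "m \<notin> Field R"
    and R': "\<And>x y. (x, y) \<in> R' \<Longrightarrow> x \<noteq> b \<and> y \<noteq> b \<and> (if x = m then b else x, if y = m then b else y) \<in> R"
  shows "cyclic_order R' (rename b m s)"
proof -
  let ?f = "\<lambda>x. if x = m then b else x"
  have "s (?f x) (?f y) + s (?f y) (?f z) + s (?f z) (?f x) = 1"
    if "(x, y) \<in> R'" "z \<in> Domain R'" "z \<noteq> x" "z \<noteq> y" for x y z
  proof -
    obtain z' where "(z, z') \<in> R'" using \<open>z \<in> Domain R'\<close> by blast
    then have "?f z \<in> Domain R" "z \<noteq> b" using R' by blast+
    moreover have "(?f x, ?f y) \<in> R" "x \<noteq> b" "y \<noteq> b" using R' that(1) by blast+
    moreover have "?f z \<noteq> ?f x" "?f z \<noteq> ?f y" using that calculation by auto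
    ultimately show ?thesis using R unfolding cyclic_order_def by blast
  qed
  then show ?thesis
    using R unfolding cyclic_order_def rename_def by blast
qed

lemma cyclic_order_insert_after:
  assumes R: "cyclic_order R s" and m: "m \<notin> Field R" and bc: "(b, c) \<in> R" "b \<noteq> c"
    and uniq: "\<And>y. (b, y) \<in> R \<Longrightarrow> y = c"
    and R': "R' = R - {(b, c)} \<union> {(b, m), (m, c)}"
  shows "cyclic_order R' (insert_after b m s)"
proof -
  let ?s = "insert_after b m s"
  have mb: "m \<noteq> b" "m \<noteq> c" using m bc by (auto simp: Field_def)
  have anti: "s x y = - s y x" for x y
    using R unfolding cyclic_order_def by blast
  have tri: "s x y + s y z + s z x = 1" if "(x, y) \<in> R" "z \<in> Domain R" "z \<noteq> x" "z \<noteq> y" for x y z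
    using R that unfolding cyclic_order_def by blast
  have s0: "?s x y = s x y" if "x \<noteq> m" "y \<noteq> m" for x y
    using that by (simp add: insert_after_def rename_def)
  have sb: "?s b m = 1" "?s m b = - 1"
    using mb by (simp_all add: insert_after_def)
  have sx: "?s x m = s x b" "?s m x = s b x" if "x \<noteq> m" "x \<noteq> b" for x
    using that by (simp_all add: insert_after_def rename_def)
  have "?s x y = - ?s y x" for x y
  proof (cases "x = m \<and> y = b \<or> x = b \<and> y = m")
    case True
    then show ?thesis using sb by (metis minus_minus)
  next
    case False
    then have "?s x y = rename b m s x y" "?s y x = rename b m s y x"
      unfolding insert_after_def by argo+
    moreover have "rename b m s x y = - rename b m s y x"
      unfolding rename_def by (rule anti)
    ultimately show ?thesis by (simp only:)
  qed
  moreover have "?s x y + ?s y z + ?s z x = 1"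
    if xy: "(x, y) \<in> R'" and z: "z \<in> Domain R'" "z \<noteq> x" "z \<noteq> y" for x y z
  proof -
    have zR: "z \<in> Domain R" if "z \<noteq> m"
      using z(1) that bc unfolding R' by blast
    consider "(x, y) \<in> R" "x \<noteq> b" | "x = b" "y = m" | "x = m" "y = c"
      using xy uniq unfolding R' by blast
    then show ?thesis
    proof cases
      case 1
      then have xm: "x \<noteq> m" "y \<noteq> m" using m by (auto simp: Field_def)
      show ?thesis
      proof (cases "z = m")
        case True
        \<comment> \<open>With \<open>z = m\<close> the triple is the old one for \<open>b\<close>.
          If \<open>y = b\<close>, that triple degenerates and the sum 1 comes from the sign between
          \<open>b\<close> and \<open>m\<close> alone.\<close>
        show ?thesis
        proof (cases "y = b")
          case True
          then show ?thesis using \<open>z = m\<close> xm 1 anti[of x b] by (simp add: s0 sb sx)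
        next
          case False
          then show ?thesis using \<open>z = m\<close> xm 1 tri[of x y b] bc by (auto simp: s0 sx)
        qed
      next
        case False
        then show ?thesis using xm 1 tri[OF 1(1) zR] z by (simp add: s0)
      qed
    next
      case 2
      then show ?thesis using z mb anti[of b z] by (simp add: s0 sb sx)
    next
      case 3
      then have "z \<noteq> m" using z by simp
      show ?thesis
      proof (cases "z = b")
        case True
        then show ?thesis using 3 mb bc anti[of b c] by (simp add: s0 sb sx)
      next
        case False
        then show ?thesis using 3 mb bc \<open>z \<noteq> m\<close> tri[OF bc(1) zR] z by (simp add: s0 sx)
      qed
    qed
  qed
  ultimately show ?thesis unfolding cyclic_order_def by blast
qed

section \<open>Stellar moves and the incidence axioms\<close>

lemma mem_rotations:
  "(x, y, z) \<in> rotations (a, b, c) \<longleftrightarrow> x = a \<and> y = b \<and> z = c \<or> x = b \<and> y = c \<and> z = a \<or> x = c \<and> y = a \<and> z = b"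
  by (auto simp: rotations_def)

lemma verts_eq_fst_edges: "verts T = fst ` edges T"
  by (force simp: verts_def edges_def)

text \<open>The existence of an opposite triangle is rephrased as symmetry of the edge set, which is
  immediate once the edges of a stellar subdivision are known explicitly.\<close>

lemma pseudosurfaceI:
  assumes "finite T" "\<And>a b c. (a, b, c) \<in> T \<Longrightarrow> (b, c, a) \<in> T" "\<And>a b c. (a, b, c) \<in> T \<Longrightarrow> a \<noteq> b"
    "\<And>a b c. (a, b, c) \<in> T \<Longrightarrow> (b, a, c) \<notin> T"
    "\<And>a b c d. (a, b, c) \<in> T \<Longrightarrow> (a, b, d) \<in> T \<Longrightarrow> c = d"
    "\<And>a b. (a, b) \<in> edges T \<Longrightarrow> (b, a) \<in> edges T"
  shows "pseudosurface T"
proof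
  show "\<exists>d. (b, a, d) \<in> T" if "(a, b, c) \<in> T" for a b c
    using assms(6)[of a b] that unfolding edges_def by blast
qed (fact assms)+

context pseudosurface
begin

lemma triangle_unique:
  assumes "(a, b, c) \<in> T"
  shows "(a, b, u) \<in> T \<longleftrightarrow> u = c" "(b, c, u) \<in> T \<longleftrightarrow> u = a" "(c, a, u) \<in> T \<longleftrightarrow> u = b"
  using assms rot rot' unique by blast+

lemma not_in_triangle:
  assumes "m \<notin> verts T"
  shows "(m, x, y) \<notin> T" "(x, m, y) \<notin> T" "(x, y, m) \<notin> T"
  using assms triangle_verts by blast+

lemma edges_star_face:
  assumes "(a, b, c) \<in> T"
  shows "edges (star_face T a b c m) = edges T \<union> {(a, m), (m, a), (b, m), (m, b), (c, m), (m, c)}"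
proof (rule set_eqI)
  fix e :: "'v \<times> 'v"
  obtain x y where e: "e = (x, y)" by fastforce
  let ?T = "star_face T a b c m"
  have new: "(a, b, m) \<in> ?T" "(b, m, a) \<in> ?T" "(m, a, b) \<in> ?T" "(b, c, m) \<in> ?T" "(c, m, b) \<in> ?T"
    "(m, b, c) \<in> ?T" "(c, a, m) \<in> ?T" "(a, m, c) \<in> ?T" "(m, c, a) \<in> ?T"
    unfolding star_face_def Un_iff mem_rotations by blast+
  show "e \<in> edges ?T \<longleftrightarrow> e \<in> edges T \<union> {(a, m), (m, a), (b, m), (m, b), (c, m), (m, c)}"
  proof
    assume "e \<in> edges ?T"
    then obtain z where "(x, y, z) \<in> ?T" by (auto simp: e edges_def)
    then have "(x, y) \<in> edges T \<or> x = m \<and> y \<in> {a, b, c} \<or> y = m \<and> x \<in> {a, b, c}"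
      unfolding star_face_def Un_iff Diff_iff mem_rotations
      using triangle_edges[OF assms] triangle_edges(1)[of x y z] by blast
    then show "e \<in> edges T \<union> {(a, m), (m, a), (b, m), (m, b), (c, m), (m, c)}"
      unfolding e by blast
  next
    assume "e \<in> edges T \<union> {(a, m), (m, a), (b, m), (m, b), (c, m), (m, c)}"
    moreover have "(x, y) \<in> edges ?T" if xy: "(x, y) \<in> edges T"
    proof -
      obtain z where z: "(x, y, z) \<in> T" using xy by (auto simp: edges_def)
      show ?thesis
      proof (cases "(x, y, z) \<in> rotations (a, b, c)")
        case True
        then show ?thesis using new unfolding mem_rotations edges_def by blast
      next
        case False
        then have "(x, y, z) \<in> ?T" using z by (simp add: star_face_def)
        then show ?thesis unfolding edges_def by blast
      qed
    qed
    ultimately show "e \<in> edges ?T" unfolding e edges_def using new by blast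
  qed
qed

lemma verts_star_face:
  assumes "(a, b, c) \<in> T"
  shows "verts (star_face T a b c m) = insert m (verts T)"
  using triangle_verts[OF assms]
  unfolding verts_eq_fst_edges edges_star_face[OF assms] image_Un by auto

lemma pseudosurface_star_face:
  assumes t: "(a, b, c) \<in> T" and m: "m \<notin> verts T"
  shows "pseudosurface (star_face T a b c m)"
proof -
  note ne = triangle_distinct[OF t]
  have m_ne: "m \<noteq> a" "m \<noteq> b" "m \<noteq> c" using m triangle_verts[OF t] by auto
  note tu = triangle_unique[OF t] not_in_triangle[OF m]
  show ?thesis
  proof (rule pseudosurfaceI)
    show "finite (star_face T a b c m)" using finite by (simp add: star_face_def rotations_def)
    show "(y, z, x) \<in> star_face T a b c m" if "(x, y, z) \<in> star_face T a b c m" for x y z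
      using that rot unfolding star_face_def Un_iff Diff_iff mem_rotations by metis
    show "x \<noteq> y" if "(x, y, z) \<in> star_face T a b c m" for x y z
      using that ne m_ne distinct unfolding star_face_def Un_iff Diff_iff mem_rotations by metis
    show "(y, x, z) \<notin> star_face T a b c m" if "(x, y, z) \<in> star_face T a b c m" for x y z
      using that ne m_ne tu no_flip unfolding star_face_def Un_iff Diff_iff mem_rotations by metis
    show "z = u" if "(x, y, z) \<in> star_face T a b c m" "(x, y, u) \<in> star_face T a b c m" for x y z u
      using that ne m_ne tu unique unfolding star_face_def Un_iff Diff_iff mem_rotations by metis
    show "(y, x) \<in> edges (star_face T a b c m)" if "(x, y) \<in> edges (star_face T a b c m)" for x y
      using that edges_sym unfolding edges_star_face[OF t] by blast
  qed
qed

lemma edges_star_edge: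
  assumes "(a, b, c) \<in> T" "(b, a, d) \<in> T" "m \<notin> verts T"
  shows "edges (star_edge T a b c d m) = edges T - {(a, b), (b, a)}
     \<union> {(a, m), (m, a), (b, m), (m, b), (c, m), (m, c), (d, m), (m, d)}"
proof (rule set_eqI)
  fix e :: "'v \<times> 'v"
  obtain x y where e: "e = (x, y)" by fastforce
  let ?T = "star_edge T a b c d m"
  let ?E = "edges T - {(a, b), (b, a)} \<union> {(a, m), (m, a), (b, m), (m, b), (c, m), (m, c), (d, m), (m, d)}"
  note ne = triangle_distinct[OF assms(1)] triangle_distinct[OF assms(2)]
  have m: "m \<noteq> a" "m \<noteq> b"
    using triangle_verts[OF assms(1)] assms(3) by auto
  have new: "(a, m, c) \<in> ?T" "(m, c, a) \<in> ?T" "(c, a, m) \<in> ?T" "(m, b, c) \<in> ?T" "(b, c, m) \<in> ?T"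
    "(c, m, b) \<in> ?T" "(b, m, d) \<in> ?T" "(m, d, b) \<in> ?T" "(d, b, m) \<in> ?T"
    "(m, a, d) \<in> ?T" "(a, d, m) \<in> ?T" "(d, m, a) \<in> ?T"
    by (simp_all add: star_edge_def mem_rotations)
  show "e \<in> edges ?T \<longleftrightarrow> e \<in> ?E"
  proof
    assume "e \<in> edges ?T"
    then obtain z where z: "(x, y, z) \<in> ?T" by (auto simp: e edges_def)
    then consider "(x, y, z) \<in> T" "(x, y, z) \<notin> rotations (a, b, c)" "(x, y, z) \<notin> rotations (b, a, d)"
      | "(x, y) \<in> {(c, a), (b, c), (d, b), (a, d)}" | "x = m \<and> y \<in> {a, b, c, d} \<or> y = m \<and> x \<in> {a, b, c, d}"
      unfolding star_edge_def Un_iff Diff_iff mem_rotations by blast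
    then show "e \<in> ?E"
    proof cases
      case 1
      then have "(x, y) \<noteq> (a, b)" "(x, y) \<noteq> (b, a)"
        using triangle_unique(1)[OF assms(1)] triangle_unique(1)[OF assms(2)]
        unfolding mem_rotations by blast+
      then show ?thesis using triangle_edges(1)[OF 1(1)] unfolding e by blast
    next
      case 2
      then show ?thesis
        using ne triangle_edges[OF assms(1)] triangle_edges[OF assms(2)] unfolding e by blast
    next
      case 3
      then show ?thesis unfolding e by blast
    qed
  next
    assume "e \<in> ?E"
    moreover have "(x, y) \<in> edges ?T" if xy: "(x, y) \<in> edges T" "(x, y) \<noteq> (a, b)" "(x, y) \<noteq> (b, a)"
    proof -
      obtain z where z: "(x, y, z) \<in> T" using xy by (auto simp: edges_def)
      show ?thesis
      proof (cases "(x, y, z) \<in> rotations (a, b, c) \<union> rotations (b, a, d)")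
        case True
        then show ?thesis using new xy(2,3) unfolding Un_iff mem_rotations edges_def by blast
      next
        case False
        then have "(x, y, z) \<in> ?T" using z by (simp add: star_edge_def)
        then show ?thesis unfolding edges_def by blast
      qed
    qed
    ultimately show "e \<in> edges ?T" unfolding e using new unfolding edges_def by blast
  qed
qed

text \<open>Two triangles glued along an edge do not have the same third corner, so the link of a
  vertex inserted on that edge is a genuine four-cycle.\<close>

lemma opposite_distinct:
  assumes "(a, b, c) \<in> T" "(b, a, d) \<in> T"
  shows "c \<noteq> d"
  using assms no_flip by blast

lemma verts_star_edge:
  assumes "(a, b, c) \<in> T" "(b, a, d) \<in> T" "m \<notin> verts T"
  shows "verts (star_edge T a b c d m) = insert m (verts T)"
proof -
  have "x \<in> fst ` (edges T - {(a, b), (b, a)})" if x: "x \<in> verts T" for x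
  proof -
    \<comment> \<open>Deleting the edge between \<open>a\<close> and \<open>b\<close> loses no
      vertex: both ends remain joined to \<open>c\<close>.\<close>
    have "(a, c) \<in> edges T" "(b, c) \<in> edges T" "c \<noteq> a" "c \<noteq> b"
      using triangle_edges[OF assms(1)] triangle_distinct[OF assms(1)] by auto
    moreover obtain y where "(x, y) \<in> edges T"
      using x unfolding verts_eq_fst_edges by auto
    ultimately show ?thesis by (cases "x = a \<or> x = b") force+
  qed
  then have "verts T \<subseteq> fst ` (edges T - {(a, b), (b, a)})" by blast
  moreover have "fst ` (edges T - {(a, b), (b, a)}) \<subseteq> verts T"
    unfolding verts_eq_fst_edges by blast
  ultimately have "fst ` (edges T - {(a, b), (b, a)}) = verts T" by blast
  then show ?thesis
    unfolding verts_eq_fst_edges[of "star_edge T a b c d m"] edges_star_edge[OF assms] image_Un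
    using triangle_verts[OF assms(1)] triangle_verts[OF assms(2)] by auto
qed

lemma pseudosurface_star_edge:
  assumes t: "(a, b, c) \<in> T" "(b, a, d) \<in> T" and m: "m \<notin> verts T"
  shows "pseudosurface (star_edge T a b c d m)"
proof -
  note ne = triangle_distinct[OF t(1)] triangle_distinct[OF t(2)] opposite_distinct[OF t]
  have m_ne: "m \<noteq> a" "m \<noteq> b" "m \<noteq> c" "m \<noteq> d"
    using m triangle_verts[OF t(1)] triangle_verts[OF t(2)] by auto
  note tu = triangle_unique[OF t(1)] triangle_unique[OF t(2)] not_in_triangle[OF m]
  show ?thesis
  proof (rule pseudosurfaceI)
    show "finite (star_edge T a b c d m)" using finite by (simp add: star_edge_def rotations_def)
    show "(y, z, x) \<in> star_edge T a b c d m" if "(x, y, z) \<in> star_edge T a b c d m" for x y z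
      using that rot unfolding star_edge_def Un_iff Diff_iff mem_rotations by metis
    show "x \<noteq> y" if "(x, y, z) \<in> star_edge T a b c d m" for x y z
      using that ne m_ne distinct unfolding star_edge_def Un_iff Diff_iff mem_rotations by metis
    show "(y, x, z) \<notin> star_edge T a b c d m" if "(x, y, z) \<in> star_edge T a b c d m" for x y z
      using that ne m_ne tu no_flip unfolding star_edge_def Un_iff Diff_iff mem_rotations by metis
    show "z = u" if "(x, y, z) \<in> star_edge T a b c d m" "(x, y, u) \<in> star_edge T a b c d m" for x y z u
      using that ne m_ne tu unique unfolding star_edge_def Un_iff Diff_iff mem_rotations by metis
    show "(y, x) \<in> edges (star_edge T a b c d m)" if "(x, y) \<in> edges (star_edge T a b c d m)" for x y
      using that edges_sym unfolding edges_star_edge[OF t m] by blast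
  qed
qed

end

lemma cyclic_order_sgn_diff:
  fixes p :: "'v \<Rightarrow> int"
  assumes "\<And>x y z. (x, y) \<in> R \<Longrightarrow> z \<in> Domain R \<Longrightarrow> z \<noteq> x \<Longrightarrow> z \<noteq> y \<Longrightarrow>
      p x < p y \<and> p y < p z \<or> p y < p z \<and> p z < p x \<or> p z < p x \<and> p x < p y"
  shows "cyclic_order R (\<lambda>x y. sgn (p y - p x))"
  unfolding cyclic_order_def
proof (intro conjI allI impI)
  show "sgn (p y - p x) = - sgn (p x - p y)" for x y
    by (simp add: sgn_if)
  fix x y z assume "(x, y) \<in> R" "z \<in> Domain R" "z \<noteq> x" "z \<noteq> y"
  from assms[OF this] show "sgn (p y - p x) + sgn (p z - p y) + sgn (p x - p z) = 1"
    by (auto simp: sgn_if)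
qed

section \<open>Signs on the subdivided triangulation\<close>

context link_order
begin

lemma cyclic_order_link: "cyclic_order (link T v) (\<sigma> v)"
  using link_order_axioms by (simp add: link_order_iff)

lemma cyclic_order_insert_link:
  assumes "(v, b, c) \<in> T" "m \<notin> verts T" "R' = link T v - {(b, c)} \<union> {(b, m), (m, c)}"
  shows "cyclic_order R' (insert_after b m (\<sigma> v))"
proof (rule cyclic_order_insert_after[OF cyclic_order_link _ _ _ _ assms(3)])
  show "m \<notin> Field (link T v)"
    using not_in_triangle[OF assms(2)] by (auto simp: link_def Field_def)
  show "b \<noteq> c" using triangle_distinct[OF assms(1)] by blast
  show "(b, c) \<in> link T v" using assms(1) by (simp add: link_def)
  show "y = c" if "(b, y) \<in> link T v" for y
    using that assms(1) unique unfolding link_def by blast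
qed

lemma cyclic_order_rename_link:
  assumes "(v, d, b) \<in> T" "(v, b, c) \<in> T" "m \<notin> verts T" "c \<noteq> d"
    and R': "R' = link T v - {(d, b), (b, c)} \<union> {(d, m), (m, c)}"
  shows "cyclic_order R' (rename b m (\<sigma> v))"
proof (rule cyclic_order_rename[OF cyclic_order_link])
  have m: "m \<noteq> b" "m \<noteq> c" "m \<noteq> d"
    using triangle_verts[OF assms(1)] triangle_verts[OF assms(2)] assms(3) by auto
  show "m \<notin> Field (link T v)"
    using not_in_triangle[OF assms(3)] by (auto simp: link_def Field_def)
  fix x y assume "(x, y) \<in> R'"
  then consider "(v, x, y) \<in> T" "(x, y) \<noteq> (d, b)" "(x, y) \<noteq> (b, c)" | "x = d" "y = m" | "x = m" "y = c"
    unfolding R' link_def by blast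
  then show "x \<noteq> b \<and> y \<noteq> b \<and> (if x = m then b else x, if y = m then b else y) \<in> link T v"
  proof cases
    case 1
    then have "x \<noteq> b" "y \<noteq> b"
      using triangle_unique(1)[OF rot[OF rot[OF assms(1)]]] unique assms(1,2) rot rot' by blast+
    then show ?thesis using 1 not_in_triangle[OF assms(3)] by (auto simp: link_def)
  next
    case 2
    then show ?thesis using m assms triangle_distinct[OF assms(1)] by (simp add: link_def)
  next
    case 3
    then show ?thesis using m assms triangle_distinct[OF assms(2)] by (auto simp: link_def)
  qed
qed

text \<open>In the link of each corner the new vertex enters between the other two corners. Signs
  among old vertices are unchanged, which is what the comparison of forms requires.\<close>

lemma link_order_star_face:
  assumes t: "(a, b, c) \<in> T" and m: "m \<notin> verts T"
  shows "\<exists>\<sigma>'. link_order (star_face T a b c m) \<sigma>' \<and>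
    (\<forall>v\<in>verts T. \<forall>x\<in>verts T. \<forall>y\<in>verts T. \<sigma>' v x y = \<sigma> v x y)"
proof -
  let ?T = "star_face T a b c m"
  note ne = triangle_distinct[OF t]
  have m_ne: "m \<noteq> a" "m \<noteq> b" "m \<noteq> c" using m triangle_verts[OF t] by auto
  note nt = not_in_triangle[OF m]
  define p :: "'v \<Rightarrow> int" where "p x = (if x = a then 0 else if x = b then 1 else 2)" for x
  define \<sigma>' where "\<sigma>' v = (if v = m then (\<lambda>x y. sgn (p y - p x))
      else if v = a then insert_after b m (\<sigma> a)
      else if v = b then insert_after c m (\<sigma> b)
      else if v = c then insert_after a m (\<sigma> c) else \<sigma> v)" for v
  have link_eq: "link ?T v = {(x, y). (v, x, y) \<in> T \<and> \<not> (v, x, y) \<in> rotations (a, b, c)}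
      \<union> {(x, y). (v, x, y) \<in> rotations (a, b, m) \<union> rotations (b, c, m) \<union> rotations (c, a, m)}" for v
    by (auto simp: link_def star_face_def)
  have "cyclic_order (link ?T v) (\<sigma>' v)" for v
  proof -
    consider "v = m" | "v = a" | "v = b" | "v = c" | "v \<notin> {a, b, c, m}" by blast
    then show ?thesis
    proof cases
      case 1
      have "link ?T m = {(a, b), (b, c), (c, a)}"
        using m_ne nt by (auto simp: link_eq mem_rotations)
      then have "cyclic_order (link ?T m) (\<lambda>x y. sgn (p y - p x))"
        using ne by (intro cyclic_order_sgn_diff) (auto simp: p_def)
      then show ?thesis using 1 by (simp add: \<sigma>'_def)
    next
      case 2
      have "link ?T a = link T a - {(b, c)} \<union> {(b, m), (m, c)}"
        using ne m_ne unfolding link_eq by (auto simp: link_def mem_rotations)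
      then have "cyclic_order (link ?T a) (insert_after b m (\<sigma> a))"
        by (rule cyclic_order_insert_link[OF t m])
      then show ?thesis using 2 m_ne ne by (auto simp: \<sigma>'_def)
    next
      case 3
      have "link ?T b = link T b - {(c, a)} \<union> {(c, m), (m, a)}"
        using ne m_ne unfolding link_eq by (auto simp: link_def mem_rotations)
      then have "cyclic_order (link ?T b) (insert_after c m (\<sigma> b))"
        by (rule cyclic_order_insert_link[OF rot[OF t] m])
      then show ?thesis using 3 m_ne ne by (auto simp: \<sigma>'_def)
    next
      case 4
      have "link ?T c = link T c - {(a, b)} \<union> {(a, m), (m, b)}"
        using ne m_ne unfolding link_eq by (auto simp: link_def mem_rotations)
      then have "cyclic_order (link ?T c) (insert_after a m (\<sigma> c))"
        by (rule cyclic_order_insert_link[OF rot'[OF t] m])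
      then show ?thesis using 4 m_ne ne by (auto simp: \<sigma>'_def)
    next
      case 5
      have "link ?T v = link T v"
        using 5 unfolding link_eq by (auto simp: link_def mem_rotations)
      then show ?thesis using 5 cyclic_order_link by (simp add: \<sigma>'_def)
    qed
  qed
  then have "link_order ?T \<sigma>'"
    using pseudosurface_star_face[OF t m] by (simp add: link_order_iff)
  moreover have "\<sigma>' v x y = \<sigma> v x y" if "v \<in> verts T" "x \<in> verts T" "y \<in> verts T" for v x y
  proof -
    have "v \<noteq> m" "x \<noteq> m" "y \<noteq> m" using that m by auto
    then show ?thesis by (simp add: \<sigma>'_def insert_after_def rename_def)
  qed
  ultimately show ?thesis by blast
qed

text \<open>At \<open>a\<close> and \<open>b\<close> the new vertex takes the place of the other
  end, so signs are renamed; at \<open>c\<close> and \<open>d\<close> it is inserted between the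
  ends. The old signs survive only after this replacement, hence the conditionals in the
  conclusion.\<close>

lemma link_order_star_edge:
  assumes t: "(a, b, c) \<in> T" "(b, a, d) \<in> T" and m: "m \<notin> verts T"
  shows "\<exists>\<sigma>'. link_order (star_edge T a b c d m) \<sigma>' \<and>
    (\<forall>v\<in>verts T. \<forall>x\<in>verts T. \<forall>y\<in>verts T.
       \<sigma>' v (if v = a \<and> x = b \<or> v = b \<and> x = a then m else x)
          (if v = a \<and> y = b \<or> v = b \<and> y = a then m else y) = \<sigma> v x y)"
proof -
  let ?T = "star_edge T a b c d m"
  note ne = triangle_distinct[OF t(1)] triangle_distinct[OF t(2)] opposite_distinct[OF t]
  have m_ne: "m \<noteq> a" "m \<noteq> b" "m \<noteq> c" "m \<noteq> d"
    using m triangle_verts[OF t(1)] triangle_verts[OF t(2)] by auto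
  note nt = not_in_triangle[OF m]
  \<comment> \<open>Numbers the link of \<open>m\<close> counterclockwise: \<open>a\<close>,
    \<open>d\<close>, \<open>b\<close>, \<open>c\<close>.\<close>
  define p :: "'v \<Rightarrow> int" where "p x = (if x = a then 0 else if x = d then 1 else if x = b then 2 else 3)" for x
  define \<sigma>' where "\<sigma>' v = (if v = m then (\<lambda>x y. sgn (p y - p x))
      else if v = a then rename b m (\<sigma> a)
      else if v = b then rename a m (\<sigma> b)
      else if v = c then insert_after a m (\<sigma> c)
      else if v = d then insert_after b m (\<sigma> d) else \<sigma> v)" for v
  have link_eq: "link ?T v = {(x, y). (v, x, y) \<in> T \<and> \<not> (v, x, y) \<in> rotations (a, b, c) \<and> \<not> (v, x, y) \<in> rotations (b, a, d)}
      \<union> {(x, y). (v, x, y) \<in> rotations (a, m, c) \<union> rotations (m, b, c) \<union> rotations (b, m, d) \<union> rotations (m, a, d)}" for v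
    by (auto simp: link_def star_edge_def)
  have "cyclic_order (link ?T v) (\<sigma>' v)" for v
  proof -
    consider "v = m" | "v = a" | "v = b" | "v = c" | "v = d" | "v \<notin> {a, b, c, d, m}" by blast
    then show ?thesis
    proof cases
      case 1
      have "link ?T m = {(a, d), (d, b), (b, c), (c, a)}"
        using m_ne nt by (auto simp: link_eq mem_rotations)
      then have "cyclic_order (link ?T m) (\<lambda>x y. sgn (p y - p x))"
        using ne by (intro cyclic_order_sgn_diff) (auto simp: p_def)
      then show ?thesis using 1 by (simp add: \<sigma>'_def)
    next
      case 2
      have "link ?T a = link T a - {(d, b), (b, c)} \<union> {(d, m), (m, c)}"
        using ne m_ne unfolding link_eq by (auto simp: link_def mem_rotations)
      then have "cyclic_order (link ?T a) (rename b m (\<sigma> a))"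
        by (rule cyclic_order_rename_link[OF rot[OF t(2)] t(1) m ne(3)])
      then show ?thesis using 2 m_ne ne by (auto simp: \<sigma>'_def)
    next
      case 3
      have "link ?T b = link T b - {(c, a), (a, d)} \<union> {(c, m), (m, d)}"
        using ne m_ne unfolding link_eq by (auto simp: link_def mem_rotations)
      then have "cyclic_order (link ?T b) (rename a m (\<sigma> b))"
        by (rule cyclic_order_rename_link[OF rot[OF t(1)] t(2) m ne(3)[symmetric]])
      then show ?thesis using 3 m_ne ne by (auto simp: \<sigma>'_def)
    next
      case 4
      have "link ?T c = link T c - {(a, b)} \<union> {(a, m), (m, b)}"
        using ne m_ne unfolding link_eq by (auto simp: link_def mem_rotations)
      then have "cyclic_order (link ?T c) (insert_after a m (\<sigma> c))"
        by (rule cyclic_order_insert_link[OF rot'[OF t(1)] m])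
      then show ?thesis using 4 m_ne ne by (auto simp: \<sigma>'_def)
    next
      case 5
      have "link ?T d = link T d - {(b, a)} \<union> {(b, m), (m, a)}"
        using ne m_ne unfolding link_eq by (auto simp: link_def mem_rotations)
      then have "cyclic_order (link ?T d) (insert_after b m (\<sigma> d))"
        by (rule cyclic_order_insert_link[OF rot'[OF t(2)] m])
      then show ?thesis using 5 m_ne ne by (auto simp: \<sigma>'_def)
    next
      case 6
      have "link ?T v = link T v"
        using 6 unfolding link_eq by (auto simp: link_def mem_rotations)
      then show ?thesis using 6 cyclic_order_link by (simp add: \<sigma>'_def)
    qed
  qed
  then have "link_order ?T \<sigma>'"
    using pseudosurface_star_edge[OF t m] by (simp add: link_order_iff)
  moreover have "\<sigma>' v (if v = a \<and> x = b \<or> v = b \<and> x = a then m else x)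
          (if v = a \<and> y = b \<or> v = b \<and> y = a then m else y) = \<sigma> v x y"
    if "v \<in> verts T" "x \<in> verts T" "y \<in> verts T" for v x y
  proof -
    have "v \<noteq> m" "x \<noteq> m" "y \<noteq> m" using that m by auto
    then show ?thesis using ne
      by (cases "v = a"; cases "v = b"; cases "v = c"; cases "v = d")
        (auto simp: \<sigma>'_def insert_after_def rename_def)
  qed
  ultimately show ?thesis by blast
qed

end

section \<open>Cycles and the form under stellar moves\<close>

context pseudosurface
begin

lemma cycles1_star_face:
  assumes z: "z \<in> cycles1 T" and t: "(a, b, c) \<in> T" and m: "m \<notin> verts T"
  shows "z \<in> cycles1 (star_face T a b c m)"
proof -
  have zm: "z (m, x) = 0" "z (x, m) = 0" for x
    using m edges_verts cycles1D(2)[OF z] by blast+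
  have "(\<Sum>x\<in>insert m (verts T). z (v, x)) = 0" if "v \<in> insert m (verts T)" for v
    using that m finite_verts cycles1D(3)[OF z] by (auto simp: zm)
  then show ?thesis
    unfolding cycles1_def verts_star_face[OF t] edges_star_face[OF t]
    using cycles1D(1,2)[OF z] by blast
qed

text \<open>Near an old vertex the subdivided chain is the old one with the far end of the split
  edge moved to \<open>m\<close>. The free function \<open>h\<close> lets the same computation serve
  the cycle condition and the form.\<close>

lemma star_edge_chain_sum:
  assumes z: "z \<in> cycles1 T" and t: "(a, b, c) \<in> T" and m: "m \<notin> verts T" and v: "v \<in> verts T"
  shows "(\<Sum>x\<in>insert m (verts T). star_edge_chain a b m z (v, x) * h x) =
    (\<Sum>x\<in>verts T. z (v, x) * h (if v = a \<and> x = b \<or> v = b \<and> x = a then m else x))"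
proof -
  let ?V = "verts T" and ?z = "star_edge_chain a b m z"
  have V: "a \<in> ?V" "b \<in> ?V" "a \<noteq> b" using triangle_verts[OF t] triangle_distinct[OF t] by auto
  have ne: "m \<noteq> a" "m \<noteq> b" "m \<noteq> v" using m V v by auto
  have split: "(\<Sum>x\<in>insert m ?V. ?z (v, x) * h x) = ?z (v, m) * h m + (\<Sum>x\<in>?V. ?z (v, x) * h x)"
    using m finite_verts by simp
  have old: "?z (u, x) = (if u = a \<and> x = b \<or> u = b \<and> x = a then 0 else z (u, x))"
    if "x \<in> ?V" "u \<in> ?V" for u x
    using that m ne by (auto simp: star_edge_chain_def)
  consider "v = a" | "v = b" | "v \<noteq> a" "v \<noteq> b" by blast
  then show ?thesis
  proof cases
    case 1
    have "(\<Sum>x\<in>?V. z (v, x) * h (if v = a \<and> x = b \<or> v = b \<and> x = a then m else x)) =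
      (\<Sum>x\<in>?V. ?z (v, x) * h x + (if x = b then z (a, b) * h m else 0))"
      using 1 V by (intro sum.cong) (auto simp: old)
    also have "\<dots> = (\<Sum>x\<in>?V. ?z (v, x) * h x) + z (a, b) * h m"
      using V finite_verts by (simp add: sum.distrib)
    finally show ?thesis unfolding split using 1 ne V by (simp add: star_edge_chain_def)
  next
    case 2
    have "(\<Sum>x\<in>?V. z (v, x) * h (if v = a \<and> x = b \<or> v = b \<and> x = a then m else x)) =
      (\<Sum>x\<in>?V. ?z (v, x) * h x + (if x = a then z (b, a) * h m else 0))"
      using 2 V by (intro sum.cong) (auto simp: old)
    also have "\<dots> = (\<Sum>x\<in>?V. ?z (v, x) * h x) + z (b, a) * h m"
      using V finite_verts by (simp add: sum.distrib)
    finally show ?thesis unfolding split using 2 ne V by (simp add: star_edge_chain_def)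
  next
    case 3
    have "z (v, m) = 0" using m edges_verts cycles1D(2)[OF z] by blast
    then have "?z (v, m) = 0" using 3 ne by (simp add: star_edge_chain_def)
    then show ?thesis unfolding split using 3 v by (simp add: old)
  qed
qed

text \<open>The chain passes straight through \<open>m\<close>, with multiplicity
  \<open>z (a, b)\<close>, from \<open>a\<close> to \<open>b\<close>.\<close>

lemma star_edge_chain_sum_centre:
  assumes z: "z \<in> cycles1 T" and t: "(a, b, c) \<in> T" and m: "m \<notin> verts T"
  shows "(\<Sum>x\<in>insert m (verts T). star_edge_chain a b m z (m, x) * h x) = z (a, b) * (h b - h a)"
proof -
  let ?V = "verts T" and ?z = "star_edge_chain a b m z"
  have V: "a \<in> ?V" "b \<in> ?V" "a \<noteq> b" using triangle_verts[OF t] triangle_distinct[OF t] by auto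
  have ne: "m \<noteq> a" "m \<noteq> b" using m V by auto
  have "z (m, x) = 0" for x
    using m edges_verts cycles1D(2)[OF z] by blast
  then have "?z (m, x) * h x = (if x = b then z (a, b) * h b else 0) - (if x = a then z (a, b) * h a else 0)" for x
    using ne V cycles1D(1)[OF z, of b a] by (auto simp: star_edge_chain_def)
  then show ?thesis
    using V finite_verts by (simp add: sum_subtractf right_diff_distrib)
qed

lemma cycles1_star_edge:
  assumes z: "z \<in> cycles1 T" and t: "(a, b, c) \<in> T" "(b, a, d) \<in> T" and m: "m \<notin> verts T"
  shows "star_edge_chain a b m z \<in> cycles1 (star_edge T a b c d m)"
proof -
  let ?z = "star_edge_chain a b m z"
  have "a \<noteq> b" "m \<noteq> a" "m \<noteq> b"
    using triangle_distinct[OF t(1)] triangle_verts[OF t(1)] m by auto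
  then have "?z (y, x) = - ?z (x, y)" for x y
    using cycles1D(1)[OF z, of y x] cycles1D(1)[OF z, of b a] unfolding star_edge_chain_def
    by (smt (verit) prod.inject)
  moreover have "?z e = 0" if "e \<notin> edges (star_edge T a b c d m)" for e
    using that cycles1D(2)[OF z, of e] unfolding edges_star_edge[OF t m] star_edge_chain_def by auto
  moreover have "(\<Sum>x\<in>insert m (verts T). ?z (v, x)) = 0" if "v \<in> insert m (verts T)" for v
    using that star_edge_chain_sum_centre[OF z t(1) m, of "\<lambda>_. 1"]
      star_edge_chain_sum[OF z t(1) m, of v "\<lambda>_. 1"] cycles1D(3)[OF z, of v] by auto
  ultimately show ?thesis
    unfolding cycles1_def verts_star_edge[OF t m] by blast
qed

end

context link_order
begin

lemma form_star_face:
  assumes y: "y \<in> cycles1 T" and m: "m \<notin> verts T"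
    and \<sigma>': "\<forall>v\<in>verts T. \<forall>x\<in>verts T. \<forall>u\<in>verts T. \<sigma>' v x u = \<sigma> v x u"
    and z: "z \<in> cycles1 T"
  shows "form (insert m (verts T)) \<sigma>' y z = form (verts T) \<sigma> y z"
proof -
  have "y (m, x) = 0" "y (x, m) = 0" "z (m, x) = 0" "z (x, m) = 0" for x
    using m edges_verts cycles1D(2)[OF y] cycles1D(2)[OF z] by blast+
  then show ?thesis
    using m finite_verts \<sigma>' by (simp add: form_def)
qed

lemma form_star_edge:
  assumes t: "(a, b, c) \<in> T" and m: "m \<notin> verts T"
    and \<sigma>': "\<forall>v\<in>verts T. \<forall>x\<in>verts T. \<forall>y\<in>verts T.
       \<sigma>' v (if v = a \<and> x = b \<or> v = b \<and> x = a then m else x)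
          (if v = a \<and> y = b \<or> v = b \<and> y = a then m else y) = \<sigma> v x y"
    and anti: "\<And>x y. \<sigma>' m x y = - \<sigma>' m y x"
    and y: "y \<in> cycles1 T" and z: "z \<in> cycles1 T"
  shows "form (insert m (verts T)) \<sigma>' (star_edge_chain a b m y) (star_edge_chain a b m z) = form (verts T) \<sigma> y z"
proof -
  let ?V = "verts T" and ?y = "star_edge_chain a b m y" and ?z = "star_edge_chain a b m z"
  let ?\<rho> = "\<lambda>v x. if v = a \<and> x = b \<or> v = b \<and> x = a then m else x"
  define S where "S v = (\<Sum>x\<in>insert m ?V. ?y (v, x) * (\<Sum>u\<in>insert m ?V. ?z (v, u) * \<sigma>' v x u))" for v
  have "form (insert m ?V) \<sigma>' ?y ?z = S m + (\<Sum>v\<in>?V. S v)"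
    using m finite_verts by (simp only: form_def sum_distrib_left[symmetric] S_def sum.insert not_False_eq_True)
  \<comment> \<open>At \<open>m\<close> both chains run along the same two half-edges; parallel
    strands contribute nothing by antisymmetry of the signs.\<close>
  also have "S m = 0"
  proof -
    have "\<sigma>' m a a = 0" "\<sigma>' m b b = 0" "\<sigma>' m b a = - \<sigma>' m a b"
      using anti[of a a] anti[of b b] anti[of b a] by auto
    then show ?thesis
      unfolding S_def star_edge_chain_sum_centre[OF y t m] star_edge_chain_sum_centre[OF z t m] by simp
  qed
  also have "(\<Sum>v\<in>?V. S v) = (\<Sum>v\<in>?V. \<Sum>x\<in>?V. y (v, x) * (\<Sum>u\<in>?V. z (v, u) * \<sigma>' v (?\<rho> v x) (?\<rho> v u)))"
    unfolding S_def by (rule sum.cong[OF HOL.refl])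
      (simp only: star_edge_chain_sum[OF y t m] star_edge_chain_sum[OF z t m])
  also have "\<dots> = form ?V \<sigma> y z"
    unfolding form_def sum_distrib_left[symmetric] using \<sigma>' by (simp cong: sum.cong)
  finally show ?thesis by simp
qed

text \<open>Signs have to be rebuilt at every stellar move, so they are existentially quantified.
  That \<open>F\<close> maps cycles to cycles belongs to the induction because the invariance steps
  apply to cycles.\<close>

lemma subdivision_form:
  assumes "subdivision T T' F"
  shows "\<exists>\<sigma>'. link_order T' \<sigma>' \<and> (\<forall>z\<in>cycles1 T. F z \<in> cycles1 T') \<and>
    (\<forall>y\<in>cycles1 T. \<forall>z\<in>cycles1 T. form (verts T') \<sigma>' (F y) (F z) = form (verts T) \<sigma> y z)"
  using assms
proof induction
  case refl
  then show ?case using link_order_axioms by blast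
next
  case (face T' F a b c m)
  then obtain \<sigma>' where \<sigma>': "link_order T' \<sigma>'" "\<forall>z\<in>cycles1 T. F z \<in> cycles1 T'"
    "\<forall>y\<in>cycles1 T. \<forall>z\<in>cycles1 T. form (verts T') \<sigma>' (F y) (F z) = form (verts T) \<sigma> y z" by blast
  interpret T': link_order T' \<sigma>' by fact
  obtain \<tau> where \<tau>: "link_order (star_face T' a b c m) \<tau>"
    "\<forall>v\<in>verts T'. \<forall>x\<in>verts T'. \<forall>y\<in>verts T'. \<tau> v x y = \<sigma>' v x y"
    using T'.link_order_star_face face by blast
  show ?case
    using \<tau>(1) \<sigma>'(2,3) T'.cycles1_star_face[OF _ face(2,3)] T'.form_star_face[OF _ face(3) \<tau>(2)]
    unfolding T'.verts_star_face[OF face(2)] by metis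
next
  case (edge T' F a b c d m)
  then obtain \<sigma>' where \<sigma>': "link_order T' \<sigma>'" "\<forall>z\<in>cycles1 T. F z \<in> cycles1 T'"
    "\<forall>y\<in>cycles1 T. \<forall>z\<in>cycles1 T. form (verts T') \<sigma>' (F y) (F z) = form (verts T) \<sigma> y z" by blast
  interpret T': link_order T' \<sigma>' by fact
  obtain \<tau> where \<tau>: "link_order (star_edge T' a b c d m) \<tau>"
    and \<tau>': "\<forall>v\<in>verts T'. \<forall>x\<in>verts T'. \<forall>y\<in>verts T'.
       \<tau> v (if v = a \<and> x = b \<or> v = b \<and> x = a then m else x)
          (if v = a \<and> y = b \<or> v = b \<and> y = a then m else y) = \<sigma>' v x y"
    using T'.link_order_star_edge[OF edge(2,3,4)] by blast
  interpret T'': link_order "star_edge T' a b c d m" \<tau> by fact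
  show ?case
    using \<tau> \<sigma>'(2,3) T'.cycles1_star_edge[OF _ edge(2,3,4)]
      T'.form_star_edge[OF edge(2,4) \<tau>' T''.antisym]
    unfolding T'.verts_star_edge[OF edge(2,3,4)] by metis
qed

text \<open>The left side depends on no subdivision and no representatives, and its value on
  \<open>T\<close> is fixed by \<open>y\<close> and \<open>z\<close>. All admissible choices
  therefore yield the same intersection number.\<close>

lemma form_eq_intersection_number:
  assumes "y \<in> cycles1 T" "z \<in> cycles1 T" "subdivision T T' F"
    and \<beta>: "represents T' F \<beta> (hclass T y)" and \<gamma>: "represents T' F \<gamma> (hclass T z)"
    and "transverse T' \<beta> \<gamma>"
  shows "form (verts T) \<sigma> y z = - 2 * intersection_number T' \<beta> \<gamma>"
proof -
  obtain \<sigma>' where \<sigma>': "link_order T' \<sigma>'" "\<And>z. z \<in> cycles1 T \<Longrightarrow> F z \<in> cycles1 T'"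
    "\<And>y z. y \<in> cycles1 T \<Longrightarrow> z \<in> cycles1 T \<Longrightarrow> form (verts T') \<sigma>' (F y) (F z) = form (verts T) \<sigma> y z"
    using subdivision_form[OF assms(3)] by blast
  interpret T': link_order T' \<sigma>' by fact
  obtain y' where y': "y' \<in> cycles1 T" "homologous T y' y" "homologous T' (chain_of \<beta>) (F y')"
    and cy: "closed_walk T' \<beta>"
    using \<beta> unfolding represents_def hclass_def homologous_def by blast
  obtain z' where z': "z' \<in> cycles1 T" "homologous T z' z" "homologous T' (chain_of \<gamma>) (F z')"
    and cz: "closed_walk T' \<gamma>"
    using \<gamma> unfolding represents_def hclass_def homologous_def by blast
  have "form (verts T) \<sigma> y z = form (verts T) \<sigma> y' z'"
    using form_homologous y' z' assms(1,2) by metis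
  also have "\<dots> = form (verts T') \<sigma>' (F y') (F z')"
    using \<sigma>'(3) y' z' by simp
  also have "\<dots> = form (verts T') \<sigma>' (chain_of \<beta>) (chain_of \<gamma>)"
    using T'.form_homologous[of "chain_of \<beta>" "chain_of \<gamma>"] T'.cycles1_chain_of cy cz y' z' \<sigma>'(2) by metis
  also have "\<dots> = - 2 * intersection_number T' \<beta> \<gamma>"
    using T'.form_transverse[OF cy cz assms(6)] .
  finally show ?thesis .
qed

text \<open>The definite description denotes the intended number only if some transverse pair
  exists, so existence is a hypothesis here; uniqueness comes from cancelling the factor -
  2.\<close>

lemma form_eq_hom_intersection:
  assumes "y \<in> cycles1 T" "z \<in> cycles1 T"
    and ex: "\<exists>T' F \<beta> \<gamma>. subdivision T T' F \<and> represents T' F \<beta> (hclass T y) \<and>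
      represents T' F \<gamma> (hclass T z) \<and> transverse T' \<beta> \<gamma>"
  shows "form (verts T) \<sigma> y z = - 2 * hom_intersection T (hclass T y) (hclass T z)"
proof -
  let ?P = "\<lambda>k. \<exists>T' F \<beta> \<gamma>. subdivision T T' F \<and> represents T' F \<beta> (hclass T y) \<and>
      represents T' F \<gamma> (hclass T z) \<and> transverse T' \<beta> \<gamma> \<and> k = intersection_number T' \<beta> \<gamma>"
  have eq: "form (verts T) \<sigma> y z = - 2 * k" if "?P k" for k
    using that form_eq_intersection_number[OF assms(1,2)] by blast
  have "\<exists>k. ?P k" using ex by blast
  then obtain k where k: "?P k" ..
  then have "(THE k. ?P k) = k"
  proof (rule the_equality)
    fix k' assume "?P k'"
    from eq[OF this] eq[OF k] show "k' = k" by simp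
  qed
  then show ?thesis using eq[OF k] by (simp add: hom_intersection_def)
qed

end

section \<open>Barycentric subdivision\<close>

text \<open>The place where infinitely many vertex names matter: every face and every edge must
  receive a new vertex of the same type.\<close>

lemma fresh_injection:
  fixes A :: "'v::infinite set" and B :: "'b set"
  assumes "finite A" "finite B"
  obtains h :: "'b \<Rightarrow> 'v::infinite" where "inj_on h B" "h ` B \<inter> A = {}"
proof -
  have "infinite (UNIV - A)"
    using assms(1) infinite_UNIV by (rule Diff_infinite_finite)
  then obtain C where C: "finite C" "card C = card B" "C \<subseteq> UNIV - A"
    by (metis infinite_arbitrarily_large)
  then obtain h where "bij_betw h B C"
    using finite_same_card_bij[OF assms(2) C(1)] by auto
  then show ?thesis using that C(3) by (metis Diff_disjoint bij_betw_def inf.absorb_iff2 inf_assoc inf_commute inf_bot_right)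
qed

text \<open>The chain map of a long subdivision is obtained only existentially. Additivity reduces
  its value on the chain of a walk to its values on single edges.\<close>

definition chain_additive :: "('v chain \<Rightarrow> 'v chain) \<Rightarrow> bool" where
  "chain_additive F \<longleftrightarrow> F (\<lambda>_. 0) = (\<lambda>_. 0) \<and> (\<forall>y z. F (\<lambda>e. y e + z e) = (\<lambda>e. F y e + F z e))"

text \<open>\<open>g e\<close> is the centre of the triangle to the left of the directed edge \<open>e\<close>, and \<open>m e\<close> the midpoint
  of \<open>e\<close>.\<close>

locale centres = pseudosurface T for T :: "'v triangles" +
  fixes g m :: "'v \<times> 'v \<Rightarrow> 'v"
  assumes g_rot: "(a, b, c) \<in> T \<Longrightarrow> g (a, b) = g (b, c)"
    and g_inj: "(a, b, c) \<in> T \<Longrightarrow> (x, y, z) \<in> T \<Longrightarrow> g (a, b) = g (x, y) \<Longrightarrow> (x, y, z) \<in> rotations (a, b, c)"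
    and g_fresh: "e \<in> edges T \<Longrightarrow> g e \<notin> verts T"
    and m_swap: "m (b, a) = m (a, b)"
    and m_inj: "e \<in> edges T \<Longrightarrow> e' \<in> edges T \<Longrightarrow> m e = m e' \<Longrightarrow> e' = e \<or> e' = prod.swap e"
    and m_fresh: "e \<in> edges T \<Longrightarrow> m e \<notin> verts T"
    and m_neq_g: "e \<in> edges T \<Longrightarrow> e' \<in> edges T \<Longrightarrow> m e \<noteq> g e'"
begin

text \<open>\<open>S\<close> is meant to be closed under rotation. Since \<open>g\<close> takes the
  same value on the three sides of a triangle, the three rotations in \<open>S\<close> supply the
  three new triangles.\<close>

definition cone :: "'v triangles \<Rightarrow> 'v triangles" where
  "cone S = (T - S) \<union> (\<Union>(a, b, c)\<in>S. rotations (a, b, g (a, b)))"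

text \<open>All faces are already starred, and the edges in \<open>S\<close>, meant to contain both
  directions of each edge, are split as well. Starring faces before edges makes
  \<open>bisect (edges T)\<close> the barycentric subdivision.\<close>

definition bisect :: "('v \<times> 'v) set \<Rightarrow> 'v triangles" where
  "bisect S = (\<Union>(a, b)\<in>edges T - S. rotations (a, b, g (a, b))) \<union>
     (\<Union>(a, b)\<in>S. rotations (a, m (a, b), g (a, b)) \<union> rotations (m (a, b), b, g (a, b)))"

lemma mem_cone:
  "(x, y, z) \<in> cone S \<longleftrightarrow> (x, y, z) \<in> T \<and> (x, y, z) \<notin> S \<or> (\<exists>a b c. (a, b, c) \<in> S \<and> (x, y, z) \<in> rotations (a, b, g (a, b)))"
  by (auto simp: cone_def)

lemma subdivision_cone:
  assumes "finite K" "K \<subseteq> rotations ` T"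
  shows "subdivision T (cone (\<Union>K)) (\<lambda>z. z)"
  using assms
proof induction
  case empty
  then show ?case by (simp add: cone_def subdivision.refl)
next
  case (insert R K)
  let ?S = "\<Union>K"
  obtain a b c where R: "R = rotations (a, b, c)" and t: "(a, b, c) \<in> T"
    using insert.prems by auto
  have "rotations t \<subseteq> T" if "t \<in> T" for t
    using that rotations_subset by (cases t) blast
  then have S: "?S \<subseteq> T" using insert.prems by blast
  have disj: "R \<inter> ?S = {}"
  proof -
    have *: "rotations s = rotations t" if "s \<in> rotations t" for s t :: "'v \<times> 'v \<times> 'v"
    proof -
      obtain x y z where "t = (x, y, z)" by (metis prod.exhaust)
      then have "s = (x, y, z) \<or> s = (y, z, x) \<or> s = (z, x, y)" "t = (x, y, z)"
        using that by (simp_all add: rotations_def)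
      then show ?thesis by (elim disjE) (simp_all add: rotations_def insert_commute)
    qed
    have "X = R" if "s \<in> R" "s \<in> X" "X \<in> K" for s X
    proof -
      obtain t where "X = rotations t" using \<open>X \<in> K\<close> insert.prems by blast
      then show ?thesis using *[of s] that R by metis
    qed
    then show ?thesis using insert.hyps by blast
  qed
  have ab: "(a, b) \<in> edges T" "(b, c) \<in> edges T" "(c, a) \<in> edges T" using triangle_edges[OF t] by auto
  have g: "g (b, c) = g (a, b)" "g (c, a) = g (a, b)"
    using g_rot[OF t] g_rot[OF rot[OF t]] by auto
  have "(a, b, c) \<in> cone ?S"
    using t disj unfolding mem_cone R by (auto simp: rotations_def)
  moreover have "g (a, b) \<notin> verts (cone ?S)"
  proof
    assume "g (a, b) \<in> verts (cone ?S)"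
    then obtain x y where "(g (a, b), x, y) \<in> cone ?S" by (auto simp: verts_def)
    then consider "(g (a, b), x, y) \<in> T" | u v w where "(u, v, w) \<in> ?S" "(g (a, b), x, y) \<in> rotations (u, v, g (u, v))"
      unfolding mem_cone by blast
    then show False
    proof cases
      case 1
      then show False using g_fresh[OF ab(1)] triangle_verts by blast
    next
      case 2
      then have uvw: "(u, v, w) \<in> T" using S by blast
      then have "g (a, b) = g (u, v)"
        using 2(2) g_fresh[OF ab(1)] triangle_verts[OF uvw] unfolding mem_rotations by blast
      then have "(u, v, w) \<in> R" using g_inj[OF t uvw] R by blast
      then show False using disj 2(1) by blast
    qed
  qed
  moreover have "star_face (cone ?S) a b c (g (a, b)) = cone (\<Union>(insert R K))"
  proof -
    have "rotations (x, y, g (x, y)) \<inter> R = {}" if "(x, y, z) \<in> ?S" for x y z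
    proof -
      have "(x, y) \<in> edges T" using that S triangle_edges by blast
      then have "g (x, y) \<noteq> a" "g (x, y) \<noteq> b" "g (x, y) \<noteq> c" using g_fresh triangle_verts[OF t] by metis+
      then show ?thesis unfolding R by (auto simp: rotations_def)
    qed
    then have "cone ?S - R = (T - \<Union>(insert R K)) \<union> (\<Union>(a, b, c)\<in>?S. rotations (a, b, g (a, b)))"
      unfolding cone_def by blast
    moreover have "(\<Union>(a, b, c)\<in>R. rotations (a, b, g (a, b))) =
        rotations (a, b, g (a, b)) \<union> rotations (b, c, g (a, b)) \<union> rotations (c, a, g (a, b))"
      unfolding R by (auto simp: rotations_def[of "(a, b, c)"] g)
    ultimately show ?thesis
      unfolding star_face_def R[symmetric] cone_def[of "\<Union>(insert R K)"] by auto
  qed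
  ultimately show ?case
    using subdivision.face[OF insert.IH, of a b c "g (a, b)"] insert.prems by simp
qed

lemma cone_all: "cone (\<Union>(rotations ` T)) = bisect {}"
proof -
  have "rotations t \<subseteq> T" if "t \<in> T" for t
    using that rotations_subset by (cases t) blast
  moreover have "t \<in> rotations t" for t :: "'v \<times> 'v \<times> 'v"
    by (cases t) (simp add: rotations_def)
  ultimately have "\<Union>(rotations ` T) = T" by blast
  then have "cone (\<Union>(rotations ` T)) = (\<Union>(a, b, c)\<in>T. rotations (a, b, g (a, b)))"
    by (simp add: cone_def)
  also have "\<dots> = bisect {}"
    unfolding bisect_def edges_def by blast
  finally show ?thesis .
qed

lemma star_edge_chain_dedge:
  assumes "{x, y} \<noteq> {a, b}" "c \<notin> {x, y}"
  shows "star_edge_chain a b c (dedge x y) = dedge x y"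
proof
  fix e
  have ab: "\<not> (x = a \<and> y = b)" "\<not> (x = b \<and> y = a)" and c: "c \<noteq> x" "c \<noteq> y"
    using assms by auto
  have "dedge x y (a, b) = 0" "dedge x y (b, a) = 0"
    using ab unfolding dedge_def prod.inject by metis+
  moreover have "dedge x y (u, c) = 0" "dedge x y (c, u) = 0" for u
    using c unfolding dedge_def prod.inject by metis+
  ultimately show "star_edge_chain a b c (dedge x y) e = dedge x y e"
    unfolding star_edge_chain_def by presburger
qed

lemma star_edge_chain_dedge_self:
  assumes "a \<noteq> b" "c \<noteq> a" "c \<noteq> b"
  shows "star_edge_chain a b c (dedge a b) = (\<lambda>e. dedge a c e + dedge c b e)"
    "star_edge_chain a b c (dedge b a) = (\<lambda>e. dedge b c e + dedge c a e)"
proof -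
  have "star_edge_chain a b c (dedge a b) e = dedge a c e + dedge c b e \<and>
      star_edge_chain a b c (dedge b a) e = dedge b c e + dedge c a e" for e
  proof -
    consider "e = (a, b)" | "e = (b, a)" | "e = (a, c)" | "e = (c, a)" | "e = (b, c)" | "e = (c, b)"
      | "e \<notin> {(a, b), (b, a), (a, c), (c, a), (b, c), (c, b)}" by blast
    then show ?thesis
      using assms by cases (simp_all add: star_edge_chain_def dedge_def)
  qed
  then show "star_edge_chain a b c (dedge a b) = (\<lambda>e. dedge a c e + dedge c b e)"
    "star_edge_chain a b c (dedge b a) = (\<lambda>e. dedge b c e + dedge c a e)" by blast+
qed

lemma star_edge_chain_add:
  "star_edge_chain a b c (\<lambda>e. y e + z e) = (\<lambda>e. star_edge_chain a b c y e + star_edge_chain a b c z e)"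
  unfolding star_edge_chain_def
  by (rule ext, rename_tac e, case_tac "e = (a, b) \<or> e = (b, a)"; case_tac "e = (a, c) \<or> e = (c, b)";
      case_tac "e = (c, a) \<or> e = (b, c)"; simp only: if_True if_False add_0)

lemma additive_star_edge_chain:
  assumes "chain_additive F"
  shows "chain_additive (\<lambda>z. star_edge_chain a b c (F z))"
  unfolding chain_additive_def
proof (intro conjI allI)
  have "F (\<lambda>_. 0) = (\<lambda>_. 0)" using assms unfolding chain_additive_def by blast
  then show "star_edge_chain a b c (F (\<lambda>_. 0)) = (\<lambda>_. 0)"
    unfolding star_edge_chain_def by (simp only: if_cancel)
  fix y z
  have "F (\<lambda>e. y e + z e) = (\<lambda>e. F y e + F z e)" using assms unfolding chain_additive_def by blast
  then show "star_edge_chain a b c (F (\<lambda>e. y e + z e)) =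
      (\<lambda>e. star_edge_chain a b c (F y) e + star_edge_chain a b c (F z) e)"
    by (simp only: star_edge_chain_add)
qed

text \<open>\<open>K\<close> consists of undirected edges, added one at a time to the fully coned
  triangulation. There the triangles beside \<open>(a, b)\<close> are
  \<open>(a, b, g (a, b))\<close> and \<open>(b, a, g (b, a))\<close>, whose shape does not change
  when other edges are split.\<close>

lemma subdivision_bisect:
  assumes "finite K" "K \<subseteq> (\<lambda>e. {e, prod.swap e}) ` edges T"
  shows "\<exists>F. subdivision T (bisect (\<Union>K)) F \<and> chain_additive F \<and>
    (\<forall>a b. (a, b) \<in> edges T \<longrightarrow> F (dedge a b) =
       (if (a, b) \<in> \<Union>K then (\<lambda>e. dedge a (m (a, b)) e + dedge (m (a, b)) b e) else dedge a b))"
  using assms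
proof induction
  case empty
  have "finite (rotations ` T)" using finite by simp
  then have "subdivision T (bisect {}) (\<lambda>z. z)"
    using subdivision_cone[of "rotations ` T"] by (simp add: cone_all)
  then show ?case by (intro exI[of _ "\<lambda>z. z"]) (simp add: chain_additive_def)
next
  case (insert R K)
  let ?S = "\<Union>K"
  obtain a b where R: "R = {(a, b), (b, a)}" and ab: "(a, b) \<in> edges T"
    using insert.prems by auto
  have ba: "(b, a) \<in> edges T" using edges_sym[OF ab] .
  have V: "a \<in> verts T" "b \<in> verts T" "a \<noteq> b" using edges_verts[OF ab] edges_neq[OF ab] by auto
  have S: "?S \<subseteq> edges T" using insert.prems edges_sym by auto
  have "X = R" if "(a, b) \<in> X \<or> (b, a) \<in> X" "X \<in> K" for X
  proof -
    obtain x y where "X = {(x, y), (y, x)}" using \<open>X \<in> K\<close> insert.prems by auto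
    then show ?thesis using that(1) R by auto
  qed
  then have notin: "(a, b) \<notin> ?S" "(b, a) \<notin> ?S"
    using insert.hyps by blast+
  have "K \<subseteq> (\<lambda>e. {e, prod.swap e}) ` edges T" using insert.prems by blast
  from insert.IH[OF this] obtain F where F: "subdivision T (bisect ?S) F" "chain_additive F"
    "\<forall>x y. (x, y) \<in> edges T \<longrightarrow> F (dedge x y) =
       (if (x, y) \<in> ?S then (\<lambda>e. dedge x (m (x, y)) e + dedge (m (x, y)) y e) else dedge x y)"
    by (elim exE conjE)
  note F_dedge = F(3)[rule_format]
  let ?m = "m (a, b)"
  have m: "?m \<notin> verts T" using m_fresh[OF ab] .
  have mS: "?m \<noteq> m (x, y)" if "(x, y) \<in> ?S" for x y
    using m_inj[OF ab, of "(x, y)"] that S notin by auto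
  have "(a, b, g (a, b)) \<in> bisect ?S" "(b, a, g (b, a)) \<in> bisect ?S"
    using ab ba notin unfolding bisect_def rotations_def by blast+
  moreover have "?m \<notin> verts (bisect ?S)"
  proof
    assume "?m \<in> verts (bisect ?S)"
    then obtain u v where "(?m, u, v) \<in> bisect ?S" by (auto simp: verts_def)
    then obtain x y where xy: "(x, y) \<in> edges T" and
      "(x, y) \<notin> ?S \<and> (?m, u, v) \<in> rotations (x, y, g (x, y)) \<or>
       (x, y) \<in> ?S \<and> (?m, u, v) \<in> rotations (x, m (x, y), g (x, y)) \<union> rotations (m (x, y), y, g (x, y))"
      using S unfolding bisect_def by blast
    then have "?m \<in> {x, y, g (x, y)} \<or> (x, y) \<in> ?S \<and> ?m = m (x, y)"
      unfolding Un_iff mem_rotations by blast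
    then show False
      using m edges_verts[OF xy] m_neq_g[OF ab xy] mS by auto
  qed
  moreover have "star_edge (bisect ?S) a b (g (a, b)) (g (b, a)) ?m = bisect (\<Union>(insert R K))"
  proof -
    let ?R = "rotations (a, b, g (a, b)) \<union> rotations (b, a, g (b, a))"
    let ?old = "\<lambda>E. (\<Union>(x, y)\<in>E. rotations (x, y, g (x, y)))"
    let ?new = "\<lambda>E. (\<Union>(x, y)\<in>E. rotations (x, m (x, y), g (x, y)) \<union> rotations (m (x, y), y, g (x, y)))"
    have 1: "rotations (x, y, g (x, y)) \<inter> ?R = {}" if "(x, y) \<in> edges T" "(x, y) \<notin> R" for x y
      using that edges_verts[OF that(1)] V g_fresh[OF ab] g_fresh[OF ba] g_fresh[OF that(1)]
      unfolding rotations_def R by auto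
    have 2: "(rotations (x, m (x, y), g (x, y)) \<union> rotations (m (x, y), y, g (x, y))) \<inter> ?R = {}" if "(x, y) \<in> edges T" for x y
      using edges_verts[OF that] V g_fresh[OF ab] g_fresh[OF ba] g_fresh[OF that] m_fresh[OF that]
        m_neq_g[OF that ab] m_neq_g[OF that ba]
      unfolding rotations_def by auto
    have 3: "?R = ?old R" unfolding R by auto
    have "bisect ?S - ?R = ?old (edges T - ?S - R) \<union> ?new ?S"
      using 1 2 S unfolding bisect_def 3 by blast
    moreover have "?new R = rotations (a, ?m, g (a, b)) \<union> rotations (?m, b, g (a, b)) \<union>
        rotations (b, ?m, g (b, a)) \<union> rotations (?m, a, g (b, a))"
      unfolding R by (auto simp: m_swap[of b a])
    moreover have "edges T - \<Union>(insert R K) = edges T - ?S - R" by blast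
    ultimately show ?thesis
      unfolding star_edge_def bisect_def[of "\<Union>(insert R K)"] by (simp add: Un_ac)
  qed
  ultimately have "subdivision T (bisect (\<Union>(insert R K))) (\<lambda>z. star_edge_chain a b ?m (F z))"
    using subdivision.edge[OF F(1)] by metis
  moreover have "star_edge_chain a b ?m (F (dedge x y)) =
      (if (x, y) \<in> \<Union>(insert R K) then (\<lambda>e. dedge x (m (x, y)) e + dedge (m (x, y)) y e) else dedge x y)"
    if xy: "(x, y) \<in> edges T" for x y
  proof -
    have xyV: "x \<in> verts T" "y \<in> verts T" "x \<noteq> y" using edges_verts[OF xy] edges_neq[OF xy] by auto
    have mab: "?m \<noteq> a" "?m \<noteq> b" "?m \<noteq> x" "?m \<noteq> y" using m V xyV by auto
    consider "(x, y) \<in> ?S" | "(x, y) = (a, b)" | "(x, y) = (b, a)" | "(x, y) \<notin> ?S" "(x, y) \<notin> R"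
      unfolding R by blast
    then show ?thesis
    proof cases
      case 1
      \<comment> \<open>The halves of an edge split earlier end at a midpoint, never at two old
        vertices, so splitting \<open>(a, b)\<close> leaves them alone.\<close>
      have "m (x, y) \<noteq> a" "m (x, y) \<noteq> b" using m_fresh[OF xy] V by auto
      then have "star_edge_chain a b ?m (dedge x (m (x, y))) = dedge x (m (x, y))"
        "star_edge_chain a b ?m (dedge (m (x, y)) y) = dedge (m (x, y)) y"
        using mab mS[OF 1] by (intro star_edge_chain_dedge; auto)+
      then show ?thesis using 1 F_dedge[OF xy] by (simp add: star_edge_chain_add)
    next
      case 2
      then show ?thesis using F_dedge[OF xy] notin star_edge_chain_dedge_self[OF V(3) mab(1,2)]
        by (simp add: R)
    next
      case 3
      then show ?thesis using F_dedge[OF xy] notin star_edge_chain_dedge_self[OF V(3) mab(1,2)]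
        by (simp add: R m_swap[of b a])
    next
      case 4
      then have "{x, y} \<noteq> {a, b}" unfolding R by (auto simp: doubleton_eq_iff)
      then have "star_edge_chain a b ?m (dedge x y) = dedge x y"
        using mab by (intro star_edge_chain_dedge) auto
      then show ?thesis using 4 F_dedge[OF xy] by simp
    qed
  qed
  ultimately show ?case
    using additive_star_edge_chain[OF F(2)] by blast
qed

lemma subdivision_barycentric:
  "\<exists>F. subdivision T (bisect (edges T)) F \<and> chain_additive F \<and>
    (\<forall>a b. (a, b) \<in> edges T \<longrightarrow> F (dedge a b) = (\<lambda>e. dedge a (m (a, b)) e + dedge (m (a, b)) b e))"
proof -
  have "\<Union>((\<lambda>e. {e, prod.swap e}) ` edges T) = edges T"
    using edges_sym by auto
  then show ?thesis
    using subdivision_bisect[of "(\<lambda>e. {e, prod.swap e}) ` edges T"] finite_edges by simp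
qed

end

text \<open>Centres are indexed by rotation classes and midpoints by unordered pairs, which gives
  the required invariance by construction. Midpoints are chosen second, so that they also avoid the
  centres.\<close>

lemma centres_exist:
  fixes T :: "'v::infinite triangles"
  assumes "pseudosurface T"
  shows "\<exists>g m. centres T g m"
proof -
  interpret pseudosurface T by fact
  obtain h :: "'v triangles \<Rightarrow> 'v" where h: "inj_on h (rotations ` T)" "h ` rotations ` T \<inter> verts T = {}"
    by (rule fresh_injection[OF finite_verts finite_imageI[OF finite]])
  define g where "g e = h (rotations (fst e, snd e, THE c. (fst e, snd e, c) \<in> T))" for e
  have g: "g (a, b) = h (rotations (a, b, c))" if "(a, b, c) \<in> T" for a b c
  proof -
    have "(THE c. (a, b, c) \<in> T) = c" using that unique by blast
    then show ?thesis by (simp add: g_def)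
  qed
  have fin: "finite ((\<lambda>e. {fst e, snd e}) ` edges T)" "finite (verts T \<union> g ` edges T)"
    using finite_edges finite_verts by auto
  obtain k :: "'v set \<Rightarrow> 'v" where k: "inj_on k ((\<lambda>e. {fst e, snd e}) ` edges T)"
    "k ` (\<lambda>e. {fst e, snd e}) ` edges T \<inter> (verts T \<union> g ` edges T) = {}"
    by (rule fresh_injection[OF fin(2) fin(1)])
  define m where "m e = k {fst e, snd e}" for e
  have "centres T g m"
  proof
    show "g (a, b) = g (b, c)" if "(a, b, c) \<in> T" for a b c
    proof -
      have "rotations (b, c, a) = rotations (a, b, c)" by (auto simp: rotations_def)
      then show ?thesis using g[OF that] g[OF rot[OF that]] by simp
    qed
    show "(x, y, z) \<in> rotations (a, b, c)"
      if "(a, b, c) \<in> T" "(x, y, z) \<in> T" "g (a, b) = g (x, y)" for a b c x y z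
    proof -
      have "rotations (a, b, c) = rotations (x, y, z)"
        using h(1) that g[OF that(1)] g[OF that(2)] by (simp add: inj_on_eq_iff)
      then show ?thesis by (simp add: rotations_def)
    qed
    show "g e \<notin> verts T" if "e \<in> edges T" for e
    proof -
      obtain a b c where "e = (a, b)" "(a, b, c) \<in> T" using \<open>e \<in> edges T\<close> by (auto simp: edges_def)
      then show ?thesis using g h(2) by blast
    qed
    show "m (b, a) = m (a, b)" for a b by (simp add: m_def insert_commute)
    show "e' = e \<or> e' = prod.swap e" if "e \<in> edges T" "e' \<in> edges T" "m e = m e'" for e e'
    proof -
      have "{fst e, snd e} = {fst e', snd e'}"
        using k(1) that by (simp add: m_def inj_on_eq_iff)
      then show ?thesis by (cases e; cases e') (auto simp: doubleton_eq_iff)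
    qed
    show "m e \<notin> verts T" if "e \<in> edges T" for e
      using k(2) that unfolding m_def by blast
    show "m e \<noteq> g e'" if "e \<in> edges T" "e' \<in> edges T" for e e'
      using k(2) that unfolding m_def by blast
  qed
  then show ?thesis by blast
qed

section \<open>Transverse representatives\<close>

definition interleave :: "('e \<Rightarrow> 'v) \<Rightarrow> ('e \<Rightarrow> 'v) \<Rightarrow> 'e list \<Rightarrow> 'v list" where
  "interleave A m es = concat (map (\<lambda>e. [A e, m e]) es)"

lemma length_interleave: "length (interleave A m es) = 2 * length es"
  by (induction es) (simp_all add: interleave_def)

lemma nth_interleave:
  "i < length es \<Longrightarrow> interleave A m es ! (2 * i) = A (es ! i) \<and> interleave A m es ! (Suc (2 * i)) = m (es ! i)"
proof (induction es arbitrary: i)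
  case (Cons e es)
  then show ?case by (cases i) (simp_all add: interleave_def)
qed simp

fun joins :: "('e \<Rightarrow> 'v) \<Rightarrow> ('e \<Rightarrow> 'v) \<Rightarrow> 'v \<Rightarrow> 'e list \<Rightarrow> 'v \<Rightarrow> bool" where
  "joins A B p [] q \<longleftrightarrow> p = q"
| "joins A B p (e # es) q \<longleftrightarrow> A e = p \<and> joins A B (B e) es q"

lemma joins_append: "joins A B p (es @ fs) q \<longleftrightarrow> (\<exists>r. joins A B p es r \<and> joins A B r fs q)"
  by (induction es arbitrary: p) auto

lemma joins_nth:
  "joins A B p es q \<Longrightarrow> i < length es \<Longrightarrow>
    A (es ! 0) = p \<and> B (es ! i) = (if Suc i < length es then A (es ! Suc i) else q)"
proof (induction es arbitrary: p i)
  case (Cons e es)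
  show ?case
  proof (cases i)
    case 0
    then show ?thesis using Cons.prems by (cases es) auto
  next
    case (Suc j)
    then show ?thesis using Cons.IH[of "B e" j] Cons.prems by simp
  qed
qed simp

text \<open>One notion for both representatives: with \<open>fst\<close> and \<open>snd\<close> the
  edges form a closed walk in the old 1-skeleton, with \<open>g\<close> and
  \<open>g \<circ> prod.swap\<close> they are the edges crossed by a closed dual walk.\<close>

definition closed_chain :: "('e \<Rightarrow> 'v) \<Rightarrow> ('e \<Rightarrow> 'v) \<Rightarrow> 'e list \<Rightarrow> bool" where
  "closed_chain A B es \<longleftrightarrow> (\<forall>i<length es. B (es ! i) = A (es ! (Suc i mod length es)))"

lemma joins_closed_chain:
  assumes "joins A B p es p"
  shows "closed_chain A B es"
  unfolding closed_chain_def
proof (intro allI impI)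
  fix i assume i: "i < length es"
  show "B (es ! i) = A (es ! (Suc i mod length es))"
  proof (cases "Suc i < length es")
    case True
    then show ?thesis using joins_nth[OF assms i] by simp
  next
    case False
    then have "Suc i = length es" using i by simp
    then show ?thesis using joins_nth[OF assms i] by simp
  qed
qed

lemma even_odd_index:
  fixes i n :: nat
  assumes "i < 2 * n"
  obtains j where "j < n" "i = 2 * j" | j where "j < n" "i = Suc (2 * j)"
  using assms by (cases "even i") (auto elim!: evenE oddE)

lemma step_interleave:
  assumes "closed_chain A B es" "i < length es"
  shows "step (interleave A m es) (2 * i) = (A (es ! i), m (es ! i))"
    "step (interleave A m es) (Suc (2 * i)) = (m (es ! i), B (es ! i))"
proof -
  let ?n = "length es"
  show "step (interleave A m es) (2 * i) = (A (es ! i), m (es ! i))"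
    using assms(2) nth_interleave[OF assms(2), of A m] by (simp add: step_def length_interleave)
  have "Suc (Suc (2 * i)) mod (2 * ?n) = 2 * (Suc i mod ?n)"
    by (metis mult_Suc_right mult_mod_right add_2_eq_Suc)
  moreover have "Suc i mod ?n < ?n" using assms(2) by (intro mod_less_divisor) linarith
  ultimately show "step (interleave A m es) (Suc (2 * i)) = (m (es ! i), B (es ! i))"
    using assms nth_interleave[OF assms(2), of A m] nth_interleave[of "Suc i mod ?n" es A m]
    by (simp add: step_def length_interleave closed_chain_def)
qed

text \<open>Only odd positions, the midpoints, are treated, because the primal and the dual walk can
  meet nowhere else.\<close>

lemma strand_interleave:
  assumes "closed_chain A B es" "i < length es"
  shows "strand (interleave A m es) (Suc (2 * i)) = (A (es ! i), B (es ! i))"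
proof -
  have "fst (strand (interleave A m es) (Suc (2 * i))) = interleave A m es ! (2 * i)"
    using assms(2) by (simp add: strand_def length_interleave)
  moreover have "snd (strand (interleave A m es) (Suc (2 * i))) = snd (step (interleave A m es) (Suc (2 * i)))"
    by (simp add: strand_def step_def)
  ultimately show ?thesis
    using step_interleave[OF assms, of m] nth_interleave[OF assms(2), of A m] by (simp add: prod_eq_iff)
qed

lemma sum_even_odd: "(\<Sum>i<2 * n. f i) = (\<Sum>i<n. f (2 * i) + f (Suc (2 * i)) :: int)"
  by (induction n) simp_all

lemma chain_of_interleave:
  assumes "closed_chain A B es"
  shows "chain_of (interleave A m es) e =
    (\<Sum>i<length es. dedge (A (es ! i)) (m (es ! i)) e + dedge (m (es ! i)) (B (es ! i)) e)"
  unfolding chain_of_eq_sum length_interleave sum_even_odd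
  by (intro sum.cong) (simp_all add: step_interleave[OF assms])

lemma closed_walk_interleave:
  assumes "closed_chain A B es" "es \<noteq> []"
    and "\<And>e. e \<in> set es \<Longrightarrow> (A e, m e) \<in> edges T \<and> (m e, B e) \<in> edges T"
  shows "closed_walk T (interleave A m es)"
  unfolding closed_walk_def
proof (intro conjI allI impI)
  show "interleave A m es \<noteq> []" using assms(2) length_interleave[of A m es] by auto
  fix i assume "i < length (interleave A m es)"
  then have "i < 2 * length es" by (simp add: length_interleave)
  then show "step (interleave A m es) i \<in> edges T"
    by (rule even_odd_index) (use step_interleave[OF assms(1)] assms(3) nth_mem in \<open>metis\<close>)+
qed

lemma homologous_sum:
  "(\<And>i. i < n \<Longrightarrow> homologous T (f i) (h i)) \<Longrightarrow>
    homologous T (\<lambda>e. \<Sum>i<(n::nat). f i e) (\<lambda>e. \<Sum>i<n. h i e)"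
proof (induction n)
  case (Suc n)
  then show ?case using homologous_add[of T "\<lambda>e. \<Sum>i<n. f i e" "\<lambda>e. \<Sum>i<n. h i e" "f n" "h n"] by simp
qed (simp add: homologous_refl)

lemma chain_additive_sum:
  assumes "chain_additive F"
  shows "F (\<lambda>e. \<Sum>i<(n::nat). f i e) = (\<lambda>e. \<Sum>i<n. F (f i) e)"
proof (induction n)
  case 0
  then show ?case using assms by (simp add: chain_additive_def)
next
  case (Suc n)
  have "F (\<lambda>e. y e + z e) = (\<lambda>e. F y e + F z e)" for y z
    using assms unfolding chain_additive_def by blast
  then have "F (\<lambda>e. (\<Sum>i<n. f i e) + f n e) = (\<lambda>e. F (\<lambda>e. \<Sum>i<n. f i e) e + F (f n) e)" .
  then show ?case using Suc by simp
qed

lemma sum_cyclic_shift: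
  fixes f :: "nat \<Rightarrow> int"
  assumes "n > 0"
  shows "(\<Sum>i<n. f (Suc i mod n)) = (\<Sum>i<n. f i)"
proof -
  obtain k where n: "n = Suc k" using assms by (cases n) auto
  have "(\<Sum>i<n. f (Suc i mod n)) = (\<Sum>i<k. f (Suc i mod n)) + f 0"
    by (simp add: n)
  also have "(\<Sum>i<k. f (Suc i mod n)) = (\<Sum>i<k. f (Suc i))"
    by (intro sum.cong) (simp_all add: n)
  also have "\<dots> + f 0 = (\<Sum>i<n. f i)"
    unfolding n sum.lessThan_Suc_shift[of f k] by simp
  finally show ?thesis .
qed

section \<open>The dual walk and its homology class\<close>

context centres
begin

abbreviation "T' \<equiv> bisect (edges T)"

lemma bisect_triangles:
  assumes "(a, b) \<in> edges T"
  shows "(a, m (a, b), g (a, b)) \<in> T'" "(m (a, b), g (a, b), a) \<in> T'" "(g (a, b), a, m (a, b)) \<in> T'"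
    "(m (a, b), b, g (a, b)) \<in> T'" "(b, g (a, b), m (a, b)) \<in> T'" "(g (a, b), m (a, b), b) \<in> T'"
proof -
  have "rotations (a, m (a, b), g (a, b)) \<subseteq> T'" "rotations (m (a, b), b, g (a, b)) \<subseteq> T'"
    using assms unfolding bisect_def by blast+
  then show "(a, m (a, b), g (a, b)) \<in> T'" "(m (a, b), g (a, b), a) \<in> T'" "(g (a, b), a, m (a, b)) \<in> T'"
    "(m (a, b), b, g (a, b)) \<in> T'" "(b, g (a, b), m (a, b)) \<in> T'" "(g (a, b), m (a, b), b) \<in> T'"
    by (simp_all add: rotations_def)
qed

lemma finite_bisect: "finite T'"
  unfolding bisect_def using finite_edges by (auto simp: rotations_def)

definition crossing :: "'v \<times> 'v \<Rightarrow> 'v chain" where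
  "crossing e = (\<lambda>x. dedge (g e) (m e) x + dedge (m e) (g (prod.swap e)) x)"

text \<open>The path through the midpoint and the path through \<open>v\<close> differ by the two
  small triangles at \<open>v\<close> on either side of the edge.\<close>

lemma homologous_crossing:
  assumes "(u, v) \<in> edges T"
  shows "homologous T' (crossing (u, v)) (\<lambda>x. dedge (g (u, v)) v x + dedge v (g (v, u)) x)"
proof -
  have vu: "(v, u) \<in> edges T" using edges_sym[OF assms] .
  have "homologous T' (dedge (g (u, v)) v) (\<lambda>x. dedge (g (u, v)) (m (u, v)) x + dedge (m (u, v)) v x)"
    using homologous_triangle[OF finite_bisect bisect_triangles(6)[OF assms]] .
  moreover have "homologous T' (dedge v (g (v, u))) (\<lambda>x. dedge v (m (u, v)) x + dedge (m (u, v)) (g (v, u)) x)"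
    using homologous_triangle[OF finite_bisect bisect_triangles(1)[OF vu]] unfolding m_swap[of v u] .
  ultimately have "homologous T' (\<lambda>x. dedge (g (u, v)) v x + dedge v (g (v, u)) x)
     (\<lambda>x. dedge (g (u, v)) (m (u, v)) x + dedge (m (u, v)) v x + (dedge v (m (u, v)) x + dedge (m (u, v)) (g (v, u)) x))"
    by (rule homologous_add)
  also have "(\<lambda>x. dedge (g (u, v)) (m (u, v)) x + dedge (m (u, v)) v x + (dedge v (m (u, v)) x + dedge (m (u, v)) (g (v, u)) x))
     = crossing (u, v)"
    by (simp add: crossing_def dedge_swap[of v "m (u, v)"])
  finally show ?thesis by (rule homologous_sym)
qed

text \<open>The dual path turns around \<open>v\<close>, crossing one by one the edges at \<open>v\<close>.\<close>

lemma turn_around_vertex: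
  assumes "(u, v) \<in> edges T"
  shows "\<exists>es. es \<noteq> [] \<and> set es \<subseteq> edges T \<and>
    joins g (g \<circ> prod.swap) (g (u, v)) es (g (v, (ccw_next T v ^^ k) u)) \<and>
    homologous T' (\<lambda>x. \<Sum>e\<leftarrow>es. crossing e x)
      (\<lambda>x. dedge (g (u, v)) v x + dedge v (g (v, (ccw_next T v ^^ k) u)) x)"
proof (induction k)
  case 0
  \<comment> \<open>Even without a turn the edge \<open>(u, v)\<close> itself is crossed. This is
    the case in which the walk doubles back, and it keeps the list nonempty.\<close>
  then show ?case
    using assms homologous_crossing[OF assms] by (intro exI[of _ "[(u, v)]"]) simp
next
  case (Suc k)
  let ?y = "(ccw_next T v ^^ k) u" and ?y' = "(ccw_next T v ^^ Suc k) u"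
  obtain es where es: "es \<noteq> []" "set es \<subseteq> edges T" "joins g (g \<circ> prod.swap) (g (u, v)) es (g (v, ?y))"
    "homologous T' (\<lambda>x. \<Sum>e\<leftarrow>es. crossing e x) (\<lambda>x. dedge (g (u, v)) v x + dedge v (g (v, ?y)) x)"
    using Suc by blast
  have t: "(v, ?y, ?y') \<in> T"
    using ccw_next_triangle[OF ccw_next_funpow_edge[OF edges_sym[OF assms], of k]] by simp
  \<comment> \<open>The old path ends at the centre where the new crossing begins. In the homologous
    paths through \<open>v\<close>, the leg into this centre cancels the leg out of it.\<close>
  have g: "g (?y', v) = g (v, ?y)" using g_rot[OF t] g_rot[OF rot[OF t]] by simp
  have e: "(?y', v) \<in> edges T" using triangle_edges[OF t] by blast
  have "homologous T' (\<lambda>x. (\<Sum>e\<leftarrow>es. crossing e x) + crossing (?y', v) x)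
      (\<lambda>x. dedge (g (u, v)) v x + dedge v (g (v, ?y)) x + (dedge (g (?y', v)) v x + dedge v (g (v, ?y')) x))"
    using homologous_add[OF es(4) homologous_crossing[OF e]] .
  then have "homologous T' (\<lambda>x. \<Sum>e\<leftarrow>es @ [(?y', v)]. crossing e x)
     (\<lambda>x. dedge (g (u, v)) v x + dedge v (g (v, ?y')) x)"
    unfolding g by (simp add: dedge_swap[of v "g (v, ?y)"])
  moreover have "joins g (g \<circ> prod.swap) (g (u, v)) (es @ [(?y', v)]) (g (v, ?y'))"
    unfolding joins_append using es(3) g by (intro exI[of _ "g (v, ?y)"]) simp
  moreover have "set (es @ [(?y', v)]) \<subseteq> edges T" using es(2) e by simp
  ultimately show ?case by (intro exI[of _ "es @ [(?y', v)]"] conjI) (blast | assumption)+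
qed

text \<open>At each vertex of \<open>\<gamma>\<close> the dual path turns from the face left of the
  incoming step to the face left of the outgoing one; \<open>reach\<close> provides the number of
  turns.\<close>

lemma dual_walk:
  assumes reach: "\<And>v x y. (v, x) \<in> edges T \<Longrightarrow> (v, y) \<in> edges T \<Longrightarrow> \<exists>k. (ccw_next T v ^^ k) x = y"
    and \<gamma>: "closed_walk T \<gamma>"
  shows "\<exists>es. es \<noteq> [] \<and> set es \<subseteq> edges T \<and> closed_chain g (g \<circ> prod.swap) es \<and>
    homologous T' (\<lambda>x. \<Sum>e\<leftarrow>es. crossing e x)
      (\<lambda>x. \<Sum>i<length \<gamma>. dedge (\<gamma> ! i) (g (step \<gamma> i)) x + dedge (g (step \<gamma> i)) (snd (step \<gamma> i)) x)"
proof -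
  let ?n = "length \<gamma>"
  have n: "?n > 0" using \<gamma> by (simp add: closed_walk_def)
  \<comment> \<open>Periodic indexing lets the induction run one full round, where
    \<open>s ?n = s 0\<close> closes the dual path.\<close>
  define s where "s i = step \<gamma> (i mod ?n)" for i
  have s_edge: "s i \<in> edges T" for i
    using closed_walk_edge(1)[OF \<gamma>, of "i mod ?n"] n by (simp add: s_def)
  have s_next: "snd (s i) = fst (s (Suc i))" for i
    by (simp add: s_def step_def mod_Suc_eq)
  have "\<exists>es. (k > 0 \<longrightarrow> es \<noteq> []) \<and> set es \<subseteq> edges T \<and> joins g (g \<circ> prod.swap) (g (s 0)) es (g (s k)) \<and>
    homologous T' (\<lambda>x. \<Sum>e\<leftarrow>es. crossing e x)
      (\<lambda>x. \<Sum>i<k. dedge (g (s i)) (snd (s i)) x + dedge (snd (s i)) (g (s (Suc i))) x)" for k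
  proof (induction k)
    case 0
    then show ?case by (intro exI[of _ "[]"]) (simp add: homologous_refl)
  next
    case (Suc k)
    then obtain es where es: "set es \<subseteq> edges T" "joins g (g \<circ> prod.swap) (g (s 0)) es (g (s k))"
      "homologous T' (\<lambda>x. \<Sum>e\<leftarrow>es. crossing e x)
        (\<lambda>x. \<Sum>i<k. dedge (g (s i)) (snd (s i)) x + dedge (snd (s i)) (g (s (Suc i))) x)" by blast
    obtain u v where uv: "s k = (u, v)" by fastforce
    obtain q where q: "s (Suc k) = (v, q)" using s_next[of k] uv by (metis prod.collapse snd_conv)
    have e: "(u, v) \<in> edges T" "(v, q) \<in> edges T" using s_edge[of k] s_edge[of "Suc k"] uv q by auto
    obtain j where "(ccw_next T v ^^ j) u = q" using reach[OF edges_sym[OF e(1)] e(2)] by blast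
    then obtain fs where fs: "fs \<noteq> []" "set fs \<subseteq> edges T" "joins g (g \<circ> prod.swap) (g (u, v)) fs (g (v, q))"
      "homologous T' (\<lambda>x. \<Sum>e\<leftarrow>fs. crossing e x) (\<lambda>x. dedge (g (u, v)) v x + dedge v (g (v, q)) x)"
      using turn_around_vertex[OF e(1), of j] by blast
    have "homologous T' (\<lambda>x. \<Sum>e\<leftarrow>es @ fs. crossing e x)
        (\<lambda>x. \<Sum>i<Suc k. dedge (g (s i)) (snd (s i)) x + dedge (snd (s i)) (g (s (Suc i))) x)"
      using homologous_add[OF es(3) fs(4)] uv q by simp
    moreover have "joins g (g \<circ> prod.swap) (g (s 0)) (es @ fs) (g (s (Suc k)))"
      unfolding joins_append using es(2) fs(3) uv q by auto
    moreover have "set (es @ fs) \<subseteq> edges T" "es @ fs \<noteq> []" using es(1) fs(1,2) by simp_all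
    ultimately show ?case by (intro exI[of _ "es @ fs"] conjI) (blast | assumption)+
  qed
  from this[of ?n] obtain es where es: "es \<noteq> []" "set es \<subseteq> edges T" "joins g (g \<circ> prod.swap) (g (s 0)) es (g (s ?n))"
    and hom: "homologous T' (\<lambda>x. \<Sum>e\<leftarrow>es. crossing e x)
      (\<lambda>x. \<Sum>i<?n. dedge (g (s i)) (snd (s i)) x + dedge (snd (s i)) (g (s (Suc i))) x)"
    using n by blast
  have "s ?n = s 0" by (simp add: s_def)
  then have "closed_chain g (g \<circ> prod.swap) es"
    using es(3) joins_closed_chain by metis
  \<comment> \<open>Regroups the legs: the induction pairs the two legs at a vertex, the conclusion
    pairs the two legs belonging to a step. A cyclic shift of one half of the sum converts one into
    the other.\<close>
  moreover have "(\<Sum>i<?n. dedge (g (s i)) (snd (s i)) x + dedge (snd (s i)) (g (s (Suc i))) x) =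
    (\<Sum>i<?n. dedge (\<gamma> ! i) (g (step \<gamma> i)) x + dedge (g (step \<gamma> i)) (snd (step \<gamma> i)) x)" for x
  proof -
    have "(\<Sum>i<?n. dedge (snd (s i)) (g (s (Suc i))) x) =
      (\<Sum>i<?n. dedge (\<gamma> ! (Suc i mod ?n)) (g (step \<gamma> (Suc i mod ?n))) x)"
      by (intro sum.cong) (simp_all add: s_def step_def)
    also have "\<dots> = (\<Sum>i<?n. dedge (\<gamma> ! i) (g (step \<gamma> i)) x)"
      using n by (rule sum_cyclic_shift)
    finally show ?thesis by (simp add: sum.distrib s_def)
  qed
  ultimately show ?thesis using es(1,2) hom by auto
qed

text \<open>The detour over the centre on the left of a step differs from the way over its midpoint
  by two small triangles sharing the side between midpoint and centre.\<close>

lemma homologous_subdivided_walk: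
  assumes \<gamma>: "closed_walk T \<gamma>"
  shows "homologous T'
    (\<lambda>x. \<Sum>i<length \<gamma>. dedge (\<gamma> ! i) (g (step \<gamma> i)) x + dedge (g (step \<gamma> i)) (snd (step \<gamma> i)) x)
    (\<lambda>x. \<Sum>i<length \<gamma>. dedge (fst (step \<gamma> i)) (m (step \<gamma> i)) x + dedge (m (step \<gamma> i)) (snd (step \<gamma> i)) x)"
proof (rule homologous_sum)
  fix i assume i: "i < length \<gamma>"
  obtain a b where ab: "step \<gamma> i = (a, b)" by fastforce
  have a: "\<gamma> ! i = a" using ab by (simp add: step_def)
  have e: "(a, b) \<in> edges T" using closed_walk_edge(1)[OF \<gamma> i] ab by simp
  have "homologous T' (\<lambda>x. dedge a (g (a, b)) x + dedge (g (a, b)) b x)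
     (\<lambda>x. dedge a (m (a, b)) x + dedge (m (a, b)) (g (a, b)) x + (dedge (g (a, b)) (m (a, b)) x + dedge (m (a, b)) b x))"
    using homologous_add[OF homologous_triangle[OF finite_bisect bisect_triangles(1)[OF e]]
        homologous_triangle[OF finite_bisect bisect_triangles(6)[OF e]]] .
  then show "homologous T'
      (\<lambda>x. dedge (\<gamma> ! i) (g (step \<gamma> i)) x + dedge (g (step \<gamma> i)) (snd (step \<gamma> i)) x)
      (\<lambda>x. dedge (fst (step \<gamma> i)) (m (step \<gamma> i)) x + dedge (m (step \<gamma> i)) (snd (step \<gamma> i)) x)"
    by (simp add: ab a dedge_swap[of "g (a, b)" "m (a, b)"])
qed

text \<open>Counterclockwise around the midpoint lie \<open>b\<close>, \<open>g (a, b)\<close>,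
  \<open>a\<close>, \<open>g (b, a)\<close>, so the two strands join opposite neighbours. Both
  directions of the dual strand are needed, since the dual walk may cross an edge from either
  side.\<close>

lemma transverse_at_midpoint:
  assumes "pseudosurface T'" and ab: "(a, b) \<in> edges T"
  shows "transverse_at T' (m (a, b)) (a, b) (g (a, b), g (b, a))"
    "transverse_at T' (m (a, b)) (a, b) (g (b, a), g (a, b))"
proof -
  interpret sub: pseudosurface T' by fact
  let ?m = "m (a, b)"
  have ba: "(b, a) \<in> edges T" using edges_sym[OF ab] .
  have ne: "a \<noteq> b" using edges_neq[OF ab] .
  obtain c d where t: "(a, b, c) \<in> T" "(b, a, d) \<in> T" using ab ba by (auto simp: edges_def)
  have gg: "g (a, b) \<noteq> g (b, a)"
  proof
    assume "g (a, b) = g (b, a)"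
    then have "(b, a, d) \<in> rotations (a, b, c)" using g_inj[OF t] by blast
    then show False using triangle_distinct[OF t(1)] unfolding mem_rotations by blast
  qed
  have gv: "g (a, b) \<noteq> a" "g (a, b) \<noteq> b" "g (b, a) \<noteq> a" "g (b, a) \<noteq> b"
    using g_fresh[OF ab] g_fresh[OF ba] edges_verts[OF ab] by auto
  \<comment> \<open>A single counterclockwise turn suffices, as the four neighbours alternate
    between the two strands.\<close>
  have left: "y \<in> left_side T' ?m (p, x)" if "(?m, x, y) \<in> T'" "y \<noteq> p" for x y p
    unfolding left_side_def using sub.ccw_next_eq[OF that(1)] that(2)
    by (intro CollectI exI[of _ 1]) (auto simp: le_Suc_eq)
  note tr = bisect_triangles[OF ab] bisect_triangles[OF ba, unfolded m_swap[of b a]]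
  have "crossed_left_to_right T' ?m (a, b) (g (a, b), g (b, a))"
    unfolding crossed_left_to_right_def using ne gv left tr by simp
  then show "transverse_at T' ?m (a, b) (g (a, b), g (b, a))" by (simp add: transverse_at_def)
  have "crossed_left_to_right T' ?m (g (b, a), g (a, b)) (a, b)"
    unfolding crossed_left_to_right_def using gg gv left tr by simp
  then show "transverse_at T' ?m (a, b) (g (b, a), g (a, b))" by (simp add: transverse_at_def)
qed

text \<open>The primal walk visits old vertices and midpoints, the dual one centres and midpoints,
  and the three kinds are disjoint. A common midpoint determines the undirected edge by
  \<open>m_inj\<close>.\<close>

lemma transverse_interleave:
  assumes "pseudosurface T'" and es: "set es \<subseteq> edges T" and fs: "set fs \<subseteq> edges T"
    and ces: "closed_chain fst snd es" and cfs: "closed_chain g (g \<circ> prod.swap) fs"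
  shows "transverse T' (interleave fst m es) (interleave g m fs)"
  unfolding transverse_def
proof (intro allI impI)
  let ?\<beta> = "interleave fst m es" and ?\<gamma> = "interleave g m fs"
  fix i j assume i: "i < length ?\<beta>" and j: "j < length ?\<gamma>" and eq: "?\<beta> ! i = ?\<gamma> ! j"
  from j have j: "j < 2 * length fs" by (simp add: length_interleave)
  then have notin: "?\<gamma> ! j \<notin> verts T"
  proof (rule even_odd_index)
    fix l assume l: "l < length fs" "j = 2 * l"
    then have "?\<gamma> ! j = g (fs ! l)" "fs ! l \<in> edges T" using nth_interleave[of l fs g m] fs by auto
    then show ?thesis using g_fresh by simp
  next
    fix l assume l: "l < length fs" "j = Suc (2 * l)"
    then have "?\<gamma> ! j = m (fs ! l)" "fs ! l \<in> edges T" using nth_interleave[of l fs g m] fs by auto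
    then show ?thesis using m_fresh by simp
  qed
  from i have "i < 2 * length es" by (simp add: length_interleave)
  then show "transverse_at T' (?\<beta> ! i) (strand ?\<beta> i) (strand ?\<gamma> j)"
  proof (rule even_odd_index)
    fix k assume k: "k < length es" "i = 2 * k"
    then have "?\<beta> ! i = fst (es ! k)" "es ! k \<in> edges T" using nth_interleave[of k es fst m] es by auto
    then have "?\<beta> ! i \<in> verts T" using edges_verts by (metis prod.collapse)
    then show ?thesis using notin eq by simp
  next
    fix k assume k: "k < length es" "i = Suc (2 * k)"
    have e: "?\<beta> ! i = m (es ! k)" "es ! k \<in> edges T" using nth_interleave[of k es fst m] es k by auto
    obtain a b where ab: "es ! k = (a, b)" by fastforce
    have strand_i: "strand ?\<beta> i = (a, b)" using strand_interleave[OF ces k(1), of m] k(2) ab by simp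
    from j show ?thesis
    proof (rule even_odd_index)
      fix l assume l: "l < length fs" "j = 2 * l"
      then have "?\<gamma> ! j = g (fs ! l)" "fs ! l \<in> edges T" using nth_interleave[of l fs g m] fs by auto
      then show ?thesis using eq e m_neq_g by metis
    next
      fix l assume l: "l < length fs" "j = Suc (2 * l)"
      then have f: "?\<gamma> ! j = m (fs ! l)" "fs ! l \<in> edges T" using nth_interleave[of l fs g m] fs by auto
      have strand_j: "strand ?\<gamma> j = (g (fs ! l), g (prod.swap (fs ! l)))"
        using strand_interleave[OF cfs l(1), of m] l(2) by simp
      have "fs ! l = (a, b) \<or> fs ! l = (b, a)"
        using m_inj[OF e(2) f(2)] eq e f ab by auto
      then show ?thesis
        using transverse_at_midpoint[OF assms(1), of a b] e ab strand_i strand_j by auto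
    qed
  qed
qed

end

lemma transverse_representatives:
  fixes T :: "'v::infinite triangles"
  assumes surf: "closed_connected_surface T"
    and \<beta>: "closed_walk T \<beta>" and \<gamma>: "closed_walk T \<gamma>"
  shows "\<exists>T' F \<beta>' \<gamma>'. subdivision T T' F \<and> represents T' F \<beta>' (hclass T (chain_of \<beta>)) \<and>
      represents T' F \<gamma>' (hclass T (chain_of \<gamma>)) \<and> transverse T' \<beta>' \<gamma>'"
proof -
  obtain \<sigma> where "link_order T \<sigma>" using link_order_exists[OF surf] by blast
  then interpret link_order T \<sigma> .
  obtain g m where "centres T g m" using centres_exist pseudosurface_axioms by blast
  then interpret centres T g m .
  obtain F where F: "subdivision T T' F" "chain_additive F"
    and F_dedge: "\<And>a b. (a, b) \<in> edges T \<Longrightarrow> F (dedge a b) = (\<lambda>e. dedge a (m (a, b)) e + dedge (m (a, b)) b e)"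
    using subdivision_barycentric by blast
  obtain \<sigma>' where "link_order T' \<sigma>'" using subdivision_form[OF F(1)] by blast
  then interpret sub: link_order T' \<sigma>' .
  have hclass_self: "chain_of \<delta> \<in> hclass T (chain_of \<delta>)" if "closed_walk T \<delta>" for \<delta>
    using cycles1_chain_of[OF that] by (simp add: hclass_def boundaries1_zero)
  have F_chain: "F (chain_of \<delta>) = (\<lambda>x. \<Sum>i<length \<delta>. dedge (fst (step \<delta> i)) (m (step \<delta> i)) x + dedge (m (step \<delta> i)) (snd (step \<delta> i)) x)"
    if \<delta>: "closed_walk T \<delta>" for \<delta>
  proof -
    \<comment> \<open>\<open>F\<close> is known only on single edges, so the chain is first expanded
      into its steps.\<close>
    have "F (chain_of \<delta>) = (\<lambda>x. \<Sum>i<length \<delta>. F (dedge (fst (step \<delta> i)) (snd (step \<delta> i))) x)"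
      unfolding chain_additive_sum[OF F(2), symmetric] by (rule arg_cong[of _ _ F]) (rule ext, rule chain_of_eq_sum)
    also have "\<dots> = (\<lambda>x. \<Sum>i<length \<delta>. dedge (fst (step \<delta> i)) (m (step \<delta> i)) x + dedge (m (step \<delta> i)) (snd (step \<delta> i)) x)"
      using closed_walk_edge(1)[OF \<delta>] F_dedge by (intro ext sum.cong) (simp_all add: prod.collapse)
    finally show ?thesis .
  qed
  let ?es = "steps \<beta>"
  have es: "set ?es \<subseteq> edges T" "?es \<noteq> []" "length ?es = length \<beta>"
    using \<beta> closed_walk_edge(1)[OF \<beta>] by (auto simp: steps_def closed_walk_def)
  have ces: "closed_chain fst snd ?es"
    unfolding closed_chain_def es(3)
  proof (intro allI impI)
    fix i assume i: "i < length \<beta>"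
    then have "Suc i mod length \<beta> < length \<beta>" by (intro mod_less_divisor) linarith
    with i show "snd (?es ! i) = fst (?es ! (Suc i mod length \<beta>))"
      by (simp add: steps_def step_def)
  qed
  have chain_\<beta>: "chain_of (interleave fst m ?es) = F (chain_of \<beta>)"
    unfolding F_chain[OF \<beta>] chain_of_interleave[OF ces] es(3)
    by (intro ext sum.cong) (simp_all add: steps_def)
  have cw_\<beta>: "closed_walk T' (interleave fst m ?es)"
  proof (rule closed_walk_interleave[OF ces es(2)])
    fix e assume "e \<in> set ?es"
    then obtain a b where "e = (a, b)" "(a, b) \<in> edges T" using es(1) by (metis prod.exhaust subsetD)
    then show "(fst e, m e) \<in> edges T' \<and> (m e, snd e) \<in> edges T'"
      using bisect_triangles sub.triangle_edges(1) by (metis fst_conv snd_conv)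
  qed
  have "chain_of (interleave fst m ?es) \<in> hclass T' (F (chain_of \<beta>))"
    using sub.cycles1_chain_of[OF cw_\<beta>] unfolding chain_\<beta> hclass_def by (simp add: boundaries1_zero)
  then have rep_\<beta>: "represents T' F (interleave fst m ?es) (hclass T (chain_of \<beta>))"
    unfolding represents_def using cw_\<beta> hclass_self[OF \<beta>] by blast
  have reach: "\<And>v x y. (v, x) \<in> edges T \<Longrightarrow> (v, y) \<in> edges T \<Longrightarrow> \<exists>k. (ccw_next T v ^^ k) x = y"
    using surf unfolding closed_connected_surface_def by blast
  obtain fs where fs: "fs \<noteq> []" "set fs \<subseteq> edges T" and cfs: "closed_chain g (g \<circ> prod.swap) fs"
    and hom: "homologous T' (\<lambda>x. \<Sum>e\<leftarrow>fs. crossing e x)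
      (\<lambda>x. \<Sum>i<length \<gamma>. dedge (\<gamma> ! i) (g (step \<gamma> i)) x + dedge (g (step \<gamma> i)) (snd (step \<gamma> i)) x)"
    using dual_walk[OF reach \<gamma>] by blast
  have "chain_of (interleave g m fs) = (\<lambda>x. \<Sum>e\<leftarrow>fs. crossing e x)"
    by (rule ext) (simp add: chain_of_interleave[OF cfs] crossing_def sum_list_sum_nth atLeast0LessThan)
  then have "homologous T' (chain_of (interleave g m fs)) (F (chain_of \<gamma>))"
    using homologous_trans[OF hom homologous_subdivided_walk[OF \<gamma>]] F_chain[OF \<gamma>] by simp
  moreover have cw_\<gamma>: "closed_walk T' (interleave g m fs)"
  proof (rule closed_walk_interleave[OF cfs fs(1)])
    fix e assume "e \<in> set fs"
    then obtain a b where e: "e = (a, b)" "(a, b) \<in> edges T" "(b, a) \<in> edges T"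
      using fs(2) edges_sym by (metis prod.exhaust subsetD)
    show "(g e, m e) \<in> edges T' \<and> (m e, (g \<circ> prod.swap) e) \<in> edges T'"
      using sub.triangle_edges(1)[OF bisect_triangles(6)[OF e(2)]]
        sub.triangle_edges(2)[OF bisect_triangles(1)[OF e(3)]] e(1) m_swap[of b a] by simp
  qed
  ultimately have "chain_of (interleave g m fs) \<in> hclass T' (F (chain_of \<gamma>))"
    using sub.cycles1_chain_of[OF cw_\<gamma>] by (simp add: hclass_def homologous_def)
  then have "represents T' F (interleave g m fs) (hclass T (chain_of \<gamma>))"
    unfolding represents_def using cw_\<gamma> hclass_self[OF \<gamma>] by blast
  then show ?thesis
    using F(1) rep_\<beta> transverse_interleave[OF sub.pseudosurface_axioms es(1) fs(2) ces cfs] by blast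
qed

section \<open>Rotations of closed walks\<close>

lemma map_rotation: "map (\<lambda>i. (k + i) mod n) [0..<n] = rotate k [0..<n]"
  by (rule nth_equalityI) (simp_all add: nth_rotate)

text \<open>Independence of the base point reduces to this permutation of positions; it allows the
  curve to be started at the positive passage of the chosen crossing.\<close>

lemma bij_betw_rotation: "bij_betw (\<lambda>i. (k + i) mod n) {..<n} {..<n::nat}"
proof -
  have "distinct (map (\<lambda>i. (k + i) mod n) [0..<n])" unfolding map_rotation by simp
  then have "inj_on (\<lambda>i. (k + i) mod n) {..<n}"
    by (simp add: distinct_map atLeast0LessThan)
  moreover have "set (map (\<lambda>i. (k + i) mod n) [0..<n]) = {..<n}"
    unfolding map_rotation by (simp add: atLeast0LessThan)
  ultimately show ?thesis by (simp add: bij_betw_def atLeast0LessThan)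
qed

lemma ex_rotation: "(\<exists>i<n. P ((k + i) mod n)) \<longleftrightarrow> (\<exists>i<(n::nat). P i)"
proof -
  have "(\<lambda>i. (k + i) mod n) ` {..<n} = {..<n}"
    using bij_betw_rotation[of k n] by (simp add: bij_betw_def)
  then have "(\<exists>j\<in>{..<n}. P j) \<longleftrightarrow> (\<exists>j\<in>(\<lambda>i. (k + i) mod n) ` {..<n}. P j)" by (simp only:)
  then show ?thesis by (simp add: Bex_def)
qed

lemma card_rotation: "card {i::nat. i < n \<and> P ((k + i) mod n)} = card {i. i < n \<and> P i}"
proof -
  let ?\<pi> = "\<lambda>i. (k + i) mod n"
  have "inj_on ?\<pi> {..<n}" and img: "?\<pi> ` {..<n} = {..<n}"
    using bij_betw_rotation[of k n] by (simp_all add: bij_betw_def)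
  have "?\<pi> ` {i \<in> {..<n}. P (?\<pi> i)} = {j \<in> ?\<pi> ` {..<n}. P j}" by blast
  also have "\<dots> = {i. i < n \<and> P i}" unfolding img by simp
  finally have "{i. i < n \<and> P i} = ?\<pi> ` {i. i < n \<and> P (?\<pi> i)}" by simp
  moreover have "inj_on ?\<pi> {i. i < n \<and> P (?\<pi> i)}"
    using \<open>inj_on ?\<pi> {..<n}\<close> by (rule inj_on_subset) auto
  ultimately show ?thesis by (simp add: card_image)
qed

lemma step_rotate:
  assumes "i < length \<gamma>"
  shows "step (rotate k \<gamma>) i = step \<gamma> ((k + i) mod length \<gamma>)"
proof -
  have "Suc i mod length \<gamma> < length \<gamma>" using assms by (intro mod_less_divisor) linarith
  then show ?thesis using assms by (simp add: step_def nth_rotate mod_simps)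
qed

lemma strand_rotate:
  assumes "i < length \<gamma>"
  shows "strand (rotate k \<gamma>) i = strand \<gamma> ((k + i) mod length \<gamma>)"
proof -
  let ?n = "length \<gamma>"
  have n: "?n > 0" using assms by linarith
  then have "Suc i mod ?n < ?n" "(i + ?n - 1) mod ?n < ?n" by simp_all
  moreover have "(k + (i + ?n - 1) mod ?n) mod ?n = ((k + i) mod ?n + ?n - 1) mod ?n"
  proof -
    have "(k + (i + (?n - 1)) mod ?n) mod ?n = ((k + i) mod ?n + (?n - 1)) mod ?n"
      by (simp add: mod_simps add.assoc)
    then show ?thesis using n by simp
  qed
  ultimately show ?thesis by (simp add: strand_def nth_rotate mod_simps)
qed

lemma chain_of_rotate: "chain_of (rotate k \<gamma>) = chain_of \<gamma>"
proof
  fix e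
  have "card {i. i < length \<gamma> \<and> step (rotate k \<gamma>) i = e} = card {i. i < length \<gamma> \<and> step \<gamma> i = e}" for e
    using card_rotation[of "length \<gamma>" "\<lambda>i. step \<gamma> i = e" k] by (simp add: step_rotate cong: conj_cong)
  then show "chain_of (rotate k \<gamma>) e = chain_of \<gamma> e"
    by (simp add: chain_of_def)
qed

lemma crossings_rotate: "crossings (rotate k \<gamma>) = crossings \<gamma>"
proof -
  let ?n = "length \<gamma>" and ?\<pi> = "\<lambda>i. (k + i) mod length \<gamma>"
  have inj: "?\<pi> i = ?\<pi> j \<longleftrightarrow> i = j" if "i < ?n" "j < ?n" for i j
    using bij_betw_rotation[of k ?n] that by (auto simp: bij_betw_def inj_on_def)
  have "(\<exists>i<?n. \<exists>j<?n. i \<noteq> j \<and> rotate k \<gamma> ! i = v \<and> rotate k \<gamma> ! j = v) \<longleftrightarrow>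
     (\<exists>i<?n. \<exists>j<?n. ?\<pi> i \<noteq> ?\<pi> j \<and> \<gamma> ! ?\<pi> i = v \<and> \<gamma> ! ?\<pi> j = v)" for v
    using inj by (metis nth_rotate)
  also have "(\<exists>i<?n. \<exists>j<?n. ?\<pi> i \<noteq> ?\<pi> j \<and> \<gamma> ! ?\<pi> i = v \<and> \<gamma> ! ?\<pi> j = v) \<longleftrightarrow>
     (\<exists>i<?n. \<exists>j<?n. i \<noteq> j \<and> \<gamma> ! i = v \<and> \<gamma> ! j = v)" for v
    using ex_rotation[of ?n "\<lambda>i. \<exists>j<?n. i \<noteq> ?\<pi> j \<and> \<gamma> ! i = v \<and> \<gamma> ! ?\<pi> j = v" k]
      ex_rotation[of ?n "\<lambda>j. _ \<noteq> j \<and> _ \<and> \<gamma> ! j = v" k] by (simp only:)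
  finally show ?thesis by (simp add: crossings_def)
qed

lemma travels_positively_rotate:
  assumes "i < length \<gamma>"
  shows "travels_positively T (rotate k \<gamma>) i \<longleftrightarrow> travels_positively T \<gamma> ((k + i) mod length \<gamma>)"
proof -
  let ?n = "length \<gamma>" and ?\<pi> = "\<lambda>i. (k + i) mod length \<gamma>"
  have inj: "?\<pi> j = ?\<pi> i \<longleftrightarrow> j = i" if "j < ?n" for j
    using bij_betw_rotation[of k ?n] that assms by (auto simp: bij_betw_def inj_on_def)
  have "travels_positively T (rotate k \<gamma>) i \<longleftrightarrow> (\<exists>j<?n. ?\<pi> j \<noteq> ?\<pi> i \<and> \<gamma> ! ?\<pi> j = \<gamma> ! ?\<pi> i \<and>
     crossed_left_to_right T (\<gamma> ! ?\<pi> i) (strand \<gamma> (?\<pi> i)) (strand \<gamma> (?\<pi> j)))"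
    unfolding travels_positively_def using assms
    by (simp add: inj nth_rotate strand_rotate cong: conj_cong)
  also have "\<dots> \<longleftrightarrow> travels_positively T \<gamma> (?\<pi> i)"
    unfolding travels_positively_def
    using ex_rotation[of ?n "\<lambda>j. j \<noteq> ?\<pi> i \<and> \<gamma> ! j = \<gamma> ! ?\<pi> i \<and>
     crossed_left_to_right T (\<gamma> ! ?\<pi> i) (strand \<gamma> (?\<pi> i)) (strand \<gamma> j)" k] .
  finally show ?thesis .
qed

lemma normal_curve_rotate:
  assumes "normal_curve T \<gamma>"
  shows "normal_curve T (rotate k \<gamma>)"
proof -
  let ?n = "length \<gamma>" and ?\<pi> = "\<lambda>i. (k + i) mod length \<gamma>"
  have ne: "\<gamma> \<noteq> []" using assms by (auto simp: normal_curve_def closed_trail_def closed_walk_def)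
  then have lt: "?\<pi> i < ?n" for i by simp
  have inj: "?\<pi> i = ?\<pi> j \<longleftrightarrow> i = j" if "i < ?n" "j < ?n" for i j
    using bij_betw_rotation[of k ?n] that by (auto simp: bij_betw_def inj_on_def)
  have "closed_walk T (rotate k \<gamma>)"
    using assms lt ne by (auto simp: normal_curve_def closed_trail_def closed_walk_def step_rotate)
  moreover have "step (rotate k \<gamma>) i \<noteq> step (rotate k \<gamma>) j \<and>
      step (rotate k \<gamma>) i \<noteq> prod.swap (step (rotate k \<gamma>) j)"
    if "i < ?n" "j < ?n" "i \<noteq> j" for i j
    using assms lt[of i] lt[of j] inj that unfolding normal_curve_def closed_trail_def
    by (simp add: step_rotate)
  moreover have "card {i. i < ?n \<and> rotate k \<gamma> ! i = v} \<le> 2" for v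
    using assms card_rotation[of ?n "\<lambda>i. \<gamma> ! i = v" k] unfolding normal_curve_def
    by (simp add: nth_rotate cong: conj_cong)
  moreover have "transverse_at T (rotate k \<gamma> ! i) (strand (rotate k \<gamma>) i) (strand (rotate k \<gamma>) j)"
    if "i < ?n" "j < ?n" "i \<noteq> j" "rotate k \<gamma> ! i = rotate k \<gamma> ! j" for i j
    using assms lt[of i] lt[of j] inj that unfolding normal_curve_def
    by (simp add: strand_rotate nth_rotate)
  ultimately show ?thesis
    unfolding normal_curve_def closed_trail_def length_rotate by blast
qed

text \<open>Rotating by \<open>k\<close> positions moves past only those letters that the filter
  keeps, and their number is the new amount of rotation.\<close>

lemma filter_rotate: "\<exists>j. filter P (rotate k xs) = rotate j (filter P xs)"
proof -
  let ?A = "take (k mod length xs) xs" and ?B = "drop (k mod length xs) xs"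
  have "filter P (rotate k xs) = filter P ?B @ filter P ?A"
    by (simp add: rotate_drop_take)
  also have "\<dots> = rotate (length (filter P ?A)) (filter P ?A @ filter P ?B)"
    by (simp add: rotate_append)
  also have "filter P ?A @ filter P ?B = filter P xs"
    by (metis append_take_drop_id filter_append)
  finally show ?thesis by blast
qed

lemma gauss_word_rotate: "\<exists>j. gauss_word T L (rotate k \<gamma>) = rotate j (gauss_word T L \<gamma>)"
proof -
  let ?n = "length \<gamma>" and ?\<pi> = "\<lambda>i. (k + i) mod length \<gamma>"
  define G where "G i = (L (\<gamma> ! i), if travels_positively T \<gamma> i then 1 else - 1 :: int)" for i
  define P where "P i \<longleftrightarrow> \<gamma> ! i \<in> crossings \<gamma>" for i
  have "gauss_word T L (rotate k \<gamma>) = map (\<lambda>i. G (?\<pi> i)) (filter (\<lambda>i. P (?\<pi> i)) [0..<?n])"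
    unfolding gauss_word_def crossings_rotate length_rotate G_def P_def
    by (intro map_cong filter_cong) (auto simp: nth_rotate travels_positively_rotate)
  also have "\<dots> = map G (filter P (rotate k [0..<?n]))"
    by (simp add: map_rotation[symmetric] filter_map comp_def)
  also obtain j where "\<dots> = map G (rotate j (filter P [0..<?n]))"
    using filter_rotate by metis
  also have "\<dots> = rotate j (gauss_word T L \<gamma>)"
    by (simp add: rotate_map gauss_word_def G_def[abs_def] P_def[abs_def])
  finally show ?thesis by blast
qed

section \<open>Splitting a crossing\<close>

definition crossing_sign :: "'v triangles \<Rightarrow> 'v list \<Rightarrow> nat \<Rightarrow> int" where
  "crossing_sign T \<gamma> i = (if travels_positively T \<gamma> i then 1 else - 1)"

lemma normal_curve_partner:
  assumes "normal_curve T \<gamma>" "i < length \<gamma>" "j < length \<gamma>" "k < length \<gamma>"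
    and "\<gamma> ! i = \<gamma> ! j" "\<gamma> ! k = \<gamma> ! j" "i \<noteq> j"
  shows "k = i \<or> k = j"
proof (rule ccontr)
  assume "\<not> ?thesis"
  then have "card {i, j, k} = 3" using assms(7) by auto
  moreover have "card {i, j, k} \<le> card {l. l < length \<gamma> \<and> \<gamma> ! l = \<gamma> ! j}"
    using assms by (intro card_mono) auto
  moreover have "\<dots> \<le> 2" using assms(1) by (simp add: normal_curve_def)
  ultimately show False by simp
qed

lemma normal_curve_closed_walk: "normal_curve T \<gamma> \<Longrightarrow> closed_walk T \<gamma>"
  by (simp add: normal_curve_def closed_trail_def)

lemma travels_positively_iff:
  assumes "normal_curve T \<gamma>" "i < length \<gamma>" "j < length \<gamma>" "\<gamma> ! i = \<gamma> ! j" "i \<noteq> j"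
  shows "travels_positively T \<gamma> i \<longleftrightarrow> crossed_left_to_right T (\<gamma> ! i) (strand \<gamma> i) (strand \<gamma> j)"
proof
  assume "travels_positively T \<gamma> i"
  then obtain k where k: "k < length \<gamma>" "k \<noteq> i" "\<gamma> ! k = \<gamma> ! i"
    "crossed_left_to_right T (\<gamma> ! i) (strand \<gamma> i) (strand \<gamma> k)"
    unfolding travels_positively_def by blast
  then have "k = j" using normal_curve_partner[OF assms(1-3) k(1)] assms(4,5) by auto
  then show "crossed_left_to_right T (\<gamma> ! i) (strand \<gamma> i) (strand \<gamma> j)" using k(4) by simp
next
  assume "crossed_left_to_right T (\<gamma> ! i) (strand \<gamma> i) (strand \<gamma> j)"
  then show "travels_positively T \<gamma> i"
    unfolding travels_positively_def using assms by (intro exI[of _ j]) auto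
qed

section \<open>The two arcs at a repeated vertex\<close>

lemma step_take:
  assumes "r \<le> length \<gamma>" "i < r" "\<gamma> ! (r mod length \<gamma>) = \<gamma> ! 0"
  shows "step (take r \<gamma>) i = step \<gamma> i"
proof (cases "Suc i = r")
  case True
  then show ?thesis using assms by (auto simp: step_def min_def)
next
  case False
  then show ?thesis using assms by (auto simp: step_def min_def)
qed

lemma step_drop:
  assumes "r < length \<gamma>" "i < length \<gamma> - r" "\<gamma> ! r = \<gamma> ! 0"
  shows "step (drop r \<gamma>) i = step \<gamma> (r + i)"
proof (cases "Suc i = length \<gamma> - r")
  case True
  then have "Suc (r + i) = length \<gamma>" using assms by simp
  then show ?thesis using assms True by (simp add: step_def)
next
  case False
  then have "Suc (r + i) < length \<gamma>" using assms by simp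
  then show ?thesis using assms by (simp add: step_def)
qed

lemma chain_of_split:
  assumes "0 < r" "r < length \<gamma>" "\<gamma> ! r = \<gamma> ! 0"
  shows "chain_of \<gamma> = (\<lambda>e. chain_of (take r \<gamma>) e + chain_of (drop r \<gamma>) e)"
proof
  fix e
  let ?f = "\<lambda>i. dedge (fst (step \<gamma> i)) (snd (step \<gamma> i)) e"
  have "chain_of (take r \<gamma>) e = (\<Sum>i<r. ?f i)"
    unfolding chain_of_eq_sum using assms by (intro sum.cong) (simp_all add: step_take)
  moreover have "chain_of (drop r \<gamma>) e = (\<Sum>i<length \<gamma> - r. ?f (r + i))"
    unfolding chain_of_eq_sum using assms by (intro sum.cong) (simp_all add: step_drop)
  moreover have "(\<Sum>i<length \<gamma>. ?f i) = (\<Sum>i<r. ?f i) + (\<Sum>i<length \<gamma> - r. ?f (r + i))"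
  proof -
    have "(\<Sum>i<length \<gamma> - r. ?f (r + i)) = (\<Sum>i\<in>{r..<length \<gamma>}. ?f i)"
      using assms by (intro sum.reindex_bij_witness[of _ "\<lambda>i. i - r" "\<lambda>i. r + i"]) auto
    then show ?thesis
      using assms sum.atLeastLessThan_concat[of 0 r "length \<gamma>" ?f] by (simp add: atLeast0LessThan)
  qed
  ultimately show "chain_of \<gamma> e = chain_of (take r \<gamma>) e + chain_of (drop r \<gamma>) e"
    unfolding chain_of_eq_sum[of \<gamma>] by simp
qed

text \<open>Closing up the arc alters one strand only: at the corner it now arrives along the last
  step before the second passage.\<close>

lemma strand_take:
  assumes "r < length \<gamma>" "i < r" "\<gamma> ! r = \<gamma> ! 0"
  shows "strand (take r \<gamma>) i = (if i = 0 then \<gamma> ! (r - 1) else fst (strand \<gamma> i), snd (strand \<gamma> i))"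
proof -
  have "snd (strand (take r \<gamma>) i) = snd (strand \<gamma> i)"
    using step_take[of r \<gamma> i] assms by (simp add: step_def strand_def)
  moreover have "fst (strand (take r \<gamma>) i) = (if i = 0 then \<gamma> ! (r - 1) else fst (strand \<gamma> i))"
    using assms by (cases i) (simp_all add: strand_def min_def)
  ultimately show ?thesis by (simp add: prod_eq_iff)
qed

lemma strand_drop:
  assumes "0 < r" "r < length \<gamma>" "i < length \<gamma> - r" "\<gamma> ! r = \<gamma> ! 0"
  shows "strand (drop r \<gamma>) i = (if i = 0 then \<gamma> ! (length \<gamma> - 1) else fst (strand \<gamma> (r + i)), snd (strand \<gamma> (r + i)))"
proof -
  have "snd (strand (drop r \<gamma>) i) = snd (strand \<gamma> (r + i))"
    using step_drop[of r \<gamma> i] assms by (simp add: step_def strand_def)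
  moreover have "fst (strand (drop r \<gamma>) i) = (if i = 0 then \<gamma> ! (length \<gamma> - 1) else fst (strand \<gamma> (r + i)))"
  proof (cases i)
    case 0
    then show ?thesis using assms by (simp add: strand_def)
  next
    case (Suc k)
    have "k + length \<gamma> - r = k + (length \<gamma> - r)" using assms(2) by simp
    moreover have "(k + (length \<gamma> - r)) mod (length \<gamma> - r) = k"
      using Suc assms(3) by (simp only: mod_add_self2 mod_less Suc_lessD)
    ultimately have "(k + length \<gamma> - r) mod (length \<gamma> - r) = k" by (simp only:)
    then show ?thesis using Suc assms by (simp add: strand_def)
  qed
  ultimately show ?thesis by (simp add: prod_eq_iff)
qed

lemma closed_walk_drop:
  assumes "closed_walk T \<gamma>" "r < length \<gamma>" "\<gamma> ! r = \<gamma> ! 0"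
  shows "closed_walk T (drop r \<gamma>)"
  using assms by (auto simp: closed_walk_def step_drop)

context link_order
begin

lemma strand_form_normal_curve:
  assumes \<gamma>: "normal_curve T \<gamma>" "i < length \<gamma>" "j < length \<gamma>" "\<gamma> ! i = \<gamma> ! j" "i \<noteq> j"
  shows "strand_form \<sigma> (\<gamma> ! i) (strand \<gamma> i) (strand \<gamma> j) = - 2 * crossing_sign T \<gamma> i"
proof -
  have cw: "closed_walk T \<gamma>" using normal_curve_closed_walk[OF \<gamma>(1)] .
  have "transverse_at T (\<gamma> ! i) (strand \<gamma> i) (strand \<gamma> j)"
    using \<gamma> unfolding normal_curve_def by blast
  then show ?thesis
    using strand_form_transverse strand_edges[OF cw \<gamma>(2)] strand_edges[OF cw \<gamma>(3)] \<gamma>(4)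
    unfolding crossing_sign_def travels_positively_iff[OF \<gamma>] by simp
qed

text \<open>The definition of crossing from left to right does not visibly exclude that each strand
  crosses the other in this way; the antisymmetry of \<open>strand_form\<close> does.\<close>

lemma crossing_sign_partner:
  assumes \<gamma>: "normal_curve T \<gamma>" "i < length \<gamma>" "j < length \<gamma>" "\<gamma> ! i = \<gamma> ! j" "i \<noteq> j"
  shows "crossing_sign T \<gamma> j = - crossing_sign T \<gamma> i"
  using strand_form_normal_curve[OF \<gamma>] strand_form_normal_curve[OF \<gamma>(1,3,2) \<gamma>(4)[symmetric] \<gamma>(5)[symmetric]]
    strand_form_antisym[of "\<gamma> ! i" "strand \<gamma> i" "strand \<gamma> j"] \<gamma>(4) by simp

text \<open>Smoothing a crossing replaces the two strands by two that touch without crossing.\<close>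

lemma strand_form_smoothed:
  assumes bound: "\<And>x y z. \<sigma> v x y + \<sigma> v y z + \<sigma> v z x \<le> 1"
    and cr: "crossed_left_to_right T v s t"
    and e: "(v, fst s) \<in> edges T" "(v, snd s) \<in> edges T"
  shows "strand_form \<sigma> v (fst t, snd s) (fst s, snd t) = 0"
proof -
  have ne: "fst s \<noteq> snd s" and l: "fst t \<in> left_side T v (fst s, snd s)" "snd t \<in> left_side T v (snd s, fst s)"
    using cr by (auto simp: crossed_left_to_right_def prod.swap_def)
  \<comment> \<open>The two orientations given by \<open>left_side_orientation\<close> sum to 2, and
    so do the left sides of the two bounds, in which the sign between \<open>fst t\<close> and
    \<open>snd t\<close> cancels. Both bounds are therefore equalities, and subtracting an
    orientation from the second one gives the claim.\<close>
  show ?thesis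
    using left_side_orientation[OF l(1) e ne] left_side_orientation[OF l(2) e(2,1) ne[symmetric]]
      bound[of "snd s" "fst t" "snd t"] bound[of "fst t" "fst s" "snd t"]
      antisym[of v "snd t" "snd s"] antisym[of v "fst t" "fst s"] antisym[of v "snd s" "fst s"]
      antisym[of v "snd t" "fst s"] antisym[of v "fst t" "snd s"] antisym[of v "fst t" "snd t"]
    unfolding strand_form_def fst_conv snd_conv by linarith
qed

lemma form_split:
  assumes \<gamma>: "normal_curve T \<gamma>" and r: "0 < r" "r < length \<gamma>" "\<gamma> ! r = \<gamma> ! 0"
    and pos: "travels_positively T \<gamma> 0"
    and bound: "\<And>v x y z. \<sigma> v x y + \<sigma> v y z + \<sigma> v z x \<le> 1"
  shows "form (verts T) \<sigma> (chain_of \<gamma>) (chain_of (drop r \<gamma>)) =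
    - 2 * (\<Sum>i | i \<in> {1..<r} \<and> \<gamma> ! i \<in> crossings \<gamma>. crossing_sign T \<gamma> i)"
proof -
  let ?n = "length \<gamma>" and ?A = "take r \<gamma>" and ?D = "drop r \<gamma>"
  let ?\<omega> = "\<lambda>i j. strand_form \<sigma> (\<gamma> ! i) (strand \<gamma> i) (strand \<gamma> j)"
  \<comment> \<open>Pairs of distinct passages only. Thus \<open>f\<close> is antisymmetric, and a
    full row has at most one nonzero entry, at the other passage through the same vertex.\<close>
  define f where "f i j = (if i \<noteq> j \<and> \<gamma> ! i = \<gamma> ! j then ?\<omega> i j else 0)" for i j
  have cw: "closed_walk T \<gamma>" using normal_curve_closed_walk[OF \<gamma>] .
  have nonempty: "\<gamma> \<noteq> []" using r by auto
  have V: "set \<gamma> \<subseteq> verts T" using closed_walk_edge(2)[OF cw] by (auto simp: in_set_conv_nth)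
  have VA: "set ?A \<subseteq> verts T" "set ?D \<subseteq> verts T" using V set_take_subset set_drop_subset by fast+
  have ne: "?A \<noteq> []" "?D \<noteq> []" using r by auto
  have partner: "k = 0 \<or> k = r" if "k < ?n" "\<gamma> ! k = \<gamma> ! 0" for k
  proof -
    have "0 < ?n" using r by linarith
    from normal_curve_partner[OF \<gamma> r(2) this that(1) r(3) that(2)] r(1) show ?thesis by blast
  qed
  have "form (verts T) \<sigma> (chain_of \<gamma>) (chain_of ?D) =
      form (verts T) \<sigma> (chain_of ?A) (chain_of ?D) + form (verts T) \<sigma> (chain_of ?D) (chain_of ?D)"
    unfolding chain_of_split[OF r] by (rule form_add_left)
  also have "form (verts T) \<sigma> (chain_of ?D) (chain_of ?D) = 0"
    using form_antisym[of "verts T" "chain_of ?D" "chain_of ?D"] by simp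
  also have "form (verts T) \<sigma> (chain_of ?A) (chain_of ?D) =
    (\<Sum>(i, j) | i < length ?A \<and> j < length ?D \<and> ?A ! i = ?D ! j.
       strand_form \<sigma> (?A ! i) (strand ?A i) (strand ?D j))"
    using form_chain_of[OF ne finite_verts VA] .
  also have "\<dots> = (\<Sum>(i, j) \<in> {..<r} \<times> {..<?n - r}. if \<gamma> ! i = \<gamma> ! (r + j)
       then strand_form \<sigma> (\<gamma> ! i) (strand ?A i) (strand ?D j) else 0)"
    using r by (intro sum.mono_neutral_cong_left) (auto split: if_splits)
  also have "\<dots> = (\<Sum>i<r. \<Sum>j<?n - r. if \<gamma> ! i = \<gamma> ! (r + j)
       then strand_form \<sigma> (\<gamma> ! i) (strand ?A i) (strand ?D j) else 0)"
    by (rule sum.cartesian_product[symmetric])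
  also have "\<dots> = (\<Sum>i\<in>{1..<r}. \<Sum>j<?n - r. f i (r + j))"
  proof -
    \<comment> \<open>At position 0 the arcs exchange their incoming half-edges: each arrives along
      one original strand and leaves along the other. This is the only pair whose strands differ
      from those of \<open>\<gamma>\<close>.\<close>
    have zero: "strand_form \<sigma> (\<gamma> ! 0) (strand ?A 0) (strand ?D 0) = 0"
    proof -
      have "(r + ?n - 1) mod ?n = r - 1" using r by (cases r) simp_all
      then have "fst (strand \<gamma> r) = \<gamma> ! (r - 1)" by (simp only: strand_def fst_conv)
      then have "strand ?A 0 = (fst (strand \<gamma> r), snd (strand \<gamma> 0))"
        using strand_take[OF r(2,1,3)] by (simp only: simp_thms if_True)
      moreover have "fst (strand \<gamma> 0) = \<gamma> ! (?n - 1)" using r by (simp add: strand_def)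
      then have "strand ?D 0 = (fst (strand \<gamma> 0), snd (strand \<gamma> r))"
        using r strand_drop[OF r(1,2) _ r(3), of 0] by simp
      moreover have "crossed_left_to_right T (\<gamma> ! 0) (strand \<gamma> 0) (strand \<gamma> r)"
        using pos travels_positively_iff[OF \<gamma>, of 0 r] r nonempty by auto
      moreover have "(\<gamma> ! 0, fst (strand \<gamma> 0)) \<in> edges T" "(\<gamma> ! 0, snd (strand \<gamma> 0)) \<in> edges T"
        using strand_edges[OF cw, of 0] nonempty by auto
      ultimately show ?thesis using strand_form_smoothed[OF bound] by simp
    qed
    have eq: "(if \<gamma> ! i = \<gamma> ! (r + j) then strand_form \<sigma> (\<gamma> ! i) (strand ?A i) (strand ?D j) else 0) =
        (if i = 0 then 0 else f i (r + j))" if i: "i < r" and j: "j < ?n - r" for i j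
    proof (cases "\<gamma> ! i = \<gamma> ! (r + j)")
      case True
      show ?thesis
      proof (cases "i = 0")
        case i0: True
        then have "r + j = r" using partner[of "r + j"] True j r by auto
        then show ?thesis using i0 True zero by simp
      next
        case False
        have "j \<noteq> 0"
        proof
          assume "j = 0"
          then have "\<gamma> ! i = \<gamma> ! 0" using True r by simp
          then show False using partner[of i] i r False by auto
        qed
        then show ?thesis
          using False True i strand_take[OF r(2) i r(3)] strand_drop[OF r(1,2) j r(3)] by (simp add: f_def)
      qed
    next
      case False
      then show ?thesis by (simp add: f_def)
    qed
    have "(\<Sum>i<r. \<Sum>j<?n - r. if \<gamma> ! i = \<gamma> ! (r + j)
       then strand_form \<sigma> (\<gamma> ! i) (strand ?A i) (strand ?D j) else 0) =
       (\<Sum>i<r. \<Sum>j<?n - r. if i = 0 then 0 else f i (r + j))"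
      by (rule sum.cong[OF HOL.refl], rule sum.cong[OF HOL.refl], rule eq) simp_all
    also have "\<dots> = (\<Sum>i\<in>{1..<r}. \<Sum>j<?n - r. f i (r + j))"
      by (rule sum.mono_neutral_cong_right) auto
    finally show ?thesis .
  qed
  also have "\<dots> = (\<Sum>i\<in>{1..<r}. \<Sum>j\<in>{r..<?n}. f i j)"
  proof (rule sum.cong[OF HOL.refl])
    fix i
    show "(\<Sum>j<?n - r. f i (r + j)) = (\<Sum>j\<in>{r..<?n}. f i j)"
      using r by (intro sum.reindex_bij_witness[of _ "\<lambda>j. j - r" "\<lambda>j. r + j"]) auto
  qed
  \<comment> \<open>Columns inside the first arc may be added because that square block sums to zero
    by antisymmetry; column 0 vanishes since \<open>c\<close> is passed only at 0 and
    \<open>r\<close>. After this, self-crossings of the first arc need no separate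
    treatment.\<close>
  also have "\<dots> = (\<Sum>i\<in>{1..<r}. \<Sum>j<?n. f i j)"
  proof -
    have "f i j = - f j i" for i j
    proof (cases "i \<noteq> j \<and> \<gamma> ! i = \<gamma> ! j")
      case True
      then show ?thesis
        using strand_form_antisym[of "\<gamma> ! j" "strand \<gamma> i" "strand \<gamma> j"] by (simp add: f_def)
    next
      case False
      then show ?thesis by (auto simp: f_def)
    qed
    then have "(\<Sum>i\<in>{1..<r}. \<Sum>j\<in>{1..<r}. f i j) = (\<Sum>i\<in>{1..<r}. \<Sum>j\<in>{1..<r}. - f j i)"
      by (intro sum.cong HOL.refl)
    also have "\<dots> = - (\<Sum>i\<in>{1..<r}. \<Sum>j\<in>{1..<r}. f j i)" by (simp add: sum_negf)
    also have "(\<Sum>i\<in>{1..<r}. \<Sum>j\<in>{1..<r}. f j i) = (\<Sum>i\<in>{1..<r}. \<Sum>j\<in>{1..<r}. f i j)"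
      by (rule sum.swap)
    finally have inner: "(\<Sum>i\<in>{1..<r}. \<Sum>j\<in>{1..<r}. f i j) = 0" by simp
    have "(\<Sum>j<?n. f i j) = (\<Sum>j\<in>{1..<r}. f i j) + (\<Sum>j\<in>{r..<?n}. f i j)" if "i \<in> {1..<r}" for i
    proof -
      have "f i 0 = 0" using partner[of i] that r by (auto simp: f_def)
      moreover have "{..<?n} = insert 0 ({1..<r} \<union> {r..<?n})" using r by auto
      ultimately show ?thesis by (simp add: sum.union_disjoint r)
    qed
    then show ?thesis using inner by (simp add: sum.distrib)
  qed
  also have "\<dots> = (\<Sum>i\<in>{1..<r}. if \<gamma> ! i \<in> crossings \<gamma> then - 2 * crossing_sign T \<gamma> i else 0)"
  proof (rule sum.cong[OF HOL.refl])
    fix i assume "i \<in> {1..<r}"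
    then have i: "i < ?n" using r by simp
    show "(\<Sum>j<?n. f i j) = (if \<gamma> ! i \<in> crossings \<gamma> then - 2 * crossing_sign T \<gamma> i else 0)"
    proof (cases "\<gamma> ! i \<in> crossings \<gamma>")
      case True
      then obtain k l where "k < ?n" "l < ?n" "k \<noteq> l" "\<gamma> ! k = \<gamma> ! i" "\<gamma> ! l = \<gamma> ! i"
        unfolding crossings_def by blast
      then obtain j where j: "j < ?n" "j \<noteq> i" "\<gamma> ! i = \<gamma> ! j" by metis
      have "f i k = (if k = j then ?\<omega> i j else 0)" if "k < ?n" for k
        using normal_curve_partner[OF \<gamma> i j(1) that j(3)] j by (auto simp: f_def)
      then have "(\<Sum>k<?n. f i k) = ?\<omega> i j" using j(1) by simp
      then show ?thesis using strand_form_normal_curve[OF \<gamma> i j(1,3)] j(2) True by simp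
    next
      case False
      then have "f i j = 0" if "j < ?n" for j using that i unfolding f_def crossings_def by auto
      then show ?thesis using False by simp
    qed
  qed
  also have "\<dots> = (\<Sum>i | i \<in> {1..<r} \<and> \<gamma> ! i \<in> crossings \<gamma>. - 2 * crossing_sign T \<gamma> i)"
    by (rule sum.mono_neutral_cong_right) auto
  finally show ?thesis by (simp add: sum_distrib_left)
qed

end

section \<open>The split curve and the subword of the crossing\<close>

context link_order
begin

text \<open>The definite description requires uniqueness: the base point must be the positive
  passage of \<open>c\<close>, and the cut must be at the only other passage.\<close>

lemma split_curve_eq_drop:
  assumes \<gamma>: "normal_curve T \<gamma>" and c: "c \<in> crossings \<gamma>"
  shows "\<exists>k r. 0 < r \<and> r < length \<gamma> \<and> rotate k \<gamma> ! 0 = c \<and> rotate k \<gamma> ! r = c \<and>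
    travels_positively T (rotate k \<gamma>) 0 \<and> split_curve T \<gamma> c = drop r (rotate k \<gamma>)"
proof -
  let ?n = "length \<gamma>"
  obtain i j where ij: "i < ?n" "j < ?n" "i \<noteq> j" "\<gamma> ! i = c" "\<gamma> ! j = c"
    using c unfolding crossings_def by blast
  then have "transverse_at T c (strand \<gamma> i) (strand \<gamma> j)"
    using \<gamma> unfolding normal_curve_def by metis
  then have "travels_positively T \<gamma> i \<or> travels_positively T \<gamma> j"
    using travels_positively_iff[OF \<gamma>, of i j] travels_positively_iff[OF \<gamma>, of j i] ij
    unfolding transverse_at_def by auto
  then obtain p q where p: "p < ?n" "\<gamma> ! p = c" "travels_positively T \<gamma> p"
    and q: "q < ?n" "\<gamma> ! q = c" "q \<noteq> p"
    using ij by metis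
  have n: "0 < ?n" using p by linarith
  let ?\<delta> = "rotate p \<gamma>"
  obtain r where r: "r < ?n" "(p + r) mod ?n = q"
    using ex_rotation[of ?n "\<lambda>j. j = q" p] q(1) by blast
  have r0: "0 < r"
  proof (rule ccontr)
    assume "\<not> 0 < r"
    then show False using r(2) p(1) q(3) by simp
  qed
  have \<delta>: "?\<delta> ! 0 = c" "?\<delta> ! r = c" "travels_positively T ?\<delta> 0"
    using nth_rotate[OF n, of p] nth_rotate[OF r(1), of p] r(2) p q travels_positively_rotate[OF n, of T p] by simp_all
  have split: "splitting T \<gamma> c (take r ?\<delta>) (drop r ?\<delta>)"
    unfolding splitting_def
  proof (intro exI[of _ p] conjI)
    show "take r ?\<delta> \<noteq> []" "drop r ?\<delta> \<noteq> []" using r0 r(1) by auto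
    show "hd (take r ?\<delta>) = c" using \<delta>(1) r0 n by (simp add: hd_conv_nth)
    show "hd (drop r ?\<delta>) = c" using \<delta>(2) r(1) by (simp add: hd_drop_conv_nth)
  qed (use \<delta> in simp_all)
  have "\<beta> = drop r ?\<delta>" if \<beta>: "splitting T \<gamma> c \<alpha> \<beta>" for \<alpha> \<beta>
  proof -
    obtain k where k: "rotate k \<gamma> = \<alpha> @ \<beta>" "\<alpha> \<noteq> []" "hd \<alpha> = c" "\<beta> \<noteq> []" "hd \<beta> = c"
      "travels_positively T (rotate k \<gamma>) 0"
      using \<beta> unfolding splitting_def by blast
    let ?k = "k mod ?n"
    have "rotate k \<gamma> ! 0 = c" using k(1-3) by (simp add: hd_conv_nth nth_append)
    then have kc: "?k < ?n" "\<gamma> ! ?k = c" "travels_positively T \<gamma> ?k"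
      using nth_rotate[OF n, of k] k(6) travels_positively_rotate[OF n, of T k] n by simp_all
    \<comment> \<open>Two passages through one crossing have opposite signs, so a second positive
      starting point is impossible; \<open>k\<close> itself is determined only modulo the
      length.\<close>
    have "?k = p"
    proof (rule ccontr)
      assume "?k \<noteq> p"
      then show False
        using crossing_sign_partner[OF \<gamma> kc(1) p(1)] kc p unfolding crossing_sign_def by simp
    qed
    then have \<delta>_eq: "?\<delta> = \<alpha> @ \<beta>" using k(1) rotate_conv_mod[of k \<gamma>] by simp
    let ?s = "length \<alpha>"
    have "length ?\<delta> = length \<alpha> + length \<beta>" unfolding \<delta>_eq by simp
    then have s: "?s < ?n" "?s \<noteq> 0" using k(2,4) by simp_all
    have "?\<delta> ! ?s = c" unfolding \<delta>_eq using k(4,5) by (simp add: hd_conv_nth nth_append)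
    then have "?s = 0 \<or> ?s = r"
      using normal_curve_partner[OF normal_curve_rotate[OF \<gamma>], of 0 p r ?s] \<delta> s(1) r(1) r0 n by simp
    then have "?s = r" using s(2) by simp
    then show ?thesis unfolding \<delta>_eq by simp
  qed
  then have "split_curve T \<gamma> c = drop r ?\<delta>"
    unfolding split_curve_def using split by (intro the_equality) blast+
  then show ?thesis using r0 r(1) \<delta> by blast
qed

end

text \<open>Each symbol occurs once, so the position of \<open>(i, 1)\<close> fixes the rotation and
  that of \<open>(i, - 1)\<close> then fixes the end of the subword. The union in the definition
  thus has a single member.\<close>

lemma symbols_between_eq:
  assumes "distinct w" and w: "rotate k w = (i, 1) # u @ (i, - 1) # u'"
  shows "symbols_between w i = set u"
proof -
  have "v = u" if v: "rotate l w = (i, 1) # v @ (i, - 1) # v'" for l v v'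
  proof -
    have n: "0 < length w" using arg_cong[OF w, of length] by simp
    have "w ! (k mod length w) = w ! (l mod length w)"
      using nth_rotate[OF n, of k] nth_rotate[OF n, of l] w v by simp
    then have "k mod length w = l mod length w"
      using \<open>distinct w\<close> n by (simp add: nth_eq_iff_index_eq)
    then have "rotate k w = rotate l w" using rotate_conv_mod by metis
    then have eq: "u @ (i, - 1) # u' = v @ (i, - 1) # v'" using w v by simp
    have "distinct (rotate k w)" "distinct (rotate l w)" using \<open>distinct w\<close> by simp_all
    then have "(i, - 1) \<notin> set u" "(i, - 1) \<notin> set u'" "(i, - 1) \<notin> set v" "(i, - 1) \<notin> set v'"
      unfolding w v by auto
    then show ?thesis using eq append_Cons_eq_iff[of "(i, - 1)" u u' v v'] by simp
  qed
  then show ?thesis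
    unfolding symbols_between_def using w by blast
qed

lemma gauss_word_split:
  assumes r: "0 < r" "r < length \<gamma>" and c: "\<gamma> ! 0 \<in> crossings \<gamma>" "\<gamma> ! r = \<gamma> ! 0"
    and pos: "travels_positively T \<gamma> 0" "\<not> travels_positively T \<gamma> r"
  shows "\<exists>u'. gauss_word T L \<gamma> = (L (\<gamma> ! 0), 1) #
    map (\<lambda>i. (L (\<gamma> ! i), crossing_sign T \<gamma> i)) (filter (\<lambda>i. \<gamma> ! i \<in> crossings \<gamma>) [1..<r]) @ (L (\<gamma> ! 0), - 1) # u'"
proof -
  have "[0..<length \<gamma>] = 0 # [1..<r] @ r # [Suc r..<length \<gamma>]"
    using r upt_add_eq_append[of 0 r "length \<gamma> - r"] by (simp add: upt_conv_Cons)
  then show ?thesis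
    unfolding gauss_word_def using c pos by (simp add: crossing_sign_def)
qed

theorem corollary4:
  fixes n :: nat and w :: "(nat \<times> int) list"
    and T :: "'v::infinite triangles" and \<gamma> :: "'v list" and L :: "'v \<Rightarrow> nat"
  assumes "signed_gauss_word n w"
    and "minimal_realization n w T \<gamma> L"
  shows "\<forall>i\<in>{1..n}. alpha T \<gamma> L i = (\<Sum>(a, p)\<in>symbols_between w i. p)"
proof
  fix i assume i: "i \<in> {1..n}"
  have surf: "closed_connected_surface T" and \<gamma>: "normal_curve T \<gamma>"
    and L: "bij_betw L (crossings \<gamma>) {1..n}" and gw: "\<exists>k. gauss_word T L \<gamma> = rotate k w"
    using assms(2) unfolding minimal_realization_def realization_def by blast+
  obtain \<sigma> where "link_order T \<sigma>" and bound: "\<And>v x y z. \<sigma> v x y + \<sigma> v y z + \<sigma> v z x \<le> 1"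
    using link_order_exists[OF surf] by blast
  then interpret link_order T \<sigma> by simp
  define c where "c = inv_into (crossings \<gamma>) L i"
  have c: "c \<in> crossings \<gamma>" "L c = i"
    using L i unfolding c_def bij_betw_def by (metis inv_into_into, metis f_inv_into_f)
  obtain k r where r: "0 < r" "r < length \<gamma>" and k: "rotate k \<gamma> ! 0 = c" "rotate k \<gamma> ! r = c"
    "travels_positively T (rotate k \<gamma>) 0" and split: "split_curve T \<gamma> c = drop r (rotate k \<gamma>)"
    using split_curve_eq_drop[OF \<gamma> c(1)] by blast
  let ?\<delta> = "rotate k \<gamma>"
  let ?C = "crossings ?\<delta>" and ?s = "crossing_sign T ?\<delta>"
  have \<delta>: "normal_curve T ?\<delta>" using normal_curve_rotate[OF \<gamma>] .
  have rd: "r < length ?\<delta>" "?\<delta> ! r = ?\<delta> ! 0" "0 < length ?\<delta>"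
    using r k by (simp, simp, unfold length_rotate, linarith)
  have cw: "closed_walk T ?\<delta>" "closed_walk T (drop r ?\<delta>)"
    using normal_curve_closed_walk[OF \<delta>] closed_walk_drop rd by blast+
  have "form (verts T) \<sigma> (chain_of ?\<delta>) (chain_of (drop r ?\<delta>)) = - 2 * alpha T \<gamma> L i"
    using form_eq_hom_intersection[OF cycles1_chain_of[OF cw(1)] cycles1_chain_of[OF cw(2)]
        transverse_representatives[OF surf cw]]
    unfolding alpha_def c_def[symmetric] split chain_of_rotate .
  \<comment> \<open>The form is evaluated in two ways, through the homology classes and crossing by
    crossing; both results carry the factor - 2, which cancels.\<close>
  then have alpha: "alpha T \<gamma> L i = (\<Sum>j | j \<in> {1..<r} \<and> ?\<delta> ! j \<in> ?C. ?s j)"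
    using form_split[OF \<delta> r(1) rd(1,2) k(3) bound] by simp
  \<comment> \<open>The curve starts at the positive passage, so the passage at \<open>r\<close>
    writes the inverse symbol, and positions strictly between 0 and \<open>r\<close> spell exactly
    the subword.\<close>
  have "?s r = - 1"
    using crossing_sign_partner[OF \<delta> rd(3,1)] rd(2) r k(3) by (simp add: crossing_sign_def)
  then have neg: "\<not> travels_positively T ?\<delta> r" by (auto simp: crossing_sign_def)
  let ?u = "map (\<lambda>j. (L (?\<delta> ! j), ?s j)) (filter (\<lambda>j. ?\<delta> ! j \<in> ?C) [1..<r])"
  have "?\<delta> ! 0 \<in> ?C" using k c(1) crossings_rotate by metis
  then obtain u' where "gauss_word T L ?\<delta> = (i, 1) # ?u @ (i, - 1) # u'"
    using gauss_word_split[OF r(1) rd(1) _ rd(2) k(3) neg, of L] unfolding k(1) c(2) by blast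
  moreover obtain l where "gauss_word T L ?\<delta> = rotate l w"
    using gauss_word_rotate[of T L k \<gamma>] gw rotate_rotate by metis
  ultimately have w: "rotate l w = (i, 1) # ?u @ (i, - 1) # u'" by simp
  have dw: "distinct w" using assms(1) by (simp add: signed_gauss_word_def)
  then have "distinct (rotate l w)" by simp
  then have "distinct ?u" unfolding w by simp
  \<comment> \<open>Distinctness of the symbols turns the sum over a set into a sum over positions,
    where both exponents of a letter occurring twice are kept and cancel.\<close>
  have "(\<Sum>(a, p)\<in>symbols_between w i. p) = (\<Sum>x\<in>set ?u. snd x)"
    unfolding symbols_between_eq[OF dw w] by (rule sum.cong) auto
  also have "\<dots> = sum_list (map snd ?u)"
    by (rule sum_list_distinct_conv_sum_set[OF \<open>distinct ?u\<close>, symmetric])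
  also have "\<dots> = sum_list (map ?s (filter (\<lambda>j. ?\<delta> ! j \<in> ?C) [1..<r]))"
    by (simp add: comp_def)
  also have "\<dots> = (\<Sum>j\<in>set (filter (\<lambda>j. ?\<delta> ! j \<in> ?C) [1..<r]). ?s j)"
    by (intro sum_list_distinct_conv_sum_set) simp
  also have "set (filter (\<lambda>j. ?\<delta> ! j \<in> ?C) [1..<r]) = {j \<in> {1..<r}. ?\<delta> ! j \<in> ?C}"
    by auto
  finally show "alpha T \<gamma> L i = (\<Sum>(a, p)\<in>symbols_between w i. p)"
    using alpha by simp
qed

end
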